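(* Let $\mathcal{C}$ be a pre-triangulated category and let $\mathcal{D}$ be an idempotent complete suspended category. Let $F\dashv G:\mathcal{D}\to\mathcal{C}$ be an adjunction of functors commuting with suspension. Suppose that the stable monad $GF:\mathcal{C}\to\mathcal{C}$ is an exact functor and that $G$ is a stably semiseparable functor, and let $e:\mathrm{Id}_{\mathcal{D}}\to\mathrm{Id}_{\mathcal{D}}$ be the idempotent natural transformation associated to $G$. Then the Eilenberg–Moore category $\mathcal{C}_{GF}$ (with the suspension $\Sigma_{GF}$ induced by that of $\mathcal{C}$) is idempotent complete and pre-triangulated with distinguished triangles being exactly the ones whose image through the forgetful functor $U_{GF}:\mathcal{C}_{GF}\to\mathcal{C}$ is distinguished in $\mathcal{C}$. Moreover, with respect to this pre-triangulation, both the functor $U_{GF}:\mathcal{C}_{GF}\to\mathcal{C}$ and its left adjoint $V_{GF}:\mathcal{C}\to\mathcal{C}_{GF}$ become exact. Furthermore, there is a unique exact equivalence of categories $(K_{GF})_e:\mathcal{D}_e\to\mathcal{C}_{GF}$ such that $(K_{GF})_e\circ H=K_{GF}$ and $U_{GF}\circ(K_{GF})_e=G_e$.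
   Context: Suspended categories. A suspended category $(\mathcal{C},\Sigma)$ is an additive category $\mathcal{C}$ with an autoequivalence $\Sigma:\mathcal{C}\to\mathcal{C}$, the suspension, which is taken to be an isomorphism of categories ($\Sigma^{-1}\Sigma=\mathrm{Id}=\Sigma\Sigma^{-1}$). All suspensions are denoted by $\Sigma$. A functor $T$ between suspended categories commutes with suspension if $T\circ\Sigma=\Sigma\circ T$; a natural transformation $\alpha$ between such functors commutes with suspension if $\alpha\Sigma=\Sigma\alpha$. An adjunction of functors commuting with suspension is an adjunction $F\dashv G:\mathcal{D}\to\mathcal{C}$ (so $F:\mathcal{C}\to\mathcal{D}$ is left adjoint to $G$) between suspended categories such that $F$, $G$, the unit $\eta$ and the counit $\epsilon$ commute with suspension; then the monad $(GF,G\epsilon F,\eta)$ is stable, i.e. its functor, multiplication and unit commute with suspension. Pre-triangulated categories. A triangle in $(\mathcal{C},\Sigma)$ is a diagram $X\xrightarrow{u}Y\xrightarrow{v}Z\xrightarrow{w}\Sigma X$. A pre-triangulated category is a suspended category with a class of triangles, called distinguished, such that: any triangle isomorphic to a distinguished one is distinguished, and $X\xrightarrow{\mathrm{Id}}X\to0\to\Sigma X$ is distinguished; every morphism $u:X\to Y$ fits into a distinguished triangle $X\xrightarrow{u}Y\to Z\to\Sigma X$; $X\xrightarrow{u}Y\xrightarrow{v}Z\xrightarrow{w}\Sigma X$ is distinguished iff $Y\xrightarrow{-v}Z\xrightarrow{-w}\Sigma X\xrightarrow{-\Sigma u}\Sigma Y$ is; and for distinguished triangles $(u,v,w)$ and $(u',v',w')$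 and $f:X\to X'$, $g:Y\to Y'$ with $gu=u'f$ there is $h:Z\to Z'$ with $hv=v'g$ and $(\Sigma f)w=w'h$ (i.e. the axioms of a triangulated category without the octahedral axiom). A functor between pre-triangulated categories is exact if it commutes with the suspension and preserves distinguished triangles. Semiseparability. A functor $G:\mathcal{D}\to\mathcal{C}$ is semiseparable if there is a natural transformation $\mathcal{P}:\mathrm{Hom}_{\mathcal{C}}(G-,G-)\to\mathrm{Hom}_{\mathcal{D}}(-,-)$ with $\mathcal{G}\circ\mathcal{P}\circ\mathcal{G}=\mathcal{G}$, where $\mathcal{G}_{X,Y}(f)=G(f)$. If $\mathcal{C},\mathcal{D}$ are suspended and $G$ commutes with suspension, $G$ is stably semiseparable if it is semiseparable through some $\mathcal{P}$ with $\Sigma(\mathcal{P}_{X,Y}(g))=\mathcal{P}_{\Sigma X,\Sigma Y}(\Sigma g)$ for all $g:GX\to GY$. The associated idempotent natural transformation of a semiseparable $G$ is $e:\mathrm{Id}_{\mathcal{D}}\to\mathrm{Id}_{\mathcal{D}}$, $e_X=\mathcal{P}_{X,X}(\mathrm{Id}_{GX})$; it does not depend on $\mathcal{P}$, and is the unique idempotent natural transformation with $Ge=\mathrm{Id}_G$ such that for $f,g:A\to B$ in $\mathcal{D}$ one has $Gf=Gg$ iff $e_B\circ f=e_B\circ g$. If $G$ is stably semiseparable then $e\Sigma=\Sigma e$. Coidentifier. $\mathcal{D}_e$ is the quotient category $\mathcal{D}/\!\sim$ with the same objects, where $f\sim g$ (for $f,g:A\to B$) iff $e_B\circ f=e_B\circ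 g$; $H:\mathcal{D}\to\mathcal{D}_e$, the quotient functor, is the identity on objects and $f\mapsto\overline f$. $\mathcal{D}_e$ carries the induced additive structure $\overline f+\overline g=\overline{f+g}$ and the suspension $\Sigma_e$ with $\Sigma_eX=\Sigma X$, $\Sigma_e\overline f=\overline{\Sigma f}$. $G_e:\mathcal{D}_e\to\mathcal{C}$ is the unique functor with $G=G_e\circ H$. Under the hypotheses of the claim, $\mathcal{D}_e$ is regarded as a pre-triangulated category whose distinguished triangles are exactly those whose image under $G_e$ is distinguished in $\mathcal{C}$. Eilenberg–Moore category. $\mathcal{C}_{GF}$ is the category of modules (algebras) over the monad $(GF,G\epsilon F,\eta)$, with forgetful functor $U_{GF}$, free functor $V_{GF}:C\mapsto(GFC,G\epsilon_{FC})$, $f\mapsto GF(f)$, and comparison functor $K_{GF}:\mathcal{D}\to\mathcal{C}_{GF}$, $D\mapsto(GD,G\epsilon_D)$, $f\mapsto G(f)$. It is a suspended category with suspension $\Sigma_{GF}(C,\mu)=(\Sigma C,\Sigma\mu)$, $\Sigma_{GF}f=\Sigma f$. A category is idempotent complete if all its idempotent morphisms split. *)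

theory Defs
  imports "HOL-Algebra.Group"
begin

text \<open>
  Categories are given by explicit carriers of objects and arrows, every arrow having a unique
  domain and codomain. Values outside the carriers are irrelevant, so functors are compared with
  \<open>functor_eq\<close> below and not with HOL equality.
\<close>

record ('o, 'm) category_data =
  Ob :: "'o set"
  Arr :: "'m set"
  Dom :: "'m \<Rightarrow> 'o"
  Cod :: "'m \<Rightarrow> 'o"
  Idt :: "'o \<Rightarrow> 'm"
  Comp :: "'m \<Rightarrow> 'm \<Rightarrow> 'm" (infixl "\<cdot>\<index>" 70)

definition Hom :: "('o, 'm, 'z) category_data_scheme \<Rightarrow> 'o \<Rightarrow> 'o \<Rightarrow> 'm set" where
  "Hom C X Y = {f \<in> Arr C. Dom C f = X \<and> Cod C f = Y}"

locale category =
  fixes C :: "('o, 'm, 'z) category_data_scheme" (structure)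
  assumes Dom_Ob: "f \<in> Arr C \<Longrightarrow> Dom C f \<in> Ob C"
    and Cod_Ob: "f \<in> Arr C \<Longrightarrow> Cod C f \<in> Ob C"
    and Idt_Hom: "X \<in> Ob C \<Longrightarrow> Idt C X \<in> Hom C X X"
    and Comp_Hom: "f \<in> Hom C X Y \<Longrightarrow> g \<in> Hom C Y Z \<Longrightarrow> g \<cdot> f \<in> Hom C X Z"
    and Comp_assoc: "f \<in> Hom C W X \<Longrightarrow> g \<in> Hom C X Y \<Longrightarrow> h \<in> Hom C Y Z
                       \<Longrightarrow> (h \<cdot> g) \<cdot> f = h \<cdot> (g \<cdot> f)"
    and Idt_left: "f \<in> Hom C X Y \<Longrightarrow> Idt C Y \<cdot> f = f"
    and Idt_right: "f \<in> Hom C X Y \<Longrightarrow> f \<cdot> Idt C X = f"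

definition iso_arr :: "('o, 'm, 'z) category_data_scheme \<Rightarrow> 'm \<Rightarrow> bool" where
  "iso_arr C f \<longleftrightarrow> f \<in> Arr C \<and>
     (\<exists>g \<in> Hom C (Cod C f) (Dom C f).
        g \<cdot>\<^bsub>C\<^esub> f = Idt C (Dom C f) \<and> f \<cdot>\<^bsub>C\<^esub> g = Idt C (Cod C f))"

definition idempotent_complete :: "('o, 'm, 'z) category_data_scheme \<Rightarrow> bool" where
  "idempotent_complete C \<longleftrightarrow>
     (\<forall>X \<in> Ob C. \<forall>p \<in> Hom C X X. p \<cdot>\<^bsub>C\<^esub> p = p \<longrightarrow>
        (\<exists>Y \<in> Ob C. \<exists>r \<in> Hom C X Y. \<exists>s \<in> Hom C Y X. s \<cdot>\<^bsub>C\<^esub> r = p \<and> r \<cdot>\<^bsub>C\<^esub> s = Idt C Y))"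

record ('oa, 'ma, 'ob, 'mb) functor_data =
  fob :: "'oa \<Rightarrow> 'ob"
  far :: "'ma \<Rightarrow> 'mb"

locale cat_functor = A: category A + B: category B
  for A :: "('oa, 'ma, 'za) category_data_scheme" and B :: "('ob, 'mb, 'zb) category_data_scheme" +
  fixes F :: "('oa, 'ma, 'ob, 'mb) functor_data"
  assumes fob_Ob: "X \<in> Ob A \<Longrightarrow> fob F X \<in> Ob B"
    and far_Hom: "f \<in> Hom A X Y \<Longrightarrow> far F f \<in> Hom B (fob F X) (fob F Y)"
    and far_Idt: "X \<in> Ob A \<Longrightarrow> far F (Idt A X) = Idt B (fob F X)"
    and far_Comp: "f \<in> Hom A X Y \<Longrightarrow> g \<in> Hom A Y Z
                     \<Longrightarrow> far F (g \<cdot>\<^bsub>A\<^esub> f) = far F g \<cdot>\<^bsub>B\<^esub> far F f"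

definition functor_eq ::
  "('oa, 'ma, 'za) category_data_scheme \<Rightarrow> ('oa, 'ma, 'ob, 'mb) functor_data
     \<Rightarrow> ('oa, 'ma, 'ob, 'mb) functor_data \<Rightarrow> bool" where
  "functor_eq A F G \<longleftrightarrow> (\<forall>X \<in> Ob A. fob F X = fob G X) \<and> (\<forall>f \<in> Arr A. far F f = far G f)"

definition id_functor :: "('o, 'm, 'o, 'm) functor_data" where
  "id_functor = \<lparr>fob = (\<lambda>X. X), far = (\<lambda>f. f)\<rparr>"

definition comp_functor ::
  "('ob, 'mb, 'oc, 'mc) functor_data \<Rightarrow> ('oa, 'ma, 'ob, 'mb) functor_data
     \<Rightarrow> ('oa, 'ma, 'oc, 'mc) functor_data" (infixl "\<circ>\<^sub>F" 75) where
  "G \<circ>\<^sub>F F = \<lparr>fob = (\<lambda>X. fob G (fob F X)), far = (\<lambda>f. far G (far F f))\<rparr>"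

locale nat_trans = F: cat_functor A B F + G: cat_functor A B G
  for A :: "('oa, 'ma, 'za) category_data_scheme" and B :: "('ob, 'mb, 'zb) category_data_scheme"
    and F G :: "('oa, 'ma, 'ob, 'mb) functor_data" +
  fixes \<alpha> :: "'oa \<Rightarrow> 'mb"
  assumes component_Hom: "X \<in> Ob A \<Longrightarrow> \<alpha> X \<in> Hom B (fob F X) (fob G X)"
    and naturality: "f \<in> Hom A X Y \<Longrightarrow> \<alpha> Y \<cdot>\<^bsub>B\<^esub> far F f = far G f \<cdot>\<^bsub>B\<^esub> \<alpha> X"

definition nat_isomorphic ::
  "('oa, 'ma, 'za) category_data_scheme \<Rightarrow> ('ob, 'mb, 'zb) category_data_scheme
     \<Rightarrow> ('oa, 'ma, 'ob, 'mb) functor_data \<Rightarrow> ('oa, 'ma, 'ob, 'mb) functor_data \<Rightarrow> bool" where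
  "nat_isomorphic A B F G \<longleftrightarrow> (\<exists>\<alpha>. nat_trans A B F G \<alpha> \<and> (\<forall>X \<in> Ob A. iso_arr B (\<alpha> X)))"

definition cat_equivalence ::
  "('oa, 'ma, 'za) category_data_scheme \<Rightarrow> ('ob, 'mb, 'zb) category_data_scheme
     \<Rightarrow> ('oa, 'ma, 'ob, 'mb) functor_data \<Rightarrow> bool" where
  "cat_equivalence A B F \<longleftrightarrow> cat_functor A B F \<and>
     (\<exists>F'. cat_functor B A F' \<and> nat_isomorphic A A id_functor (F' \<circ>\<^sub>F F)
           \<and> nat_isomorphic B B (F \<circ>\<^sub>F F') id_functor)"

locale adjunction =
  unit: nat_trans C C id_functor "G \<circ>\<^sub>F F" \<eta> + counit: nat_trans D D "F \<circ>\<^sub>F G" id_functor \<epsilon> +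
  F: cat_functor C D F + G: cat_functor D C G
  for C :: "('oc, 'mc, 'zc) category_data_scheme" and D :: "('od, 'md, 'zd) category_data_scheme"
    and F :: "('oc, 'mc, 'od, 'md) functor_data" and G :: "('od, 'md, 'oc, 'mc) functor_data"
    and \<eta> :: "'oc \<Rightarrow> 'mc" and \<epsilon> :: "'od \<Rightarrow> 'md" +
  assumes triangle_F: "X \<in> Ob C \<Longrightarrow> \<epsilon> (fob F X) \<cdot>\<^bsub>D\<^esub> far F (\<eta> X) = Idt D (fob F X)"
    and triangle_G: "Y \<in> Ob D \<Longrightarrow> far G (\<epsilon> Y) \<cdot>\<^bsub>C\<^esub> \<eta> (fob G Y) = Idt C (fob G Y)"

definition left_adjoint ::
  "('oc, 'mc, 'zc) category_data_scheme \<Rightarrow> ('od, 'md, 'zd) category_data_scheme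
     \<Rightarrow> ('oc, 'mc, 'od, 'md) functor_data \<Rightarrow> ('od, 'md, 'oc, 'mc) functor_data \<Rightarrow> bool" where
  "left_adjoint C D F G \<longleftrightarrow> (\<exists>\<eta> \<epsilon>. adjunction C D F G \<eta> \<epsilon>)"

record ('o, 'm) additive_data = "('o, 'm) category_data" +
  Zer :: "'o \<Rightarrow> 'o \<Rightarrow> 'm"
  Add :: "'m \<Rightarrow> 'm \<Rightarrow> 'm" (infixl "\<boxplus>\<index>" 65)

definition hom_group :: "('o, 'm, 'z) additive_data_scheme \<Rightarrow> 'o \<Rightarrow> 'o \<Rightarrow> 'm monoid" where
  "hom_group C X Y = \<lparr>carrier = Hom C X Y, mult = Add C, one = Zer C X Y\<rparr>"

definition Neg :: "('o, 'm, 'z) additive_data_scheme \<Rightarrow> 'm \<Rightarrow> 'm" where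
  "Neg C f = m_inv (hom_group C (Dom C f) (Cod C f)) f"

definition zero_object :: "('o, 'm, 'z) category_data_scheme \<Rightarrow> 'o \<Rightarrow> bool" where
  "zero_object C N \<longleftrightarrow> N \<in> Ob C \<and> (\<forall>X \<in> Ob C. (\<exists>!f. f \<in> Hom C X N) \<and> (\<exists>!f. f \<in> Hom C N X))"

locale additive_category = category C
  for C :: "('o, 'm, 'z) additive_data_scheme" (structure) +
  assumes hom_comm_group: "X \<in> Ob C \<Longrightarrow> Y \<in> Ob C \<Longrightarrow> comm_group (hom_group C X Y)"
    and Comp_Add_right: "f \<in> Hom C X Y \<Longrightarrow> f' \<in> Hom C X Y \<Longrightarrow> g \<in> Hom C Y Z
                           \<Longrightarrow> g \<cdot> (f \<boxplus> f') = (g \<cdot> f) \<boxplus> (g \<cdot> f')"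
    and Comp_Add_left: "f \<in> Hom C X Y \<Longrightarrow> g \<in> Hom C Y Z \<Longrightarrow> g' \<in> Hom C Y Z
                           \<Longrightarrow> (g \<boxplus> g') \<cdot> f = (g \<cdot> f) \<boxplus> (g' \<cdot> f)"
    and ex_zero_object: "\<exists>N. zero_object C N"
    and ex_biproduct: "X \<in> Ob C \<Longrightarrow> Y \<in> Ob C \<Longrightarrow>
          \<exists>B \<in> Ob C. \<exists>i \<in> Hom C X B. \<exists>j \<in> Hom C Y B. \<exists>p \<in> Hom C B X. \<exists>q \<in> Hom C B Y.
            p \<cdot> i = Idt C X \<and> q \<cdot> j = Idt C Y \<and> p \<cdot> j = Zer C Y X \<and> q \<cdot> i = Zer C X Y \<and>
            (i \<cdot> p) \<boxplus> (j \<cdot> q) = Idt C B"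

record ('o, 'm) suspended_data = "('o, 'm) additive_data" +
  Susp :: "('o, 'm, 'o, 'm) functor_data"

locale suspended_category = additive_category C + Susp: cat_functor C C "Susp C"
  for C :: "('o, 'm, 'z) suspended_data_scheme" (structure) +
  assumes Susp_invertible: "\<exists>S. cat_functor C C S \<and> functor_eq C (S \<circ>\<^sub>F Susp C) id_functor
                                 \<and> functor_eq C (Susp C \<circ>\<^sub>F S) id_functor"

definition functor_commutes_Susp ::
  "('oa, 'ma, 'za) suspended_data_scheme \<Rightarrow> ('ob, 'mb, 'zb) suspended_data_scheme
     \<Rightarrow> ('oa, 'ma, 'ob, 'mb) functor_data \<Rightarrow> bool" where
  "functor_commutes_Susp A B F \<longleftrightarrow> functor_eq A (F \<circ>\<^sub>F Susp A) (Susp B \<circ>\<^sub>F F)"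

definition nat_trans_commutes_Susp ::
  "('oa, 'ma, 'za) suspended_data_scheme \<Rightarrow> ('ob, 'mb, 'zb) suspended_data_scheme
     \<Rightarrow> ('oa \<Rightarrow> 'mb) \<Rightarrow> bool" where
  "nat_trans_commutes_Susp A B \<alpha> \<longleftrightarrow> (\<forall>X \<in> Ob A. \<alpha> (fob (Susp A) X) = far (Susp B) (\<alpha> X))"

locale suspended_adjunction =
  C: suspended_category C + D: suspended_category D + adjunction C D F G \<eta> \<epsilon>
  for C :: "('oc, 'mc, 'zc) suspended_data_scheme" and D :: "('od, 'md, 'zd) suspended_data_scheme"
    and F :: "('oc, 'mc, 'od, 'md) functor_data" and G :: "('od, 'md, 'oc, 'mc) functor_data"
    and \<eta> :: "'oc \<Rightarrow> 'mc" and \<epsilon> :: "'od \<Rightarrow> 'md" +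
  assumes F_Susp: "functor_commutes_Susp C D F"
    and G_Susp: "functor_commutes_Susp D C G"
    and unit_Susp: "nat_trans_commutes_Susp C C \<eta>"
    and counit_Susp: "nat_trans_commutes_Susp D D \<epsilon>"

definition is_triangle :: "('o, 'm, 'z) suspended_data_scheme \<Rightarrow> 'm \<Rightarrow> 'm \<Rightarrow> 'm \<Rightarrow> bool" where
  "is_triangle C u v w \<longleftrightarrow> u \<in> Arr C \<and> v \<in> Arr C \<and> w \<in> Arr C \<and>
     Dom C v = Cod C u \<and> Dom C w = Cod C v \<and> Cod C w = fob (Susp C) (Dom C u)"

definition triangle_map ::
  "('o, 'm, 'z) suspended_data_scheme \<Rightarrow> 'm \<times> 'm \<times> 'm \<Rightarrow> 'm \<times> 'm \<times> 'm
     \<Rightarrow> 'm \<Rightarrow> 'm \<Rightarrow> 'm \<Rightarrow> bool" where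
  "triangle_map C = (\<lambda>(u, v, w) (u', v', w') f g h.
     f \<in> Hom C (Dom C u) (Dom C u') \<and> g \<in> Hom C (Dom C v) (Dom C v') \<and>
     h \<in> Hom C (Dom C w) (Dom C w') \<and>
     g \<cdot>\<^bsub>C\<^esub> u = u' \<cdot>\<^bsub>C\<^esub> f \<and> h \<cdot>\<^bsub>C\<^esub> v = v' \<cdot>\<^bsub>C\<^esub> g \<and> far (Susp C) f \<cdot>\<^bsub>C\<^esub> w = w' \<cdot>\<^bsub>C\<^esub> h)"

locale pretriangulated = suspended_category C
  for C :: "('o, 'm, 'z) suspended_data_scheme" (structure) +
  fixes \<Delta> :: "('m \<times> 'm \<times> 'm) set"
  assumes dist_triangle: "(u, v, w) \<in> \<Delta> \<Longrightarrow> is_triangle C u v w"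
    and dist_iso_closed: "(u, v, w) \<in> \<Delta> \<Longrightarrow> is_triangle C u' v' w' \<Longrightarrow>
          triangle_map C (u, v, w) (u', v', w') f g h \<Longrightarrow>
          iso_arr C f \<Longrightarrow> iso_arr C g \<Longrightarrow> iso_arr C h \<Longrightarrow> (u', v', w') \<in> \<Delta>"
    and dist_identity: "X \<in> Ob C \<Longrightarrow> zero_object C N \<Longrightarrow>
          (Idt C X, Zer C X N, Zer C N (fob (Susp C) X)) \<in> \<Delta>"
    and dist_complete: "u \<in> Arr C \<Longrightarrow> \<exists>v w. (u, v, w) \<in> \<Delta>"
    and dist_rotate: "is_triangle C u v w \<Longrightarrow>
          (u, v, w) \<in> \<Delta> \<longleftrightarrow> (Neg C v, Neg C w, Neg C (far (Susp C) u)) \<in> \<Delta>"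
    and dist_map: "(u, v, w) \<in> \<Delta> \<Longrightarrow> (u', v', w') \<in> \<Delta> \<Longrightarrow>
          f \<in> Hom C (Dom C u) (Dom C u') \<Longrightarrow> g \<in> Hom C (Cod C u) (Cod C u') \<Longrightarrow> g \<cdot> u = u' \<cdot> f \<Longrightarrow>
          \<exists>h. triangle_map C (u, v, w) (u', v', w') f g h"

locale exact_functor = A: pretriangulated A \<Delta>A + B: pretriangulated B \<Delta>B + cat_functor A B F
  for A :: "('oa, 'ma, 'za) suspended_data_scheme" and \<Delta>A :: "('ma \<times> 'ma \<times> 'ma) set"
    and B :: "('ob, 'mb, 'zb) suspended_data_scheme" and \<Delta>B :: "('mb \<times> 'mb \<times> 'mb) set"
    and F :: "('oa, 'ma, 'ob, 'mb) functor_data" +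
  assumes commutes_Susp: "functor_commutes_Susp A B F"
    and preserves_dist: "(u, v, w) \<in> \<Delta>A \<Longrightarrow> (far F u, far F v, far F w) \<in> \<Delta>B"

definition reflected_triangles ::
  "('oa, 'ma, 'za) suspended_data_scheme \<Rightarrow> ('oa, 'ma, 'ob, 'mb) functor_data
     \<Rightarrow> ('mb \<times> 'mb \<times> 'mb) set \<Rightarrow> ('ma \<times> 'ma \<times> 'ma) set" where
  "reflected_triangles A F \<Delta>B =
     {(u, v, w). is_triangle A u v w \<and> (far F u, far F v, far F w) \<in> \<Delta>B}"

locale semiseparable_via = cat_functor D C G
  for D :: "('od, 'md, 'zd) category_data_scheme" and C :: "('oc, 'mc, 'zc) category_data_scheme"
    and G :: "('od, 'md, 'oc, 'mc) functor_data" +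
  fixes P :: "'od \<Rightarrow> 'od \<Rightarrow> 'mc \<Rightarrow> 'md"
  assumes P_Hom: "X \<in> Ob D \<Longrightarrow> Y \<in> Ob D \<Longrightarrow> g \<in> Hom C (fob G X) (fob G Y) \<Longrightarrow> P X Y g \<in> Hom D X Y"
    and P_natural: "a \<in> Hom D X' X \<Longrightarrow> b \<in> Hom D Y Y' \<Longrightarrow> g \<in> Hom C (fob G X) (fob G Y) \<Longrightarrow>
          P X' Y' (far G b \<cdot>\<^bsub>C\<^esub> g \<cdot>\<^bsub>C\<^esub> far G a) = b \<cdot>\<^bsub>D\<^esub> P X Y g \<cdot>\<^bsub>D\<^esub> a"
    and GPG: "f \<in> Hom D X Y \<Longrightarrow> far G (P X Y (far G f)) = far G f"

definition stably_semiseparable ::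
  "('od, 'md, 'zd) suspended_data_scheme \<Rightarrow> ('oc, 'mc, 'zc) suspended_data_scheme
     \<Rightarrow> ('od, 'md, 'oc, 'mc) functor_data \<Rightarrow> bool" where
  "stably_semiseparable D C G \<longleftrightarrow>
     (\<exists>P. semiseparable_via D C G P \<and>
       (\<forall>X \<in> Ob D. \<forall>Y \<in> Ob D. \<forall>g \<in> Hom C (fob G X) (fob G Y).
          far (Susp D) (P X Y g) = P (fob (Susp D) X) (fob (Susp D) Y) (far (Susp C) g)))"

definition associated_idempotent ::
  "('od, 'md, 'zd) category_data_scheme \<Rightarrow> ('oc, 'mc, 'zc) category_data_scheme
     \<Rightarrow> ('od, 'md, 'oc, 'mc) functor_data \<Rightarrow> ('od \<Rightarrow> 'md) \<Rightarrow> bool" where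
  "associated_idempotent D C G e \<longleftrightarrow>
     (\<exists>P. semiseparable_via D C G P \<and> (\<forall>X \<in> Ob D. e X = P X X (Idt C (fob G X))))"

definition coid_rel :: "('o, 'm, 'z) category_data_scheme \<Rightarrow> ('o \<Rightarrow> 'm) \<Rightarrow> ('m \<times> 'm) set" where
  "coid_rel D e = {(f, g). f \<in> Arr D \<and> g \<in> Arr D \<and> Dom D f = Dom D g \<and> Cod D f = Cod D g \<and>
                           e (Cod D f) \<cdot>\<^bsub>D\<^esub> f = e (Cod D g) \<cdot>\<^bsub>D\<^esub> g}"

definition coid_class :: "('o, 'm, 'z) category_data_scheme \<Rightarrow> ('o \<Rightarrow> 'm) \<Rightarrow> 'm \<Rightarrow> 'm set" where
  "coid_class D e f = coid_rel D e `` {f}"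

definition rep :: "'m set \<Rightarrow> 'm" where
  "rep c = (SOME f. f \<in> c)"

definition coidentifier ::
  "('o, 'm, 'z) suspended_data_scheme \<Rightarrow> ('o \<Rightarrow> 'm) \<Rightarrow> ('o, 'm set) suspended_data" where
  "coidentifier D e =
     \<lparr>Ob = Ob D,
      Arr = Arr D // coid_rel D e,
      Dom = (\<lambda>c. Dom D (rep c)),
      Cod = (\<lambda>c. Cod D (rep c)),
      Idt = (\<lambda>X. coid_class D e (Idt D X)),
      Comp = (\<lambda>c d. coid_class D e (rep c \<cdot>\<^bsub>D\<^esub> rep d)),
      Zer = (\<lambda>X Y. coid_class D e (Zer D X Y)),
      Add = (\<lambda>c d. coid_class D e (rep c \<boxplus>\<^bsub>D\<^esub> rep d)),
      Susp = \<lparr>fob = fob (Susp D), far = (\<lambda>c. coid_class D e (far (Susp D) (rep c)))\<rparr>\<rparr>"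

definition quotient_functor ::
  "('o, 'm, 'z) category_data_scheme \<Rightarrow> ('o \<Rightarrow> 'm) \<Rightarrow> ('o, 'm, 'o, 'm set) functor_data" where
  "quotient_functor D e = \<lparr>fob = (\<lambda>X. X), far = coid_class D e\<rparr>"

text \<open>
  The functor \<open>G\<^sub>e\<close> on the coidentifier with \<open>G\<^sub>e \<circ> H = G\<close>: the value of \<open>G\<close> does not depend on
  the representative, since \<open>e\<^sub>B \<cdot> f = e\<^sub>B \<cdot> g\<close> implies \<open>G f = G g\<close>.
\<close>

definition factor_functor ::
  "('od, 'md, 'oc, 'mc) functor_data \<Rightarrow> ('od, 'md set, 'oc, 'mc) functor_data" where
  "factor_functor G = \<lparr>fob = fob G, far = (\<lambda>c. far G (rep c))\<rparr>"

text \<open>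
  Arrows of the Eilenberg-Moore category are triples consisting of the source module, the
  underlying arrow and the target module, because one arrow of \<open>C\<close> can be a module morphism
  between several pairs of modules.
\<close>

type_synonym ('o, 'm) module_arrow = "('o \<times> 'm) \<times> 'm \<times> ('o \<times> 'm)"

definition EM_modules ::
  "('o, 'm, 'z) category_data_scheme \<Rightarrow> ('o, 'm, 'o, 'm) functor_data \<Rightarrow> ('o \<Rightarrow> 'm) \<Rightarrow> ('o \<Rightarrow> 'm)
     \<Rightarrow> ('o \<times> 'm) set" where
  "EM_modules C T \<mu> \<eta> =
     {(X, h). X \<in> Ob C \<and> h \<in> Hom C (fob T X) X \<and>
              h \<cdot>\<^bsub>C\<^esub> far T h = h \<cdot>\<^bsub>C\<^esub> \<mu> X \<and> h \<cdot>\<^bsub>C\<^esub> \<eta> X = Idt C X}"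

definition EM_arrows ::
  "('o, 'm, 'z) category_data_scheme \<Rightarrow> ('o, 'm, 'o, 'm) functor_data \<Rightarrow> ('o \<Rightarrow> 'm) \<Rightarrow> ('o \<Rightarrow> 'm)
     \<Rightarrow> ('o, 'm) module_arrow set" where
  "EM_arrows C T \<mu> \<eta> =
     {((X, h), f, (Y, k)). (X, h) \<in> EM_modules C T \<mu> \<eta> \<and> (Y, k) \<in> EM_modules C T \<mu> \<eta> \<and>
                           f \<in> Hom C X Y \<and> f \<cdot>\<^bsub>C\<^esub> h = k \<cdot>\<^bsub>C\<^esub> far T f}"

definition eilenberg_moore ::
  "('o, 'm, 'z) suspended_data_scheme \<Rightarrow> ('o, 'm, 'o, 'm) functor_data \<Rightarrow> ('o \<Rightarrow> 'm) \<Rightarrow> ('o \<Rightarrow> 'm)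
     \<Rightarrow> ('o \<times> 'm, ('o, 'm) module_arrow) suspended_data" where
  "eilenberg_moore C T \<mu> \<eta> =
     (let S = (\<lambda>(X, h). (fob (Susp C) X, far (Susp C) h)) in
     \<lparr>Ob = EM_modules C T \<mu> \<eta>,
      Arr = EM_arrows C T \<mu> \<eta>,
      Dom = (\<lambda>(M, f, N). M),
      Cod = (\<lambda>(M, f, N). N),
      Idt = (\<lambda>(X, h). ((X, h), Idt C X, (X, h))),
      Comp = (\<lambda>(M', g, N') (M, f, N). (M, g \<cdot>\<^bsub>C\<^esub> f, N')),
      Zer = (\<lambda>(X, h) (Y, k). ((X, h), Zer C X Y, (Y, k))),
      Add = (\<lambda>(M, f, N) (M', g, N'). (M, f \<boxplus>\<^bsub>C\<^esub> g, N)),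
      Susp = \<lparr>fob = S, far = (\<lambda>(M, f, N). (S M, far (Susp C) f, S N))\<rparr>\<rparr>)"

definition EM_forgetful :: "('o \<times> 'm, ('o, 'm) module_arrow, 'o, 'm) functor_data" where
  "EM_forgetful = \<lparr>fob = (\<lambda>(X, h). X), far = (\<lambda>(M, f, N). f)\<rparr>"

definition EM_free ::
  "('o, 'm, 'z) category_data_scheme \<Rightarrow> ('o, 'm, 'o, 'm) functor_data \<Rightarrow> ('o \<Rightarrow> 'm)
     \<Rightarrow> ('o, 'm, 'o \<times> 'm, ('o, 'm) module_arrow) functor_data" where
  "EM_free C T \<mu> =
     (let V = (\<lambda>X. (fob T X, \<mu> X)) in
     \<lparr>fob = V, far = (\<lambda>f. (V (Dom C f), far T f, V (Cod C f)))\<rparr>)"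

definition EM_comparison ::
  "('od, 'md, 'zd) category_data_scheme \<Rightarrow> ('od, 'md, 'oc, 'mc) functor_data \<Rightarrow> ('od \<Rightarrow> 'md)
     \<Rightarrow> ('od, 'md, 'oc \<times> 'mc, ('oc, 'mc) module_arrow) functor_data" where
  "EM_comparison D G \<epsilon> =
     (let K = (\<lambda>Y. (fob G Y, far G (\<epsilon> Y))) in
     \<lparr>fob = K, far = (\<lambda>f. (K (Dom D f), far G f, K (Cod D f)))\<rparr>)"

end

theory Submission
  imports Defs
begin

text \<open>
  Semiseparability of \<open>G\<close> gives a natural \<open>\<gamma> : Id \<rightarrow> FG\<close>, \<open>\<gamma>\<^sub>Y = P (\<eta>\<^bsub>GY\<^esub>)\<close>, with \<open>\<epsilon> \<cdot> \<gamma> = e\<close>; since \<open>G e = Id\<close>,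
  the arrows \<open>G \<gamma> F\<close> split the multiplication of \<open>T = GF\<close> by bimodule maps, i.e. the monad is separable.
  Hence every module is naturally a retract of a free one, and averaging makes any arrow between
  modules linear. This fills morphisms of triangles in \<open>CT\<close>. For a linear \<open>u\<close>, the projections of
  the free modules onto source and target of \<open>u\<close> extend to an endomorphism \<open>q\<close> of the free triangle;
  \<open>(q\<^sup>2 - q)\<^sup>2 = 0\<close> on the cone, so \<open>q\<close> can be corrected to an idempotent, whose image is a cone of \<open>u\<close>.
  The required splitting exists because \<open>P\<close> is multiplicative on linear maps and inverts \<open>G\<close> there:
  idempotents on modules in the image of \<open>K\<close> lift to \<open>D\<close>. For the same reason \<open>K\<close> is full and
  essentially surjective, and two arrows have the same image under \<open>K\<close> iff they are identified in \<open>De\<close>.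
\<close>

section \<open>Categories and additive functors\<close>

text \<open>A morphism of cones supplied by the axioms carries no uniqueness: between modules it
  need not be linear, and over idempotents it need not be idempotent. Averaging cures the first
  defect because it fixes linear arrows and commutes with composition by them on either side, so the
  squares of the filler survive. For the second, \<open>n = q^2 - q\<close> composes to zero with
  both arrows of the triangle at the cone; in \<open>C\<close> it therefore factors through the
  arrow into the cone, which gives \<open>n n = 0\<close>, and \<open>3 q^2 - 2 q^3\<close> is an
  idempotent that agrees with \<open>q\<close> next to those two arrows. That the resulting triangle
  is distinguished is recognised in \<open>C\<close>, where it is a retract of a distinguished one;
  \<open>CT\<close> has no triangulated structure yet. Additivity is not part of the notion of
  functor used here. \<open>G\<close> gets it as a right adjoint, \<open>F\<close> by transposing,
  and suspension as the right adjoint of its own inverse. Compatibility of \<open>P\<close> with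
  suspension enters through \<open>e\<close>, which has to commute with suspension before classes of
  arrows can be suspended.\<close>

lemma in_Hom [simp]: "f \<in> Hom C X Y \<longleftrightarrow> f \<in> Arr C \<and> Dom C f = X \<and> Cod C f = Y"
  by (simp add: Hom_def)

context category
begin

lemma Comp_Arr [simp]:
  assumes "f \<in> Arr C" "g \<in> Arr C" "Dom C g = Cod C f"
  shows "g \<cdot> f \<in> Arr C" "Dom C (g \<cdot> f) = Dom C f" "Cod C (g \<cdot> f) = Cod C g"
  using Comp_Hom[of f "Dom C f" "Cod C f" g "Cod C g"] assms by auto

lemma Idt_Arr [simp]:
  assumes "X \<in> Ob C"
  shows "Idt C X \<in> Arr C" "Dom C (Idt C X) = X" "Cod C (Idt C X) = X"
  using Idt_Hom[OF assms] by auto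

lemma Comp_Idt [simp]:
  "f \<in> Arr C \<Longrightarrow> Cod C f = Y \<Longrightarrow> Idt C Y \<cdot> f = f"
  "f \<in> Arr C \<Longrightarrow> Dom C f = X \<Longrightarrow> f \<cdot> Idt C X = f"
  using Idt_left Idt_right by auto

lemma Comp_assoc_Arr:
  assumes "f \<in> Arr C" "g \<in> Arr C" "h \<in> Arr C" "Dom C g = Cod C f" "Dom C h = Cod C g"
  shows "(h \<cdot> g) \<cdot> f = h \<cdot> (g \<cdot> f)"
  using Comp_assoc[of f _ _ g _ h] assms by auto

declare Dom_Ob [simp] Cod_Ob [simp]

text \<open>Right-nested normal form hides a redex \<open>g \<cdot> f\<close> behind a further
  factor \<open>x\<close>. Instantiated with a known equation, this makes the equation usable as a
  rewrite rule inside such composites.\<close>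

lemma Comp_reduce:
  assumes "g \<cdot> f = k" "x \<in> Arr C" "f \<in> Arr C" "g \<in> Arr C" "Dom C g = Cod C f" "Dom C f = Cod C x"
  shows "g \<cdot> (f \<cdot> x) = k \<cdot> x"
  using assms Comp_assoc_Arr by metis

lemma iso_arrI:
  assumes "f \<in> Arr C" "g \<in> Arr C" "Dom C g = Cod C f" "Cod C g = Dom C f"
    "g \<cdot> f = Idt C (Dom C f)" "f \<cdot> g = Idt C (Cod C f)"
  shows "iso_arr C f"
  using assms by (auto simp: iso_arr_def)

lemma iso_arrE:
  assumes "iso_arr C f"
  obtains g where "f \<in> Arr C" "g \<in> Arr C" "Dom C g = Cod C f" "Cod C g = Dom C f"
    "g \<cdot> f = Idt C (Dom C f)" "f \<cdot> g = Idt C (Cod C f)"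
  using assms by (auto simp: iso_arr_def)

lemma iso_arr_Idt [simp]: "X \<in> Ob C \<Longrightarrow> iso_arr C (Idt C X)"
  by (rule iso_arrI[of _ "Idt C X"]) auto

end

section \<open>Calculus of sums, zeros and signs\<close>

context additive_category
begin

lemma Add_Arr [simp]:
  assumes "f \<in> Arr C" "g \<in> Arr C" "Dom C f = Dom C g" "Cod C f = Cod C g"
  shows "f \<boxplus> g \<in> Arr C" "Dom C (f \<boxplus> g) = Dom C g" "Cod C (f \<boxplus> g) = Cod C g"
proof -
  interpret comm_group "hom_group C (Dom C g) (Cod C g)"
    using assms by (auto intro: hom_comm_group)
  show "f \<boxplus> g \<in> Arr C" "Dom C (f \<boxplus> g) = Dom C g" "Cod C (f \<boxplus> g) = Cod C g"
    using m_closed[of f g] assms by (auto simp: hom_group_def)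
qed

lemma Zer_Arr [simp]:
  assumes "X \<in> Ob C" "Y \<in> Ob C"
  shows "Zer C X Y \<in> Arr C" "Dom C (Zer C X Y) = X" "Cod C (Zer C X Y) = Y"
proof -
  interpret comm_group "hom_group C X Y"
    using assms by (auto intro: hom_comm_group)
  show "Zer C X Y \<in> Arr C" "Dom C (Zer C X Y) = X" "Cod C (Zer C X Y) = Y"
    using one_closed by (auto simp: hom_group_def)
qed

lemma Neg_Arr [simp]:
  assumes "f \<in> Arr C"
  shows "Neg C f \<in> Arr C" "Dom C (Neg C f) = Dom C f" "Cod C (Neg C f) = Cod C f"
proof -
  interpret comm_group "hom_group C (Dom C f) (Cod C f)"
    using assms by (auto intro: hom_comm_group)
  show "Neg C f \<in> Arr C" "Dom C (Neg C f) = Dom C f" "Cod C (Neg C f) = Cod C f"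
    using inv_closed[of f] assms by (auto simp: hom_group_def Neg_def)
qed

lemma Add_commute:
  assumes "f \<in> Arr C" "g \<in> Arr C" "Dom C f = Dom C g" "Cod C f = Cod C g"
  shows "f \<boxplus> g = g \<boxplus> f"
proof -
  interpret comm_group "hom_group C (Dom C g) (Cod C g)"
    using assms by (auto intro: hom_comm_group)
  show ?thesis
    using m_comm[of f g] assms by (auto simp: hom_group_def)
qed

lemma Add_assoc:
  assumes "f \<in> Arr C" "g \<in> Arr C" "h \<in> Arr C"
    "Dom C f = Dom C g" "Cod C f = Cod C g" "Dom C g = Dom C h" "Cod C g = Cod C h"
  shows "(f \<boxplus> g) \<boxplus> h = f \<boxplus> (g \<boxplus> h)"
proof -
  interpret comm_group "hom_group C (Dom C h) (Cod C h)"
    using assms by (auto intro: hom_comm_group)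
  show ?thesis
    using m_assoc[of f g h] assms by (auto simp: hom_group_def)
qed

lemma Add_Zer [simp]:
  assumes "f \<in> Arr C" "Dom C f = X" "Cod C f = Y"
  shows "f \<boxplus> Zer C X Y = f" "Zer C X Y \<boxplus> f = f"
proof -
  interpret comm_group "hom_group C X Y"
    using assms by (auto intro: hom_comm_group)
  show "f \<boxplus> Zer C X Y = f" "Zer C X Y \<boxplus> f = f"
    using r_one[of f] l_one[of f] assms by (auto simp: hom_group_def)
qed

lemma Add_Neg [simp]:
  assumes "f \<in> Arr C"
  shows "f \<boxplus> Neg C f = Zer C (Dom C f) (Cod C f)" "Neg C f \<boxplus> f = Zer C (Dom C f) (Cod C f)"
proof -
  interpret comm_group "hom_group C (Dom C f) (Cod C f)"
    using assms by (auto intro: hom_comm_group)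
  show "f \<boxplus> Neg C f = Zer C (Dom C f) (Cod C f)" "Neg C f \<boxplus> f = Zer C (Dom C f) (Cod C f)"
    using r_inv[of f] l_inv[of f] assms by (auto simp: hom_group_def Neg_def)
qed

lemma Neg_eqI:
  assumes "f \<in> Arr C" "g \<in> Arr C" "Dom C f = Dom C g" "Cod C f = Cod C g"
    "f \<boxplus> g = Zer C (Dom C f) (Cod C f)"
  shows "Neg C f = g"
proof -
  have "Neg C f = Neg C f \<boxplus> (f \<boxplus> g)"
    using assms by simp
  also have "\<dots> = (Neg C f \<boxplus> f) \<boxplus> g"
    using assms by (subst Add_assoc) auto
  also have "\<dots> = g"
    using assms by simp
  finally show ?thesis .
qed

lemma Add_left_commute:
  assumes "f \<in> Arr C" "g \<in> Arr C" "h \<in> Arr C"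
    "Dom C f = Dom C g" "Cod C f = Cod C g" "Dom C g = Dom C h" "Cod C g = Cod C h"
  shows "f \<boxplus> (g \<boxplus> h) = g \<boxplus> (f \<boxplus> h)"
  using assms Add_commute[of f g] by (simp flip: Add_assoc)

lemma Add_self_eq_Zer:
  assumes "f \<in> Arr C" "f \<boxplus> f = f"
  shows "f = Zer C (Dom C f) (Cod C f)"
proof -
  have "f = f \<boxplus> (f \<boxplus> Neg C f)"
    using assms by simp
  also have "\<dots> = (f \<boxplus> f) \<boxplus> Neg C f"
    using assms(1) by (subst Add_assoc) auto
  also have "\<dots> = Zer C (Dom C f) (Cod C f)"
    using assms by simp
  finally show ?thesis .
qed

lemma diff_eq_Zer:
  assumes "f \<in> Arr C" "g \<in> Arr C" "Dom C f = Dom C g" "Cod C f = Cod C g"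
    "f \<boxplus> Neg C g = Zer C (Dom C f) (Cod C f)"
  shows "f = g"
proof -
  have "f = f \<boxplus> (Neg C g \<boxplus> g)"
    using assms by simp
  also have "\<dots> = (f \<boxplus> Neg C g) \<boxplus> g"
    using assms(1-4) by (subst Add_assoc) auto
  also have "\<dots> = g"
    using assms by simp
  finally show ?thesis .
qed

lemma Neg_Neg [simp]: "f \<in> Arr C \<Longrightarrow> Neg C (Neg C f) = f"
  by (rule Neg_eqI) auto

lemma Neg_Zer [simp]: "X \<in> Ob C \<Longrightarrow> Y \<in> Ob C \<Longrightarrow> Neg C (Zer C X Y) = Zer C X Y"
  by (rule Neg_eqI) auto

lemma Neg_eq_iff:
  assumes "f \<in> Arr C" "g \<in> Arr C"
  shows "Neg C f = Neg C g \<longleftrightarrow> f = g"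
  using assms Neg_Neg by metis

lemma Comp_distrib_left:
  assumes "f \<in> Arr C" "f' \<in> Arr C" "g \<in> Arr C" "Dom C f = Dom C f'" "Cod C f = Cod C f'"
    "Dom C g = Cod C f'"
  shows "g \<cdot> (f \<boxplus> f') = (g \<cdot> f) \<boxplus> (g \<cdot> f')"
  using assms Comp_Add_right[of f _ _ f' g] by auto

lemma Comp_distrib_right:
  assumes "f \<in> Arr C" "g \<in> Arr C" "g' \<in> Arr C" "Dom C g = Dom C g'" "Cod C g = Cod C g'"
    "Dom C g' = Cod C f"
  shows "(g \<boxplus> g') \<cdot> f = (g \<cdot> f) \<boxplus> (g' \<cdot> f)"
  using assms Comp_Add_left[of f _ _ g _ g'] by auto

lemma Comp_Zer [simp]:
  "f \<in> Arr C \<Longrightarrow> Cod C f = Y \<Longrightarrow> Z \<in> Ob C \<Longrightarrow> Zer C Y Z \<cdot> f = Zer C (Dom C f) Z"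
  "f \<in> Arr C \<Longrightarrow> Dom C f = Y \<Longrightarrow> X \<in> Ob C \<Longrightarrow> f \<cdot> Zer C X Y = Zer C X (Cod C f)"
proof -
  assume f: "f \<in> Arr C" "Cod C f = Y" "Z \<in> Ob C"
  then have "Y \<in> Ob C"
    by auto
  with f have "(Zer C Y Z \<cdot> f) \<boxplus> (Zer C Y Z \<cdot> f) = Zer C Y Z \<cdot> f"
    by (simp flip: Comp_distrib_right)
  with f \<open>Y \<in> Ob C\<close> show "Zer C Y Z \<cdot> f = Zer C (Dom C f) Z"
    using Add_self_eq_Zer[of "Zer C Y Z \<cdot> f"] by simp
next
  assume f: "f \<in> Arr C" "Dom C f = Y" "X \<in> Ob C"
  then have "Y \<in> Ob C"
    by auto
  with f have "(f \<cdot> Zer C X Y) \<boxplus> (f \<cdot> Zer C X Y) = f \<cdot> Zer C X Y"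
    by (simp flip: Comp_distrib_left)
  with f \<open>Y \<in> Ob C\<close> show "f \<cdot> Zer C X Y = Zer C X (Cod C f)"
    using Add_self_eq_Zer[of "f \<cdot> Zer C X Y"] by simp
qed

lemma Comp_Neg [simp]:
  assumes "f \<in> Arr C" "g \<in> Arr C" "Dom C g = Cod C f"
  shows "Neg C g \<cdot> f = Neg C (g \<cdot> f)" "g \<cdot> Neg C f = Neg C (g \<cdot> f)"
proof -
  show "Neg C g \<cdot> f = Neg C (g \<cdot> f)"
    using assms by (intro Neg_eqI[symmetric]) (auto simp flip: Comp_distrib_right)
  show "g \<cdot> Neg C f = Neg C (g \<cdot> f)"
    using assms by (intro Neg_eqI[symmetric]) (auto simp flip: Comp_distrib_left)
qed

text \<open>Every arrow into or out of \<open>N\<close> factors through \<open>Idt C N\<close>, so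
  it vanishes once that identity does. In this equational form the property is visibly preserved by
  additive functors.\<close>

lemma zero_object_iff: "zero_object C N \<longleftrightarrow> N \<in> Ob C \<and> Idt C N = Zer C N N"
proof
  assume N: "zero_object C N"
  then have "\<exists>!f. f \<in> Hom C N N" "N \<in> Ob C"
    unfolding zero_object_def by blast+
  moreover from this have "Zer C N N \<in> Hom C N N" "Idt C N \<in> Hom C N N"
    by auto
  ultimately show "N \<in> Ob C \<and> Idt C N = Zer C N N"
    by blast
next
  assume N: "N \<in> Ob C \<and> Idt C N = Zer C N N"
  have "f = Zer C (Dom C f) N" if "f \<in> Arr C" "Cod C f = N" for f
  proof -
    have "f = Idt C N \<cdot> f"
      using that by simp
    also have "\<dots> = Zer C (Dom C f) N"
      using N that by simp
    finally show ?thesis .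
  qed
  note into = this
  have "f = Zer C N (Cod C f)" if "f \<in> Arr C" "Dom C f = N" for f
  proof -
    have "f = f \<cdot> Idt C N"
      using that by simp
    also have "\<dots> = Zer C N (Cod C f)"
      using N that by simp
    finally show ?thesis .
  qed
  note out_of = this
  show "zero_object C N"
    unfolding zero_object_def
  proof (intro conjI ballI)
    fix X assume "X \<in> Ob C"
    then show "\<exists>!f. f \<in> Hom C X N"
      using N into by (intro ex1I[of _ "Zer C X N"]) auto
  next
    fix X assume "X \<in> Ob C"
    then show "\<exists>!f. f \<in> Hom C N X"
      using N out_of by (intro ex1I[of _ "Zer C N X"]) auto
  qed (use N in simp)
qed

end

context cat_functor
begin

lemma far_Arr [simp]:
  assumes "f \<in> Arr A"
  shows "far F f \<in> Arr B" "Dom B (far F f) = fob F (Dom A f)" "Cod B (far F f) = fob F (Cod A f)"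
  using far_Hom[of f "Dom A f" "Cod A f"] assms by auto

declare fob_Ob [simp] far_Idt [simp]

lemma far_Comp_Arr:
  "f \<in> Arr A \<Longrightarrow> g \<in> Arr A \<Longrightarrow> Dom A g = Cod A f
     \<Longrightarrow> far F (g \<cdot>\<^bsub>A\<^esub> f) = far F g \<cdot>\<^bsub>B\<^esub> far F f"
  using far_Comp[of f _ _ g] by auto

lemma iso_arr_far:
  assumes "iso_arr A f"
  shows "iso_arr B (far F f)"
proof -
  obtain g where g: "f \<in> Arr A" "g \<in> Arr A" "Dom A g = Cod A f" "Cod A g = Dom A f"
    "g \<cdot>\<^bsub>A\<^esub> f = Idt A (Dom A f)" "f \<cdot>\<^bsub>A\<^esub> g = Idt A (Cod A f)"
    using assms by (rule A.iso_arrE)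
  then show ?thesis
    by (intro B.iso_arrI[of _ "far F g"]) (auto simp flip: far_Comp_Arr)
qed

end

lemma comp_functor_simps [simp]:
  "fob (G \<circ>\<^sub>F F) X = fob G (fob F X)" "far (G \<circ>\<^sub>F F) f = far G (far F f)"
  by (auto simp: comp_functor_def)

lemma id_functor_simps [simp]: "fob id_functor X = X" "far id_functor f = f"
  by (auto simp: id_functor_def)

lemma cat_functor_id: "category A \<Longrightarrow> cat_functor A A id_functor"
  by (simp add: cat_functor_def cat_functor_axioms_def)

lemma cat_functor_comp:
  assumes "cat_functor A B F" "cat_functor B C G"
  shows "cat_functor A C (G \<circ>\<^sub>F F)"
proof -
  interpret F: cat_functor A B F by fact
  interpret G: cat_functor B C G by fact
  show ?thesis
    by unfold_locales (auto simp: F.far_Comp_Arr G.far_Comp_Arr)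
qed

context nat_trans
begin

lemma component_Arr [simp]:
  assumes "X \<in> Ob A"
  shows "\<alpha> X \<in> Arr B" "Dom B (\<alpha> X) = fob F X" "Cod B (\<alpha> X) = fob G X"
  using component_Hom[OF assms] by auto

lemma naturality_Arr:
  "f \<in> Arr A \<Longrightarrow> X = Dom A f \<Longrightarrow> Y = Cod A f \<Longrightarrow> \<alpha> Y \<cdot>\<^bsub>B\<^esub> far F f = far G f \<cdot>\<^bsub>B\<^esub> \<alpha> X"
  by (simp add: naturality)

end

locale additive_functor = A: additive_category A + B: additive_category B + cat_functor A B F
  for A :: "('oa, 'ma, 'za) additive_data_scheme" and B :: "('ob, 'mb, 'zb) additive_data_scheme"
    and F :: "('oa, 'ma, 'ob, 'mb) functor_data" +
  assumes far_Add: "f \<in> Hom A X Y \<Longrightarrow> g \<in> Hom A X Y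
    \<Longrightarrow> far F (f \<boxplus>\<^bsub>A\<^esub> g) = far F f \<boxplus>\<^bsub>B\<^esub> far F g"
begin

lemma far_Add_Arr:
  "f \<in> Arr A \<Longrightarrow> g \<in> Arr A \<Longrightarrow> Dom A f = Dom A g \<Longrightarrow> Cod A f = Cod A g
     \<Longrightarrow> far F (f \<boxplus>\<^bsub>A\<^esub> g) = far F f \<boxplus>\<^bsub>B\<^esub> far F g"
  using far_Add by auto

lemma far_Zer [simp]:
  assumes "X \<in> Ob A" "Y \<in> Ob A"
  shows "far F (Zer A X Y) = Zer B (fob F X) (fob F Y)"
  using assms far_Add_Arr[of "Zer A X Y" "Zer A X Y"] B.Add_self_eq_Zer[of "far F (Zer A X Y)"]
  by simp

lemma far_Neg: "f \<in> Arr A \<Longrightarrow> far F (Neg A f) = Neg B (far F f)"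
  by (rule B.Neg_eqI[symmetric]) (auto simp flip: far_Add_Arr)

lemma zero_object_fob: "zero_object A N \<Longrightarrow> zero_object B (fob F N)"
  unfolding A.zero_object_iff B.zero_object_iff
  by (metis far_Idt far_Zer fob_Ob)

end

section \<open>Adjoint functors between additive categories are additive\<close>

locale additive_adjunction = C: additive_category C + D: additive_category D +
    adjunction C D F G \<eta> \<epsilon>
  for C :: "('oc, 'mc, 'zc) additive_data_scheme" and D :: "('od, 'md, 'zd) additive_data_scheme"
    and F G \<eta> \<epsilon>
begin

text \<open>Naturality, in the target, of the transposition that sends
  \<open>a : X \<rightarrow> G Y\<close> to
  \<open>\<epsilon> Y \<cdot> F a : F X \<rightarrow> Y\<close>.\<close>

lemma transpose_G:
  assumes "a \<in> Arr C" "b \<in> Arr D" "Cod C a = fob G (Dom D b)"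
  shows "\<epsilon> (Cod D b) \<cdot>\<^bsub>D\<^esub> far F (far G b \<cdot>\<^bsub>C\<^esub> a) = b \<cdot>\<^bsub>D\<^esub> (\<epsilon> (Dom D b) \<cdot>\<^bsub>D\<^esub> far F a)"
proof -
  have "\<epsilon> (Cod D b) \<cdot>\<^bsub>D\<^esub> far F (far G b) = b \<cdot>\<^bsub>D\<^esub> \<epsilon> (Dom D b)"
    using counit.naturality_Arr[of b] assms by simp
  then show ?thesis
    using assms D.Comp_reduce[of "\<epsilon> (Cod D b)" "far F (far G b)" _ "far F a"]
    by (simp add: F.far_Comp_Arr D.Comp_assoc_Arr)
qed

text \<open>The inverse transposition, \<open>b\<close> to \<open>G b \<cdot> \<eta>\<close>,
  recovers \<open>a\<close> by naturality of the unit and a triangle identity.\<close>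

lemma transpose_inject:
  assumes "a \<in> Arr C" "a' \<in> Arr C" "Dom C a = Dom C a'" "Y \<in> Ob D"
    "Cod C a = fob G Y" "Cod C a' = fob G Y"
    "\<epsilon> Y \<cdot>\<^bsub>D\<^esub> far F a = \<epsilon> Y \<cdot>\<^bsub>D\<^esub> far F a'"
  shows "a = a'"
proof -
  have eq: "far G (\<epsilon> Y \<cdot>\<^bsub>D\<^esub> far F x) \<cdot>\<^bsub>C\<^esub> \<eta> (Dom C x) = x"
    if "x \<in> Arr C" "Cod C x = fob G Y" for x
  proof -
    have "far G (far F x) \<cdot>\<^bsub>C\<^esub> \<eta> (Dom C x) = \<eta> (fob G Y) \<cdot>\<^bsub>C\<^esub> x"
      using unit.naturality_Arr[of x] that by simp
    then have "far G (\<epsilon> Y \<cdot>\<^bsub>D\<^esub> far F x) \<cdot>\<^bsub>C\<^esub> \<eta> (Dom C x)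
        = far G (\<epsilon> Y) \<cdot>\<^bsub>C\<^esub> (\<eta> (fob G Y) \<cdot>\<^bsub>C\<^esub> x)"
      using that assms(4) by (simp add: G.far_Comp_Arr C.Comp_assoc_Arr)
    also have "\<dots> = x"
      using that assms(4) C.Comp_reduce[OF triangle_G[OF assms(4)], of x] by simp
    finally show ?thesis .
  qed
  show ?thesis
    using eq[of a] eq[of a'] assms by metis
qed

text \<open>Identity and zero of \<open>G N\<close> have transposes with target \<open>N\<close>,
  where any two parallel arrows agree.\<close>

lemma zero_object_G: "zero_object D N \<Longrightarrow> zero_object C (fob G N)"
  unfolding C.zero_object_iff
proof
  assume N: "zero_object D N"
  then have "N \<in> Ob D" "\<And>f g. f \<in> Arr D \<Longrightarrow> g \<in> Arr D \<Longrightarrow> Cod D f = N \<Longrightarrow> Cod D g = N \<Longrightarrow> Dom D f = Dom D g \<Longrightarrow> f = g"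
    by (auto simp: zero_object_def) (metis D.Dom_Ob)
  then show "Idt C (fob G N) = Zer C (fob G N) (fob G N)"
    by - (rule transpose_inject[of _ _ N], auto)
qed (auto simp: zero_object_def)

text \<open>A zero arrow factors through a zero object, and \<open>G\<close> preserves both the
  factorisation and the zero object.\<close>

lemma far_G_Zer:
  assumes "X \<in> Ob D" "Y \<in> Ob D"
  shows "far G (Zer D X Y) = Zer C (fob G X) (fob G Y)"
proof -
  obtain N where N: "zero_object D N"
    using D.ex_zero_object by blast
  then have Ob: "N \<in> Ob D"
    by (simp add: zero_object_def)
  have "far G (Zer D X Y) = far G (Zer D N Y) \<cdot>\<^bsub>C\<^esub> far G (Zer D X N)"
    using Ob assms G.far_Comp_Arr[of "Zer D X N" "Zer D N Y"] by simp
  also have "\<dots> = far G (Zer D N Y) \<cdot>\<^bsub>C\<^esub> (Idt C (fob G N) \<cdot>\<^bsub>C\<^esub> far G (Zer D X N))"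
    using Ob assms by simp
  also have "\<dots> = far G (Zer D N Y) \<cdot>\<^bsub>C\<^esub> (Zer C (fob G N) (fob G N) \<cdot>\<^bsub>C\<^esub> far G (Zer D X N))"
    using zero_object_G[OF N] by (simp add: C.zero_object_iff)
  also have "\<dots> = Zer C (fob G X) (fob G Y)"
    using Ob assms by simp
  finally show ?thesis .
qed

text \<open>The codiagonal \<open>p + q\<close> of a biproduct is preserved because \<open>G\<close>, being a right adjoint,
  keeps the two projections jointly monic.\<close>

lemma additive_functor_G: "additive_functor D C G"
proof
  fix f g X Y assume fg: "f \<in> Hom D X Y" "g \<in> Hom D X Y"
  then have Y: "Y \<in> Ob D" and X: "X \<in> Ob D"
    by auto
  obtain B i j p q where B: "B \<in> Ob D" "i \<in> Hom D Y B" "j \<in> Hom D Y B" "p \<in> Hom D B Y" "q \<in> Hom D B Y"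
    and eqs: "p \<cdot>\<^bsub>D\<^esub> i = Idt D Y" "q \<cdot>\<^bsub>D\<^esub> j = Idt D Y" "p \<cdot>\<^bsub>D\<^esub> j = Zer D Y Y" "q \<cdot>\<^bsub>D\<^esub> i = Zer D Y Y"
      "(i \<cdot>\<^bsub>D\<^esub> p) \<boxplus>\<^bsub>D\<^esub> (j \<cdot>\<^bsub>D\<^esub> q) = Idt D B"
    using D.ex_biproduct[OF Y Y] by blast
  have jointly_monic: "a = b"
    if ab: "a \<in> Arr C" "b \<in> Arr C" "Dom C a = Dom C b" "Cod C a = fob G B" "Cod C b = fob G B"
      and eq: "far G p \<cdot>\<^bsub>C\<^esub> a = far G p \<cdot>\<^bsub>C\<^esub> b" "far G q \<cdot>\<^bsub>C\<^esub> a = far G q \<cdot>\<^bsub>C\<^esub> b" for a b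
  proof (rule transpose_inject[of _ _ B])
    define a' b' where "a' = \<epsilon> B \<cdot>\<^bsub>D\<^esub> far F a" and "b' = \<epsilon> B \<cdot>\<^bsub>D\<^esub> far F b"
    have arr: "a' \<in> Arr D" "b' \<in> Arr D" "Dom D a' = fob F (Dom C b)" "Dom D b' = fob F (Dom C b)"
      "Cod D a' = B" "Cod D b' = B"
      using ab B by (auto simp: a'_def b'_def)
    have "p \<cdot>\<^bsub>D\<^esub> a' = p \<cdot>\<^bsub>D\<^esub> b'" "q \<cdot>\<^bsub>D\<^esub> a' = q \<cdot>\<^bsub>D\<^esub> b'"
      using transpose_G[of a p] transpose_G[of b p] transpose_G[of a q] transpose_G[of b q] ab B eq
      by (auto simp: a'_def b'_def)
    moreover have "x = (i \<cdot>\<^bsub>D\<^esub> (p \<cdot>\<^bsub>D\<^esub> x)) \<boxplus>\<^bsub>D\<^esub> (j \<cdot>\<^bsub>D\<^esub> (q \<cdot>\<^bsub>D\<^esub> x))"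
      if "x \<in> Arr D" "Cod D x = B" for x
    proof -
      have "x = ((i \<cdot>\<^bsub>D\<^esub> p) \<boxplus>\<^bsub>D\<^esub> (j \<cdot>\<^bsub>D\<^esub> q)) \<cdot>\<^bsub>D\<^esub> x"
        using eqs that by simp
      also have "\<dots> = (i \<cdot>\<^bsub>D\<^esub> (p \<cdot>\<^bsub>D\<^esub> x)) \<boxplus>\<^bsub>D\<^esub> (j \<cdot>\<^bsub>D\<^esub> (q \<cdot>\<^bsub>D\<^esub> x))"
        using B that by (simp add: D.Comp_distrib_right D.Comp_assoc_Arr)
      finally show ?thesis .
    qed
    ultimately show "\<epsilon> B \<cdot>\<^bsub>D\<^esub> far F a = \<epsilon> B \<cdot>\<^bsub>D\<^esub> far F b"
      using arr unfolding a'_def[symmetric] b'_def[symmetric] by metis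
  qed (use ab B in auto)
  have Geqs: "far G p \<cdot>\<^bsub>C\<^esub> far G i = Idt C (fob G Y)" "far G q \<cdot>\<^bsub>C\<^esub> far G j = Idt C (fob G Y)"
    "far G p \<cdot>\<^bsub>C\<^esub> far G j = Zer C (fob G Y) (fob G Y)" "far G q \<cdot>\<^bsub>C\<^esub> far G i = Zer C (fob G Y) (fob G Y)"
    using B Y eqs by (auto simp: far_G_Zer simp flip: G.far_Comp_Arr)
  \<comment> \<open>The image of the biproduct is again one: both sides have the same composites
    with \<open>far G p\<close> and \<open>far G q\<close>.\<close>
  have sum_GB: "(far G i \<cdot>\<^bsub>C\<^esub> far G p) \<boxplus>\<^bsub>C\<^esub> (far G j \<cdot>\<^bsub>C\<^esub> far G q) = Idt C (fob G B)"
    by (rule jointly_monic)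
       (use B Y Geqs C.Comp_reduce[OF Geqs(1), of "far G p"] C.Comp_reduce[OF Geqs(2), of "far G q"]
         C.Comp_reduce[OF Geqs(3), of "far G q"] C.Comp_reduce[OF Geqs(4), of "far G p"]
        in \<open>auto simp: C.Comp_distrib_left\<close>)
  have pq: "far G (p \<boxplus>\<^bsub>D\<^esub> q) = far G p \<boxplus>\<^bsub>C\<^esub> far G q"
  proof -
    have "far G (p \<boxplus>\<^bsub>D\<^esub> q) \<cdot>\<^bsub>C\<^esub> far G i = Idt C (fob G Y)" "far G (p \<boxplus>\<^bsub>D\<^esub> q) \<cdot>\<^bsub>C\<^esub> far G j = Idt C (fob G Y)"
      using B Y eqs by (auto simp: D.Comp_distrib_right simp flip: G.far_Comp_Arr)
    note red = C.Comp_reduce[OF this(1), of "far G p"] C.Comp_reduce[OF this(2), of "far G q"]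
    have "far G (p \<boxplus>\<^bsub>D\<^esub> q)
        = far G (p \<boxplus>\<^bsub>D\<^esub> q) \<cdot>\<^bsub>C\<^esub> ((far G i \<cdot>\<^bsub>C\<^esub> far G p) \<boxplus>\<^bsub>C\<^esub> (far G j \<cdot>\<^bsub>C\<^esub> far G q))"
      using B by (simp add: sum_GB)
    also have "\<dots> = far G p \<boxplus>\<^bsub>C\<^esub> far G q"
      using B red by (subst C.Comp_distrib_left) auto
    finally show ?thesis .
  qed
  \<comment> \<open>\<open>m\<close> has components \<open>f\<close> and \<open>g\<close>, so
    \<open>p \<boxplus> q\<close> after \<open>m\<close> is \<open>f \<boxplus> g\<close>.\<close>
  define m where "m = (i \<cdot>\<^bsub>D\<^esub> f) \<boxplus>\<^bsub>D\<^esub> (j \<cdot>\<^bsub>D\<^esub> g)"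
  have m: "m \<in> Arr D" "Dom D m = X" "Cod D m = B"
    using B fg by (auto simp: m_def)
  have "p \<cdot>\<^bsub>D\<^esub> m = f" "q \<cdot>\<^bsub>D\<^esub> m = g"
    using B fg D.Comp_reduce[OF eqs(1), of f] D.Comp_reduce[OF eqs(2), of g]
      D.Comp_reduce[OF eqs(3), of g] D.Comp_reduce[OF eqs(4), of f]
    by (auto simp: m_def D.Comp_distrib_left)
  then show "far G (f \<boxplus>\<^bsub>D\<^esub> g) = far G f \<boxplus>\<^bsub>C\<^esub> far G g"
    using B m pq G.far_Comp_Arr[of m p] G.far_Comp_Arr[of m q] G.far_Comp_Arr[of m "p \<boxplus>\<^bsub>D\<^esub> q"]
    by (simp add: D.Comp_distrib_right C.Comp_distrib_right)
qed

lemma transpose_F_inject: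
  assumes "b \<in> Arr D" "b' \<in> Arr D" "X \<in> Ob C" "Dom D b = fob F X" "Dom D b' = fob F X"
    "Cod D b = Cod D b'" "far G b \<cdot>\<^bsub>C\<^esub> \<eta> X = far G b' \<cdot>\<^bsub>C\<^esub> \<eta> X"
  shows "b = b'"
proof -
  have eq: "\<epsilon> (Cod D x) \<cdot>\<^bsub>D\<^esub> far F (far G x \<cdot>\<^bsub>C\<^esub> \<eta> X) = x"
    if "x \<in> Arr D" "Dom D x = fob F X" for x
    using transpose_G[of "\<eta> X" x] that assms(3) by (simp add: triangle_F)
  show ?thesis
    using eq[of b] eq[of b'] assms by metis
qed

text \<open>By naturality of the unit, \<open>F f\<close> transposes to
  \<open>\<eta> \<cdot> f\<close>, which is additive in \<open>f\<close>. Since \<open>G\<close> is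
  already additive, transposition respects sums as well, and it is injective.\<close>

lemma additive_functor_F: "additive_functor C D F"
proof
  interpret G: additive_functor D C G
    by (rule additive_functor_G)
  fix f g X Y assume fg: "f \<in> Hom C X Y" "g \<in> Hom C X Y"
  then show "far F (f \<boxplus>\<^bsub>C\<^esub> g) = far F f \<boxplus>\<^bsub>D\<^esub> far F g"
    using unit.naturality_Arr[of f] unit.naturality_Arr[of g] unit.naturality_Arr[of "f \<boxplus>\<^bsub>C\<^esub> g"]
    by - (rule transpose_F_inject[of _ _ X],
        auto simp: G.far_Add_Arr C.Comp_distrib_right C.Comp_distrib_left)
qed

end

text \<open>The inverse of suspension is left adjoint to it, with identities as unit and counit;
  additivity then comes from the adjunction.\<close>

sublocale suspended_category \<subseteq> Susp: additive_functor C C "Susp C"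
proof -
  obtain S where S: "cat_functor C C S" "functor_eq C (S \<circ>\<^sub>F Susp C) id_functor"
    "functor_eq C (Susp C \<circ>\<^sub>F S) id_functor"
    using Susp_invertible by blast
  interpret S: cat_functor C C S by fact
  have [simp]: "\<And>X. X \<in> Ob C \<Longrightarrow> fob S (fob (Susp C) X) = X" "\<And>X. X \<in> Ob C \<Longrightarrow> fob (Susp C) (fob S X) = X"
    "\<And>f. f \<in> Arr C \<Longrightarrow> far S (far (Susp C) f) = f" "\<And>f. f \<in> Arr C \<Longrightarrow> far (Susp C) (far S f) = f"
    using S by (auto simp: functor_eq_def)
  interpret additive_adjunction C C S "Susp C" "Idt C" "Idt C"
    by (intro additive_adjunction.intro additive_category_axioms adjunction.intro nat_trans.intro
        cat_functor_id cat_functor_comp[of C C _ C] category_axioms Susp.cat_functor_axioms S.cat_functor_axioms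
        nat_trans_axioms.intro adjunction_axioms.intro)
       (use S.cat_functor_axioms Susp.cat_functor_axioms in auto)
  show "additive_functor C C (Susp C)"
    by (rule additive_functor_G)
qed

section \<open>Pre-triangulated categories\<close>

context additive_category
begin

text \<open>The witness is \<open>3 q^2 - 2 q^3\<close>: this polynomial fixes 0 and 1 with
  vanishing derivative at both, so \<open>p^2 - p\<close> is a multiple of
  \<open>(q^2 - q)^2\<close>. The last two conclusions allow \<open>p\<close> to replace
  \<open>q\<close> beside arrows on which \<open>q\<close> already acts as an idempotent.\<close>

lemma idempotent_lift:
  assumes q: "q \<in> Arr C" "Dom C q = X" "Cod C q = X"
    and nilpotent: "(q \<cdot> q \<boxplus> Neg C q) \<cdot> (q \<cdot> q \<boxplus> Neg C q) = Zer C X X"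
  obtains p where "p \<in> Arr C" "Dom C p = X" "Cod C p = X" "p \<cdot> p = p"
    "\<And>v. v \<in> Arr C \<Longrightarrow> Cod C v = X \<Longrightarrow> q \<cdot> (q \<cdot> v) = q \<cdot> v \<Longrightarrow> p \<cdot> v = q \<cdot> v"
    "\<And>w. w \<in> Arr C \<Longrightarrow> Dom C w = X \<Longrightarrow> (w \<cdot> q) \<cdot> q = w \<cdot> q \<Longrightarrow> w \<cdot> p = w \<cdot> q"
proof -
  \<comment> \<open>Here \<open>t = q^3 - q^2\<close>, so \<open>q^2 - 2 t\<close> is the polynomial
    \<open>3 q^2 - 2 q^3\<close>. Written with \<open>n\<close> and \<open>t\<close>, the
    computation reduces to \<open>n n = 0\<close>, \<open>t t = 0\<close> and
    \<open>q t = t q = t\<close>.\<close>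
  define n where "n = q \<cdot> q \<boxplus> Neg C q"
  define t where "t = q \<cdot> n"
  define p where "p = q \<cdot> q \<boxplus> Neg C (t \<boxplus> t)"
  have X: "X \<in> Ob C"
    using q by auto
  have n: "n \<in> Arr C" "Dom C n = X" "Cod C n = X" and t: "t \<in> Arr C" "Dom C t = X" "Cod C t = X"
    using q by (auto simp: n_def t_def)
  have nn: "n \<cdot> n = Zer C X X"
    using nilpotent by (simp add: n_def)
  have nq: "n \<cdot> q = t"
    using q by (simp add: t_def n_def Comp_distrib_left Comp_distrib_right Comp_assoc_Arr)
  have qq: "q \<cdot> q = q \<boxplus> n"
    using q X Add_left_commute[of q "q \<cdot> q" "Neg C q"] by (simp add: n_def)
  have nt: "n \<cdot> t = Zer C X X"
    using q n nq nn X Comp_reduce[OF nq[unfolded t_def], of n] by (simp add: t_def Comp_assoc_Arr)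
  have tn: "t \<cdot> n = Zer C X X"
    using q n nn X by (simp add: t_def Comp_assoc_Arr)
  have qt: "q \<cdot> t = t"
    using q n t qq tn nn Comp_reduce[OF qq, of n] X by (simp add: t_def Comp_distrib_right)
  have tq: "t \<cdot> q = t"
    using q n t qt nq by (simp add: t_def Comp_assoc_Arr)
  have tt: "t \<cdot> t = Zer C X X"
    using q n t nt X by (subst (1) t_def) (simp add: Comp_assoc_Arr)
  have qqt: "(q \<cdot> q) \<cdot> t = t" "t \<cdot> (q \<cdot> q) = t"
    using q t qt tq Comp_reduce[OF tq, of q] by (simp_all add: Comp_assoc_Arr)
  have qqqq: "(q \<cdot> q) \<cdot> (q \<cdot> q) = q \<cdot> q \<boxplus> (t \<boxplus> t)"
  proof -
    have "(q \<cdot> q) \<cdot> (q \<cdot> q) = (q \<boxplus> n) \<cdot> (q \<boxplus> n)"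
      by (simp add: qq)
    also have "\<dots> = (q \<cdot> q \<boxplus> n \<cdot> q) \<boxplus> (q \<cdot> n \<boxplus> n \<cdot> n)"
      using q n by (simp add: Comp_distrib_left Comp_distrib_right)
    also have "\<dots> = q \<cdot> q \<boxplus> (t \<boxplus> t)"
      using q n t nn nq t_def[symmetric] by (simp add: Add_assoc)
    finally show ?thesis .
  qed
  have p: "p \<in> Arr C" "Dom C p = X" "Cod C p = X"
    using q t by (auto simp: p_def)
  have pt: "p \<cdot> t = t"
    using q t X tt qqt by (simp add: p_def Comp_distrib_left Comp_distrib_right)
  have "p \<cdot> p = p \<cdot> (q \<cdot> q) \<boxplus> Neg C (t \<boxplus> t)"
    using q t p pt by (subst (2) p_def) (simp add: Comp_distrib_left)
  also have "p \<cdot> (q \<cdot> q) = (q \<cdot> q) \<cdot> (q \<cdot> q) \<boxplus> Neg C (t \<boxplus> t)"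
    using q t qqt by (simp add: p_def Comp_distrib_right)
  also have "\<dots> = q \<cdot> q"
    using q t X by (simp add: qqqq Add_assoc)
  finally have pp: "p \<cdot> p = p"
    by (simp add: p_def)
  have pv: "p \<cdot> v = q \<cdot> v" if v: "v \<in> Arr C" "Cod C v = X" "q \<cdot> (q \<cdot> v) = q \<cdot> v" for v
  proof -
    have "n \<cdot> v = Zer C (Dom C v) X"
      using q v by (simp add: n_def Comp_distrib_right Comp_assoc_Arr)
    then have "t \<cdot> v = Zer C (Dom C v) X"
      using q n v by (simp add: t_def Comp_assoc_Arr)
    then show ?thesis
      using q t v X by (simp add: p_def Comp_distrib_right Comp_assoc_Arr)
  qed
  have wp: "w \<cdot> p = w \<cdot> q" if w: "w \<in> Arr C" "Dom C w = X" "(w \<cdot> q) \<cdot> q = w \<cdot> q" for w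
  proof -
    have "w \<cdot> n = Zer C X (Cod C w)"
      using q w by (simp add: n_def Comp_distrib_left flip: Comp_assoc_Arr)
    then have "w \<cdot> t = Zer C X (Cod C w)"
      using q n w by (simp flip: nq Comp_assoc_Arr)
    then show ?thesis
      using q t w X by (simp add: p_def Comp_distrib_left flip: Comp_assoc_Arr)
  qed
  show ?thesis
    using that p pp pv wp by blast
qed

end

context suspended_category
begin

lemma Susp_inverse:
  obtains S where "cat_functor C C S"
    "\<And>X. X \<in> Ob C \<Longrightarrow> fob S (fob (Susp C) X) = X" "\<And>X. X \<in> Ob C \<Longrightarrow> fob (Susp C) (fob S X) = X"
    "\<And>f. f \<in> Arr C \<Longrightarrow> far S (far (Susp C) f) = f" "\<And>f. f \<in> Arr C \<Longrightarrow> far (Susp C) (far S f) = f"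
  using Susp_invertible by (auto simp: functor_eq_def)

lemma Susp_inject: "f \<in> Arr C \<Longrightarrow> g \<in> Arr C \<Longrightarrow> far (Susp C) f = far (Susp C) g \<Longrightarrow> f = g"
  by (metis Susp_inverse)

lemma Susp_full:
  assumes "g \<in> Arr C" "Dom C g = fob (Susp C) X" "Cod C g = fob (Susp C) Y" "X \<in> Ob C" "Y \<in> Ob C"
  obtains f where "f \<in> Arr C" "Dom C f = X" "Cod C f = Y" "far (Susp C) f = g"
proof -
  obtain S where S: "cat_functor C C S"
    "\<And>X. X \<in> Ob C \<Longrightarrow> fob S (fob (Susp C) X) = X" "\<And>f. f \<in> Arr C \<Longrightarrow> far (Susp C) (far S f) = f"
    using Susp_inverse by metis
  interpret S: cat_functor C C S by fact
  show ?thesis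
    using that[of "far S g"] S assms by simp
qed

lemma triangle_map_iff:
  assumes "is_triangle C u v w" "is_triangle C u' v' w'"
  shows "triangle_map C (u, v, w) (u', v', w') f g h \<longleftrightarrow>
    f \<in> Arr C \<and> g \<in> Arr C \<and> h \<in> Arr C \<and> Dom C f = Dom C u \<and> Cod C f = Dom C u' \<and>
    Dom C g = Cod C u \<and> Cod C g = Cod C u' \<and> Dom C h = Cod C v \<and> Cod C h = Cod C v' \<and>
    g \<cdot> u = u' \<cdot> f \<and> h \<cdot> v = v' \<cdot> g \<and> far (Susp C) f \<cdot> w = w' \<cdot> h"
  using assms by (auto simp: triangle_map_def is_triangle_def)

end

section \<open>Exactness of distinguished triangles, and their retracts\<close>

context pretriangulated
begin

lemma dist_Arr:
  assumes "(u, v, w) \<in> \<Delta>"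
  shows "u \<in> Arr C" "v \<in> Arr C" "w \<in> Arr C" "Dom C v = Cod C u" "Dom C w = Cod C v"
    "Cod C w = fob (Susp C) (Dom C u)"
  using dist_triangle[OF assms] by (auto simp: is_triangle_def)

lemma dist_rotated:
  "(u, v, w) \<in> \<Delta> \<Longrightarrow> (Neg C v, Neg C w, Neg C (far (Susp C) u)) \<in> \<Delta>"
  using dist_rotate dist_triangle by blast

text \<open>The pair \<open>Idt\<close>, \<open>u\<close> maps the identity triangle to
  \<open>(u, v, w)\<close>; the third component starts at a zero object, and
  \<open>v \<cdot> u\<close> factors through it.\<close>

lemma dist_comp_12:
  assumes "(u, v, w) \<in> \<Delta>"
  shows "v \<cdot> u = Zer C (Dom C u) (Cod C v)"
proof -
  note arr = dist_Arr[OF assms]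
  obtain N where N: "zero_object C N"
    using ex_zero_object by blast
  then have Ob: "N \<in> Ob C" "Dom C u \<in> Ob C"
    using arr by (auto simp: zero_object_iff)
  obtain h where "triangle_map C (Idt C (Dom C u), Zer C (Dom C u) N, Zer C N (fob (Susp C) (Dom C u)))
      (u, v, w) (Idt C (Dom C u)) u h"
    using dist_map[OF dist_identity[OF _ N] assms, of "Dom C u" "Idt C (Dom C u)" u] arr Ob by auto
  then show ?thesis
    using arr Ob by (auto simp: triangle_map_def)
qed

lemma dist_comp_23:
  assumes "(u, v, w) \<in> \<Delta>"
  shows "w \<cdot> v = Zer C (Cod C u) (fob (Susp C) (Dom C u))"
  using dist_comp_12[OF dist_rotated[OF assms]] dist_Arr[OF assms] by simp

text \<open>Rotating the identity triangle of the source \<open>A\<close> of \<open>a\<close> gives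
  a triangle on \<open>A \<rightarrow> 0\<close>. As \<open>v \<cdot> a\<close> vanishes,
  \<open>a\<close> and zero map it to the rotation of \<open>(u, v, w)\<close>; the filler is an
  arrow between suspensions, and desuspending it yields \<open>b\<close>.\<close>

lemma dist_exact_2:
  assumes "(u, v, w) \<in> \<Delta>" "a \<in> Arr C" "Cod C a = Cod C u" "v \<cdot> a = Zer C (Dom C a) (Cod C v)"
  obtains b where "b \<in> Arr C" "Dom C b = Dom C a" "Cod C b = Dom C u" "u \<cdot> b = a"
proof -
  note arr = dist_Arr[OF assms(1)]
  define A where "A = Dom C a"
  obtain N where N: "zero_object C N"
    using ex_zero_object by blast
  then have Ob: "N \<in> Ob C" "A \<in> Ob C"
    using assms by (auto simp: zero_object_iff A_def)
  have "(Zer C A N, Zer C N (fob (Susp C) A), Neg C (Idt C (fob (Susp C) A))) \<in> \<Delta>"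
    using dist_rotated[OF dist_identity[OF _ N], of A] Ob by simp
  from dist_map[OF this dist_rotated[OF assms(1)], of a "Zer C N (Cod C v)"] obtain h
    where "triangle_map C (Zer C A N, Zer C N (fob (Susp C) A), Neg C (Idt C (fob (Susp C) A)))
      (Neg C v, Neg C w, Neg C (far (Susp C) u)) a (Zer C N (Cod C v)) h"
    using arr Ob assms A_def by auto
  then have h: "h \<in> Arr C" "Dom C h = fob (Susp C) A" "Cod C h = fob (Susp C) (Dom C u)"
    "Neg C (far (Susp C) a) = Neg C (far (Susp C) u \<cdot> h)"
    using arr Ob assms A_def by (auto simp: triangle_map_def)
  obtain b where b: "b \<in> Arr C" "Dom C b = A" "Cod C b = Dom C u" "far (Susp C) b = h"
    using Susp_full[OF h(1-3)] arr Ob by auto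
  with h arr assms(2,3) have "far (Susp C) a = far (Susp C) (u \<cdot> b)"
    by (simp add: Neg_eq_iff Susp.far_Comp_Arr)
  then have "u \<cdot> b = a"
    using arr b assms(2) by - (rule Susp_inject, auto)
  then show ?thesis
    using that b A_def by simp
qed

text \<open>Exactness at the second place of the rotated triangle; the sign that rotation puts on
  \<open>v\<close> is absorbed in \<open>b\<close>.\<close>

lemma dist_exact_3:
  assumes "(u, v, w) \<in> \<Delta>" "a \<in> Arr C" "Cod C a = Cod C v"
    "w \<cdot> a = Zer C (Dom C a) (fob (Susp C) (Dom C u))"
  obtains b where "b \<in> Arr C" "Dom C b = Dom C a" "Cod C b = Cod C u" "v \<cdot> b = a"
proof -
  note arr = dist_Arr[OF assms(1)]
  obtain b where "b \<in> Arr C" "Dom C b = Dom C a" "Cod C b = Cod C u" "Neg C v \<cdot> b = a"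
    using dist_exact_2[OF dist_rotated[OF assms(1)], of a] arr assms by auto
  then show ?thesis
    using that[of "Neg C b"] arr by simp
qed

lemma dist_exact_4:
  assumes "(u, v, w) \<in> \<Delta>" "a \<in> Arr C" "Cod C a = fob (Susp C) (Dom C u)"
    "far (Susp C) u \<cdot> a = Zer C (Dom C a) (fob (Susp C) (Cod C u))"
  obtains b where "b \<in> Arr C" "Dom C b = Dom C a" "Cod C b = Cod C v" "w \<cdot> b = a"
proof -
  note arr = dist_Arr[OF assms(1)]
  obtain b where "b \<in> Arr C" "Dom C b = Dom C a" "Cod C b = Cod C v" "Neg C w \<cdot> b = a"
    using dist_exact_3[OF dist_rotated[OF assms(1)], of a] arr assms by auto
  then show ?thesis
    using that[of "Neg C b"] arr by simp
qed

text \<open>The retract inherits exactness of its long \<open>Hom\<close> sequences, so by the five lemma it is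
  isomorphic to the distinguished triangle on the same first arrow.\<close>

lemma dist_retract:
  assumes dist: "(u, v, w) \<in> \<Delta>" and tri: "is_triangle C u' v' w'"
    and i: "triangle_map C (u', v', w') (u, v, w) i1 i2 i3"
    and r: "triangle_map C (u, v, w) (u', v', w') r1 r2 r3"
    and ri: "r1 \<cdot> i1 = Idt C (Dom C u')" "r2 \<cdot> i2 = Idt C (Cod C u')" "r3 \<cdot> i3 = Idt C (Cod C v')"
  shows "(u', v', w') \<in> \<Delta>"
proof -
  note arr = dist_Arr[OF dist]
  have arr': "u' \<in> Arr C" "v' \<in> Arr C" "w' \<in> Arr C" "Dom C v' = Cod C u'" "Dom C w' = Cod C v'"
    "Cod C w' = fob (Susp C) (Dom C u')"
    using tri by (auto simp: is_triangle_def)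
  have i: "i1 \<in> Arr C" "i2 \<in> Arr C" "i3 \<in> Arr C" "Dom C i1 = Dom C u'" "Cod C i1 = Dom C u"
    "Dom C i2 = Cod C u'" "Cod C i2 = Cod C u" "Dom C i3 = Cod C v'" "Cod C i3 = Cod C v"
    and iu: "i2 \<cdot> u' = u \<cdot> i1" and iv: "i3 \<cdot> v' = v \<cdot> i2" and iw: "far (Susp C) i1 \<cdot> w' = w \<cdot> i3"
    using i by (auto simp: triangle_map_iff[OF tri dist_triangle[OF dist]])
  have r: "r1 \<in> Arr C" "r2 \<in> Arr C" "r3 \<in> Arr C" "Dom C r1 = Dom C u" "Cod C r1 = Dom C u'"
    "Dom C r2 = Cod C u" "Cod C r2 = Cod C u'" "Dom C r3 = Cod C v" "Cod C r3 = Cod C v'"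
    and ru: "r2 \<cdot> u = u' \<cdot> r1" and rv: "r3 \<cdot> v = v' \<cdot> r2" and rw: "far (Susp C) r1 \<cdot> w = w' \<cdot> r3"
    using r by (auto simp: triangle_map_iff[OF dist_triangle[OF dist] tri])
  obtain v'' w'' where dist'': "(u', v'', w'') \<in> \<Delta>"
    using dist_complete arr'(1) by blast
  note arr'' = dist_Arr[OF dist'']
  obtain h where "triangle_map C (u', v'', w'') (u, v, w) i1 i2 h"
    using dist_map[OF dist'' dist, of i1 i2] i iu by auto
  then have h: "h \<in> Arr C" "Dom C h = Cod C v''" "Cod C h = Cod C v"
    and hv: "h \<cdot> v'' = v \<cdot> i2" and hw: "far (Susp C) i1 \<cdot> w'' = w \<cdot> h"
    by (auto simp: triangle_map_iff[OF dist_triangle[OF dist''] dist_triangle[OF dist]])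
  \<comment> \<open>The comparison of cones over the identity of \<open>u'\<close>: into the ambient
    triangle by the filler \<open>h\<close>, back by the retraction \<open>r3\<close>.\<close>
  define \<theta> where "\<theta> = r3 \<cdot> h"
  have \<theta>: "\<theta> \<in> Arr C" "Dom C \<theta> = Cod C v''" "Cod C \<theta> = Cod C v'"
    using h r by (auto simp: \<theta>_def)
  have \<theta>v: "\<theta> \<cdot> v'' = v'"
  proof -
    have "\<theta> \<cdot> v'' = r3 \<cdot> (v \<cdot> i2)"
      using h r arr'' by (simp add: \<theta>_def Comp_assoc_Arr hv)
    also have "\<dots> = v' \<cdot> (r2 \<cdot> i2)"
      using rv r i arr arr' Comp_reduce[OF rv, of i2] by (simp add: Comp_assoc_Arr)
    finally show ?thesis
      using ri arr' by simp
  qed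
  have w\<theta>: "w' \<cdot> \<theta> = w''"
  proof -
    have "w' \<cdot> \<theta> = far (Susp C) r1 \<cdot> (w \<cdot> h)"
      using h r arr arr' Comp_reduce[OF rw[symmetric], of h] by (simp add: \<theta>_def Comp_assoc_Arr)
    also have "\<dots> = (far (Susp C) r1 \<cdot> far (Susp C) i1) \<cdot> w''"
      using r i arr'' by (simp add: hw[symmetric] Comp_assoc_Arr)
    also have "\<dots> = w''"
      using r i arr'' arr' ri by (simp flip: Susp.far_Comp_Arr)
    finally show ?thesis .
  qed
  \<comment> \<open>Exactness passes to the retract: include \<open>a\<close> in the ambient
    triangle, factor it there, and retract the factor. The same argument serves one place
    earlier.\<close>
  have exact_Z': "\<exists>c. c \<in> Arr C \<and> Dom C c = Dom C a \<and> Cod C c = Cod C u' \<and> v' \<cdot> c = a"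
    if a: "a \<in> Arr C" "Cod C a = Cod C v'" "w' \<cdot> a = Zer C (Dom C a) (fob (Susp C) (Dom C u'))" for a
  proof -
    have "w \<cdot> (i3 \<cdot> a) = Zer C (Dom C a) (fob (Susp C) (Dom C u))"
      using Comp_reduce[OF iw[symmetric], of a] a arr i arr' by (simp add: Comp_assoc_Arr)
    then obtain b where b: "b \<in> Arr C" "Dom C b = Dom C a" "Cod C b = Cod C u" "v \<cdot> b = i3 \<cdot> a"
      using dist_exact_3[OF dist, of "i3 \<cdot> a"] a arr i by auto
    have "v' \<cdot> (r2 \<cdot> b) = r3 \<cdot> (i3 \<cdot> a)"
      using Comp_reduce[OF rv[symmetric], of b] b arr arr' r by (simp add: Comp_assoc_Arr)
    also have "\<dots> = a"
      using Comp_reduce[OF ri(3), of a] a r i arr' by simp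
    finally show ?thesis
      using b r by (intro exI[of _ "r2 \<cdot> b"]) auto
  qed
  have exact_Y': "\<exists>c. c \<in> Arr C \<and> Dom C c = Dom C a \<and> Cod C c = Dom C u' \<and> u' \<cdot> c = a"
    if a: "a \<in> Arr C" "Cod C a = Cod C u'" "v' \<cdot> a = Zer C (Dom C a) (Cod C v')" for a
  proof -
    have "v \<cdot> (i2 \<cdot> a) = Zer C (Dom C a) (Cod C v)"
      using Comp_reduce[OF iv[symmetric], of a] a arr i arr' by (simp add: Comp_assoc_Arr)
    then obtain b where b: "b \<in> Arr C" "Dom C b = Dom C a" "Cod C b = Dom C u" "u \<cdot> b = i2 \<cdot> a"
      using dist_exact_2[OF dist, of "i2 \<cdot> a"] a arr i by auto
    have "u' \<cdot> (r1 \<cdot> b) = r2 \<cdot> (i2 \<cdot> a)"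
      using Comp_reduce[OF ru[symmetric], of b] b arr arr' r by (simp add: Comp_assoc_Arr)
    also have "\<dots> = a"
      using Comp_reduce[OF ri(2), of a] a r i arr' by simp
    finally show ?thesis
      using b r by (intro exI[of _ "r1 \<cdot> b"]) auto
  qed
  \<comment> \<open>Injectivity half of the five lemma, chased with generalised elements
    \<open>a\<close>.\<close>
  have \<theta>_mono: "a = Zer C (Dom C a) (Cod C v'')"
    if a: "a \<in> Arr C" "Cod C a = Cod C v''" "\<theta> \<cdot> a = Zer C (Dom C a) (Cod C v')" for a
  proof -
    have "w'' \<cdot> a = Zer C (Dom C a) (fob (Susp C) (Dom C u'))"
      using Comp_reduce[OF w\<theta>, of a] a \<theta> arr' by simp
    then obtain b where b: "b \<in> Arr C" "Dom C b = Dom C a" "Cod C b = Cod C u'" "v'' \<cdot> b = a"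
      using dist_exact_3[OF dist'', of a] a by auto
    have "v' \<cdot> b = Zer C (Dom C b) (Cod C v')"
      using Comp_reduce[OF \<theta>v, of b] b a \<theta> arr'' by simp
    then obtain c where c: "c \<in> Arr C" "Dom C c = Dom C a" "Cod C c = Dom C u'" "u' \<cdot> c = b"
      using exact_Y'[of b] b by auto
    have "v'' \<cdot> (u' \<cdot> c) = Zer C (Dom C a) (Cod C v'')"
      using Comp_reduce[OF dist_comp_12[OF dist''], of c] c arr'' by simp
    then show ?thesis
      using b c by simp
  qed
  \<comment> \<open>Surjectivity half, applied to the identity of \<open>Cod C v'\<close>:
    \<open>b\<close> is a first approximation to a preimage under \<open>\<theta>\<close>. It exists
    because the suspension of \<open>u'\<close> annihilates \<open>w'\<close>, a relation inherited
    from the ambient triangle through the retraction.\<close>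
  obtain b where b: "b \<in> Arr C" "Dom C b = Cod C v'" "Cod C b = Cod C v''" "w'' \<cdot> b = w'"
  proof (rule dist_exact_4[OF dist'', of w'])
    have "far (Susp C) r2 \<cdot> (far (Susp C) i2 \<cdot> (far (Susp C) u' \<cdot> w')) =
      far (Susp C) r2 \<cdot> (far (Susp C) u \<cdot> (w \<cdot> i3))"
    proof -
      have "far (Susp C) i2 \<cdot> far (Susp C) u' = far (Susp C) u \<cdot> far (Susp C) i1"
        using iu i arr arr' by (simp flip: Susp.far_Comp_Arr)
      from Comp_reduce[OF this, of w'] show ?thesis
        using i arr arr' r by (simp add: Comp_assoc_Arr iw)
    qed
    also have "far (Susp C) u \<cdot> (w \<cdot> i3) = Zer C (Cod C v') (fob (Susp C) (Cod C u))"
    proof -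
      have "far (Susp C) u \<cdot> w = Zer C (Cod C v) (fob (Susp C) (Cod C u))"
        using dist_comp_23[OF dist_rotated[OF dist]] arr by simp
      from Comp_reduce[OF this, of i3] show ?thesis
        using i arr by simp
    qed
    also have "far (Susp C) r2 \<cdot> (far (Susp C) i2 \<cdot> (far (Susp C) u' \<cdot> w')) = far (Susp C) u' \<cdot> w'"
    proof -
      have "far (Susp C) r2 \<cdot> far (Susp C) i2 = Idt C (fob (Susp C) (Cod C u'))"
        using ri r i arr' by (simp flip: Susp.far_Comp_Arr)
      from Comp_reduce[OF this, of "far (Susp C) u' \<cdot> w'"] show ?thesis
        using i arr' r by simp
    qed
    finally show "far (Susp C) u' \<cdot> w' = Zer C (Dom C w') (fob (Susp C) (Cod C u'))"
      using r arr' by simp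
  qed (use arr' that in auto)
  have "w' \<cdot> (Idt C (Cod C v') \<boxplus> Neg C (\<theta> \<cdot> b)) = Zer C (Cod C v') (fob (Susp C) (Dom C u'))"
    using b \<theta> arr' w\<theta> Comp_reduce[OF w\<theta>, of b] by (simp add: Comp_distrib_left)
  then obtain c where c: "c \<in> Arr C" "Dom C c = Cod C v'" "Cod C c = Cod C u'"
    "v' \<cdot> c = Idt C (Cod C v') \<boxplus> Neg C (\<theta> \<cdot> b)"
    using exact_Z'[of "Idt C (Cod C v') \<boxplus> Neg C (\<theta> \<cdot> b)"] b \<theta> arr' by auto
  \<comment> \<open>\<open>v' \<cdot> c\<close> is exactly the error
    \<open>Idt - \<theta> \<cdot> b\<close>, and \<open>\<theta> \<cdot> v'' = v'\<close>; adding
    \<open>v'' \<cdot> c\<close> therefore makes \<open>b\<close> a right inverse of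
    \<open>\<theta>\<close>.\<close>
  define \<rho> where "\<rho> = v'' \<cdot> c \<boxplus> b"
  have \<rho>: "\<rho> \<in> Arr C" "Dom C \<rho> = Cod C v'" "Cod C \<rho> = Cod C v''"
    using b c arr'' by (auto simp: \<rho>_def)
  have "\<theta> \<cdot> \<rho> = v' \<cdot> c \<boxplus> \<theta> \<cdot> b"
    using Comp_reduce[OF \<theta>v, of c] b c \<theta> arr'' by (simp add: \<rho>_def Comp_distrib_left)
  also have "\<dots> = Idt C (Cod C v')"
    using b \<theta> arr' by (simp add: c Add_assoc)
  finally have \<theta>\<rho>: "\<theta> \<cdot> \<rho> = Idt C (Cod C v')" .
  \<comment> \<open>A right inverse of an arrow with trivial kernel is two-sided.\<close>
  have "\<theta> \<cdot> (\<rho> \<cdot> \<theta> \<boxplus> Neg C (Idt C (Cod C v''))) = Zer C (Cod C v'') (Cod C v')"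
    using \<theta> \<rho> arr'' Comp_reduce[OF \<theta>\<rho>, of \<theta>] by (simp add: Comp_distrib_left)
  then have "\<rho> \<cdot> \<theta> \<boxplus> Neg C (Idt C (Cod C v'')) = Zer C (Cod C v'') (Cod C v'')"
    using \<theta>_mono[of "\<rho> \<cdot> \<theta> \<boxplus> Neg C (Idt C (Cod C v''))"] \<theta> \<rho> arr'' by simp
  then have "\<rho> \<cdot> \<theta> = Idt C (Cod C v'')"
    using \<theta> \<rho> arr'' by - (rule diff_eq_Zer, auto)
  then have "iso_arr C \<theta>"
    using \<theta>\<rho> \<theta> \<rho> by (intro iso_arrI[of \<theta> \<rho>]) auto
  moreover have "triangle_map C (u', v'', w'') (u', v', w') (Idt C (Dom C u')) (Idt C (Cod C u')) \<theta>"
    using \<theta> \<theta>v w\<theta> arr' arr'' by (simp add: triangle_map_iff[OF dist_triangle[OF dist''] tri])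
  ultimately show ?thesis
    using dist_iso_closed[OF dist'' tri] arr' by auto
qed

end

section \<open>Equivalences, reflected triangles and the coidentifier\<close>

locale fully_faithful = cat_functor A B F
  for A :: "('oa, 'ma, 'za) category_data_scheme" and B :: "('ob, 'mb, 'zb) category_data_scheme"
    and F :: "('oa, 'ma, 'ob, 'mb) functor_data" +
  assumes faithful: "f \<in> Hom A X Y \<Longrightarrow> g \<in> Hom A X Y \<Longrightarrow> far F f = far F g \<Longrightarrow> f = g"
    and full: "X \<in> Ob A \<Longrightarrow> Y \<in> Ob A \<Longrightarrow> h \<in> Hom B (fob F X) (fob F Y) \<Longrightarrow> \<exists>f \<in> Hom A X Y. far F f = h"
begin

lemma faithful_Arr:
  "far F f = far F g \<Longrightarrow> f \<in> Arr A \<Longrightarrow> g \<in> Arr A \<Longrightarrow> Dom A f = Dom A g \<Longrightarrow> Cod A f = Cod A g \<Longrightarrow> f = g"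
  using faithful by auto

lemma fullE:
  assumes "X \<in> Ob A" "Y \<in> Ob A" "h \<in> Arr B" "Dom B h = fob F X" "Cod B h = fob F Y"
  obtains f where "f \<in> Arr A" "Dom A f = X" "Cod A f = Y" "far F f = h"
  using full[of X Y h] assms by auto

definition lift :: "'oa \<Rightarrow> 'oa \<Rightarrow> 'mb \<Rightarrow> 'ma" where
  "lift X Y h = (SOME f. f \<in> Hom A X Y \<and> far F f = h)"

lemma lift [simp]:
  assumes "X \<in> Ob A" "Y \<in> Ob A" "h \<in> Arr B" "Dom B h = fob F X" "Cod B h = fob F Y"
  shows "lift X Y h \<in> Arr A" "Dom A (lift X Y h) = X" "Cod A (lift X Y h) = Y" "far F (lift X Y h) = h"
proof -
  have "\<exists>f. f \<in> Hom A X Y \<and> far F f = h"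
    using full[of X Y h] assms by auto
  then have "lift X Y h \<in> Hom A X Y \<and> far F (lift X Y h) = h"
    unfolding lift_def by (rule someI_ex)
  then show "lift X Y h \<in> Arr A" "Dom A (lift X Y h) = X" "Cod A (lift X Y h) = Y" "far F (lift X Y h) = h"
    by auto
qed

end

locale weak_equivalence = fully_faithful A B F
  for A :: "('oa, 'ma, 'za) category_data_scheme" and B :: "('ob, 'mb, 'zb) category_data_scheme"
    and F :: "('oa, 'ma, 'ob, 'mb) functor_data" +
  assumes ess_surj: "Y \<in> Ob B \<Longrightarrow> \<exists>X \<in> Ob A. \<exists>\<phi> \<in> Hom B (fob F X) Y. iso_arr B \<phi>"
begin

lemma ess_surjE:
  assumes "Y \<in> Ob B"
  obtains X \<phi> \<psi> where "X \<in> Ob A" "\<phi> \<in> Arr B" "Dom B \<phi> = fob F X" "Cod B \<phi> = Y"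
    "\<psi> \<in> Arr B" "Dom B \<psi> = Y" "Cod B \<psi> = fob F X"
    "\<psi> \<cdot>\<^bsub>B\<^esub> \<phi> = Idt B (fob F X)" "\<phi> \<cdot>\<^bsub>B\<^esub> \<psi> = Idt B Y"
  using ess_surj[OF assms] by (auto elim!: B.iso_arrE)

text \<open>Choose for every \<open>Y\<close> an isomorphism \<open>\<phi> Y\<close> from some
  \<open>F (R Y)\<close>, with inverse \<open>\<psi> Y\<close>. The quasi-inverse sends
  \<open>g\<close> to the lift of its conjugate by these isomorphisms; all laws are checked after
  applying the faithful \<open>F\<close>, where inverse pairs cancel.\<close>

lemma cat_equivalence: "cat_equivalence A B F"
proof -
  have "\<exists>X \<phi> \<psi>. X \<in> Ob A \<and> \<phi> \<in> Arr B \<and> Dom B \<phi> = fob F X \<and> Cod B \<phi> = Y \<and>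
      \<psi> \<in> Arr B \<and> Dom B \<psi> = Y \<and> Cod B \<psi> = fob F X \<and>
      \<psi> \<cdot>\<^bsub>B\<^esub> \<phi> = Idt B (fob F X) \<and> \<phi> \<cdot>\<^bsub>B\<^esub> \<psi> = Idt B Y" if "Y \<in> Ob B" for Y
    using that by (rule ess_surjE) blast
  then obtain R \<phi> \<psi> where R: "\<And>Y. Y \<in> Ob B \<Longrightarrow> R Y \<in> Ob A \<and> \<phi> Y \<in> Arr B \<and> Dom B (\<phi> Y) = fob F (R Y) \<and>
      Cod B (\<phi> Y) = Y \<and> \<psi> Y \<in> Arr B \<and> Dom B (\<psi> Y) = Y \<and> Cod B (\<psi> Y) = fob F (R Y) \<and>
      \<psi> Y \<cdot>\<^bsub>B\<^esub> \<phi> Y = Idt B (fob F (R Y)) \<and> \<phi> Y \<cdot>\<^bsub>B\<^esub> \<psi> Y = Idt B Y"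
    by metis
  then have [simp]: "\<And>Y. Y \<in> Ob B \<Longrightarrow> R Y \<in> Ob A"
    "\<And>Y. Y \<in> Ob B \<Longrightarrow> \<phi> Y \<in> Arr B" "\<And>Y. Y \<in> Ob B \<Longrightarrow> Dom B (\<phi> Y) = fob F (R Y)"
    "\<And>Y. Y \<in> Ob B \<Longrightarrow> Cod B (\<phi> Y) = Y"
    "\<And>Y. Y \<in> Ob B \<Longrightarrow> \<psi> Y \<in> Arr B" "\<And>Y. Y \<in> Ob B \<Longrightarrow> Cod B (\<psi> Y) = fob F (R Y)"
    "\<And>Y. Y \<in> Ob B \<Longrightarrow> Dom B (\<psi> Y) = Y"
    and inv: "\<And>Y. Y \<in> Ob B \<Longrightarrow> \<psi> Y \<cdot>\<^bsub>B\<^esub> \<phi> Y = Idt B (fob F (R Y))"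
    "\<And>Y. Y \<in> Ob B \<Longrightarrow> \<phi> Y \<cdot>\<^bsub>B\<^esub> \<psi> Y = Idt B Y"
    by blast+
  have \<phi>\<psi>: "\<phi> Y \<cdot>\<^bsub>B\<^esub> (\<psi> Y \<cdot>\<^bsub>B\<^esub> f) = f" if "Y \<in> Ob B" "f \<in> Arr B" "Cod B f = Y" for Y f
    using that B.Comp_reduce[OF inv(2), of Y f] by simp
  define F' where "F' = \<lparr>fob = R, far = (\<lambda>g. lift (R (Dom B g)) (R (Cod B g))
    (\<psi> (Cod B g) \<cdot>\<^bsub>B\<^esub> (g \<cdot>\<^bsub>B\<^esub> \<phi> (Dom B g))))\<rparr>"
  have F'_Ob [simp]: "fob F' Y = R Y" for Y
    by (simp add: F'_def)
  have F'_Arr [simp]: "far F' g \<in> Arr A" "Dom A (far F' g) = R (Dom B g)" "Cod A (far F' g) = R (Cod B g)"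
    and FF': "far F (far F' g) = \<psi> (Cod B g) \<cdot>\<^bsub>B\<^esub> (g \<cdot>\<^bsub>B\<^esub> \<phi> (Dom B g))" if "g \<in> Arr B" for g
    using that by (simp_all add: F'_def)
  interpret F': cat_functor B A F'
  proof
    fix Y assume "Y \<in> Ob B"
    then show "far F' (Idt B Y) = Idt A (fob F' Y)"
      by - (rule faithful_Arr, auto simp: FF' inv)
  next
    fix f g X Y Z assume "f \<in> Hom B X Y" "g \<in> Hom B Y Z"
    then show "far F' (g \<cdot>\<^bsub>B\<^esub> f) = far F' g \<cdot>\<^bsub>A\<^esub> far F' f"
      by - (rule faithful_Arr, auto simp: FF' far_Comp_Arr B.Comp_assoc_Arr \<phi>\<psi>)
  qed auto
  interpret F'F: cat_functor A A "F' \<circ>\<^sub>F F"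
    by (rule cat_functor_comp[OF cat_functor_axioms F'.cat_functor_axioms])
  interpret FF': cat_functor B B "F \<circ>\<^sub>F F'"
    by (rule cat_functor_comp[OF F'.cat_functor_axioms cat_functor_axioms])
  interpret idA: cat_functor A A id_functor
    by (rule cat_functor_id) unfold_locales
  interpret idB: cat_functor B B id_functor
    by (rule cat_functor_id) unfold_locales
  define \<alpha> where "\<alpha> X = lift X (R (fob F X)) (\<psi> (fob F X))" for X
  have \<alpha>_Arr: "\<alpha> X \<in> Arr A" "Dom A (\<alpha> X) = X" "Cod A (\<alpha> X) = R (fob F X)" "far F (\<alpha> X) = \<psi> (fob F X)"
    if "X \<in> Ob A" for X
    using that by (simp_all add: \<alpha>_def)
  have "nat_trans A A id_functor (F' \<circ>\<^sub>F F) \<alpha>"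
  proof
    fix f X Y assume f: "f \<in> Hom A X Y"
    then have "X \<in> Ob A" "Y \<in> Ob A"
      by auto
    with f show "\<alpha> Y \<cdot>\<^bsub>A\<^esub> far id_functor f = far (F' \<circ>\<^sub>F F) f \<cdot>\<^bsub>A\<^esub> \<alpha> X"
      by - (rule faithful_Arr, auto simp: FF' far_Comp_Arr B.Comp_assoc_Arr \<alpha>_Arr inv)
  qed (auto simp: \<alpha>_Arr)
  moreover have "iso_arr A (\<alpha> X)" if "X \<in> Ob A" for X
  proof (rule A.iso_arrI[of _ "lift (R (fob F X)) X (\<phi> (fob F X))"])
    show "lift (R (fob F X)) X (\<phi> (fob F X)) \<cdot>\<^bsub>A\<^esub> \<alpha> X = Idt A (Dom A (\<alpha> X))"
      by (rule faithful_Arr) (auto simp: that \<alpha>_Arr far_Comp_Arr inv)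
    show "\<alpha> X \<cdot>\<^bsub>A\<^esub> lift (R (fob F X)) X (\<phi> (fob F X)) = Idt A (Cod A (\<alpha> X))"
      by (rule faithful_Arr) (auto simp: that \<alpha>_Arr far_Comp_Arr inv)
  qed (auto simp: that \<alpha>_Arr)
  moreover have "nat_trans B B (F \<circ>\<^sub>F F') id_functor \<phi>"
    by unfold_locales (auto simp: FF' \<phi>\<psi>)
  moreover have "iso_arr B (\<phi> Y)" if "Y \<in> Ob B" for Y
    by (rule B.iso_arrI[of _ "\<psi> Y"]) (auto simp: that inv)
  ultimately show ?thesis
    unfolding cat_equivalence_def nat_isomorphic_def
    using cat_functor_axioms F'.cat_functor_axioms by blast
qed

end

section \<open>Triangles reflected along an additive functor that commutes with suspension\<close>

locale stable_additive_functor = A: suspended_category A + B: suspended_category B +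
    additive_functor A B F
  for A :: "('oa, 'ma, 'za) suspended_data_scheme" and B :: "('ob, 'mb, 'zb) suspended_data_scheme"
    and F :: "('oa, 'ma, 'ob, 'mb) functor_data" +
  assumes commutes_Susp: "functor_commutes_Susp A B F"
begin

lemma Susp_commute [simp]:
  "X \<in> Ob A \<Longrightarrow> fob F (fob (Susp A) X) = fob (Susp B) (fob F X)"
  "f \<in> Arr A \<Longrightarrow> far F (far (Susp A) f) = far (Susp B) (far F f)"
  using commutes_Susp by (auto simp: functor_commutes_Susp_def functor_eq_def)

lemma is_triangle_far: "is_triangle A u v w \<Longrightarrow> is_triangle B (far F u) (far F v) (far F w)"
  by (auto simp: is_triangle_def)

lemma triangle_map_far:
  assumes t: "is_triangle A u v w" "is_triangle A u' v' w'" "triangle_map A (u, v, w) (u', v', w') f g h"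
  shows "triangle_map B (far F u, far F v, far F w) (far F u', far F v', far F w')
    (far F f) (far F g) (far F h)"
proof -
  note arr = t(3)[unfolded A.triangle_map_iff[OF t(1,2)]] t(1,2)[unfolded is_triangle_def]
  then have "far F g \<cdot>\<^bsub>B\<^esub> far F u = far F u' \<cdot>\<^bsub>B\<^esub> far F f"
    "far F h \<cdot>\<^bsub>B\<^esub> far F v = far F v' \<cdot>\<^bsub>B\<^esub> far F g"
    "far F (far (Susp A) f) \<cdot>\<^bsub>B\<^esub> far F w = far F w' \<cdot>\<^bsub>B\<^esub> far F h"
    by (simp_all flip: far_Comp_Arr del: Susp_commute)
  with arr show ?thesis
    unfolding B.triangle_map_iff[OF t(1,2)[THEN is_triangle_far]] by auto
qed

end

locale reflected_pretriangulation = stable_additive_functor A B F + B: pretriangulated B \<Delta>B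
  for A :: "('oa, 'ma, 'za) suspended_data_scheme" and B :: "('ob, 'mb, 'zb) suspended_data_scheme"
    and F :: "('oa, 'ma, 'ob, 'mb) functor_data" and \<Delta>B
begin

abbreviation \<Delta>A where "\<Delta>A \<equiv> reflected_triangles A F \<Delta>B"

lemma reflected_iff: "(u, v, w) \<in> \<Delta>A \<longleftrightarrow> is_triangle A u v w \<and> (far F u, far F v, far F w) \<in> \<Delta>B"
  by (simp add: reflected_triangles_def)

text \<open>Isomorphism closure, identity triangles and rotation concern given triangles whose data
  \<open>F\<close> preserves, so they are inherited from \<open>B\<close>. Only the two axioms that
  assert existence of arrows in \<open>A\<close> are left to be supplied.\<close>

lemma pretriangulatedI:
  assumes complete: "\<And>u. u \<in> Arr A \<Longrightarrow> \<exists>v w. (u, v, w) \<in> \<Delta>A"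
    and fill: "\<And>u v w u' v' w' f g. (u, v, w) \<in> \<Delta>A \<Longrightarrow> (u', v', w') \<in> \<Delta>A \<Longrightarrow> f \<in> Arr A \<Longrightarrow> g \<in> Arr A \<Longrightarrow>
      Dom A f = Dom A u \<Longrightarrow> Cod A f = Dom A u' \<Longrightarrow> Dom A g = Cod A u \<Longrightarrow> Cod A g = Cod A u' \<Longrightarrow>
      g \<cdot>\<^bsub>A\<^esub> u = u' \<cdot>\<^bsub>A\<^esub> f \<Longrightarrow> \<exists>h. triangle_map A (u, v, w) (u', v', w') f g h"
  shows "pretriangulated A \<Delta>A"
proof
  fix u v w u' v' w' f g h
  assume "(u, v, w) \<in> \<Delta>A" "is_triangle A u' v' w'" "triangle_map A (u, v, w) (u', v', w') f g h"
    "iso_arr A f" "iso_arr A g" "iso_arr A h"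
  then show "(u', v', w') \<in> \<Delta>A"
    unfolding reflected_iff
    using B.dist_iso_closed is_triangle_far triangle_map_far iso_arr_far by meson
next
  fix X N assume "X \<in> Ob A" "zero_object A N"
  then show "(Idt A X, Zer A X N, Zer A N (fob (Susp A) X)) \<in> \<Delta>A"
    unfolding reflected_iff
    using B.dist_identity[of "fob F X" "fob F N"] zero_object_fob[of N]
    by (auto simp: is_triangle_def A.zero_object_iff)
next
  fix u v w assume t: "is_triangle A u v w"
  then have arr: "u \<in> Arr A" "v \<in> Arr A" "w \<in> Arr A"
    by (auto simp: is_triangle_def)
  have "is_triangle A (Neg A v) (Neg A w) (Neg A (far (Susp A) u))"
    using t by (auto simp: is_triangle_def)
  then show "(u, v, w) \<in> \<Delta>A \<longleftrightarrow> (Neg A v, Neg A w, Neg A (far (Susp A) u)) \<in> \<Delta>A"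
    unfolding reflected_iff using t B.dist_rotate[OF is_triangle_far[OF t]] arr
    by (simp add: far_Neg)
next
  fix u v w u' v' w' f g
  assume "(u, v, w) \<in> \<Delta>A" "(u', v', w') \<in> \<Delta>A"
    "f \<in> Hom A (Dom A u) (Dom A u')" "g \<in> Hom A (Cod A u) (Cod A u')" "g \<cdot>\<^bsub>A\<^esub> u = u' \<cdot>\<^bsub>A\<^esub> f"
  then show "\<exists>h. triangle_map A (u, v, w) (u', v', w') f g h"
    using fill by auto
qed (use complete reflected_iff in auto)

lemma exact_functor_reflected:
  assumes "pretriangulated A \<Delta>A"
  shows "exact_functor A \<Delta>A B \<Delta>B F"
proof -
  interpret A: pretriangulated A \<Delta>A by fact
  show ?thesis
    by unfold_locales (auto simp: commutes_Susp reflected_iff)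
qed

end

locale reflected_along_equivalence = reflected_pretriangulation A B F \<Delta>B + weak_equivalence A B F
  for A :: "('oa, 'ma, 'za) suspended_data_scheme" and B :: "('ob, 'mb, 'zb) suspended_data_scheme"
    and F :: "('oa, 'ma, 'ob, 'mb) functor_data" and \<Delta>B
begin

text \<open>A cone of \<open>F u\<close> can be moved along an isomorphism to some
  \<open>F Z\<close>; fullness then lifts its arrows. Fillers lift in the same way, and faithfulness
  makes their squares commute.\<close>

lemma pretriangulated_reflected: "pretriangulated A \<Delta>A"
proof (rule pretriangulatedI)
  fix u assume u: "u \<in> Arr A"
  then obtain v w where dist: "(far F u, v, w) \<in> \<Delta>B"
    using B.dist_complete by (meson far_Arr)
  note arr = B.dist_Arr[OF dist]
  obtain Z \<phi> \<psi> where Z: "Z \<in> Ob A" "\<phi> \<in> Arr B" "Dom B \<phi> = fob F Z" "Cod B \<phi> = Cod B v"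
    "\<psi> \<in> Arr B" "Dom B \<psi> = Cod B v" "Cod B \<psi> = fob F Z"
    "\<psi> \<cdot>\<^bsub>B\<^esub> \<phi> = Idt B (fob F Z)" "\<phi> \<cdot>\<^bsub>B\<^esub> \<psi> = Idt B (Cod B v)"
    using arr by (auto intro: ess_surjE[of "Cod B v"])
  obtain v' where v': "v' \<in> Arr A" "Dom A v' = Cod A u" "Cod A v' = Z" "far F v' = \<psi> \<cdot>\<^bsub>B\<^esub> v"
    using u Z arr by (auto intro: fullE[of "Cod A u" Z "\<psi> \<cdot>\<^bsub>B\<^esub> v"])
  obtain w' where w': "w' \<in> Arr A" "Dom A w' = Z" "Cod A w' = fob (Susp A) (Dom A u)"
    "far F w' = w \<cdot>\<^bsub>B\<^esub> \<phi>"
    using u Z arr by (auto intro: fullE[of Z "fob (Susp A) (Dom A u)" "w \<cdot>\<^bsub>B\<^esub> \<phi>"])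
  have t: "is_triangle A u v' w'"
    using u v' w' by (auto simp: is_triangle_def)
  have "triangle_map B (far F u, v, w) (far F u, far F v', far F w')
      (Idt B (fob F (Dom A u))) (Idt B (fob F (Cod A u))) \<psi>"
    unfolding B.triangle_map_iff[OF B.dist_triangle[OF dist] is_triangle_far[OF t]]
    using u v' w' Z arr by (simp add: B.Comp_assoc_Arr)
  moreover have "iso_arr B \<psi>"
    using Z by (intro B.iso_arrI[of \<psi> \<phi>]) auto
  ultimately have "(far F u, far F v', far F w') \<in> \<Delta>B"
    using B.dist_iso_closed[OF dist is_triangle_far[OF t]] u by auto
  then show "\<exists>v w. (u, v, w) \<in> \<Delta>A"
    using t reflected_iff by blast
next
  fix u v w u' v' w' f g
  assume "(u, v, w) \<in> \<Delta>A" "(u', v', w') \<in> \<Delta>A"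
    and fg: "f \<in> Arr A" "g \<in> Arr A"
      "Dom A f = Dom A u" "Cod A f = Dom A u'" "Dom A g = Cod A u" "Cod A g = Cod A u'"
      "g \<cdot>\<^bsub>A\<^esub> u = u' \<cdot>\<^bsub>A\<^esub> f"
  then have t: "is_triangle A u v w" "is_triangle A u' v' w'"
    and dist: "(far F u, far F v, far F w) \<in> \<Delta>B" "(far F u', far F v', far F w') \<in> \<Delta>B"
    by (auto simp: reflected_iff)
  have arr: "u \<in> Arr A" "v \<in> Arr A" "w \<in> Arr A" "Dom A v = Cod A u" "Dom A w = Cod A v"
    "Cod A w = fob (Susp A) (Dom A u)"
    "u' \<in> Arr A" "v' \<in> Arr A" "w' \<in> Arr A" "Dom A v' = Cod A u'" "Dom A w' = Cod A v'"
    "Cod A w' = fob (Susp A) (Dom A u')"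
    using t by (auto simp: is_triangle_def)
  have "far F g \<cdot>\<^bsub>B\<^esub> far F u = far F u' \<cdot>\<^bsub>B\<^esub> far F f"
    using fg arr by (simp flip: far_Comp_Arr)
  then obtain k where "triangle_map B (far F u, far F v, far F w) (far F u', far F v', far F w') (far F f) (far F g) k"
    using B.dist_map[OF dist, of "far F f" "far F g"] fg arr by auto
  then have k: "k \<in> Arr B" "Dom B k = fob F (Cod A v)" "Cod B k = fob F (Cod A v')"
    "k \<cdot>\<^bsub>B\<^esub> far F v = far F v' \<cdot>\<^bsub>B\<^esub> far F g"
    "far (Susp B) (far F f) \<cdot>\<^bsub>B\<^esub> far F w = far F w' \<cdot>\<^bsub>B\<^esub> k"
    unfolding B.triangle_map_iff[OF t[THEN is_triangle_far]] using arr by auto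
  obtain h where h: "h \<in> Arr A" "Dom A h = Cod A v" "Cod A h = Cod A v'" "far F h = k"
    using k arr by (auto intro: fullE[of "Cod A v" "Cod A v'" k])
  have "h \<cdot>\<^bsub>A\<^esub> v = v' \<cdot>\<^bsub>A\<^esub> g"
    using h k arr fg by - (rule faithful_Arr, auto simp: far_Comp_Arr)
  moreover have "far (Susp A) f \<cdot>\<^bsub>A\<^esub> w = w' \<cdot>\<^bsub>A\<^esub> h"
    using h k arr fg by - (rule faithful_Arr, auto simp: far_Comp_Arr)
  ultimately show "\<exists>h. triangle_map A (u, v, w) (u', v', w') f g h"
    using fg h by (auto simp: A.triangle_map_iff[OF t])
qed

end

section \<open>The coidentifier as a suspended category\<close>

locale stable_endotransformation = suspended_category D +
    e: nat_trans D D id_functor id_functor e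
  for D :: "('o, 'm, 'z) suspended_data_scheme" (structure) and e :: "'o \<Rightarrow> 'm" +
  assumes e_Susp: "nat_trans_commutes_Susp D D e"
begin

abbreviation De where "De \<equiv> coidentifier D e"
abbreviation cls where "cls \<equiv> coid_class D e"

lemma coid_rel_iff:
  "(f, g) \<in> coid_rel D e \<longleftrightarrow> f \<in> Arr D \<and> g \<in> Arr D \<and> Dom D f = Dom D g \<and> Cod D f = Cod D g \<and>
     e (Cod D g) \<cdot> f = e (Cod D g) \<cdot> g"
  by (auto simp: coid_rel_def)

lemma equiv_coid_rel: "equiv (Arr D) (coid_rel D e)"
  by (rule equivI) (auto simp: refl_on_def coid_rel_iff intro!: symI transI)

lemma cls_eq_iff: "f \<in> Arr D \<Longrightarrow> g \<in> Arr D \<Longrightarrow> cls f = cls g \<longleftrightarrow> (f, g) \<in> coid_rel D e"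
  unfolding coid_class_def by (rule eq_equiv_class_iff[OF equiv_coid_rel])

lemma cls_eqI: "(f, g) \<in> coid_rel D e \<Longrightarrow> cls f = cls g"
  unfolding coid_class_def by (rule equiv_class_eq[OF equiv_coid_rel])

text \<open>The operations of the coidentifier act on arbitrarily chosen members
  \<open>rep c\<close>; this is the bridge to rules about a given representative.\<close>

lemma coid_rel_rep:
  assumes "f \<in> Arr D"
  shows "(rep (cls f), f) \<in> coid_rel D e"
proof -
  have "f \<in> cls f"
    using assms by (auto simp: coid_class_def coid_rel_iff)
  then have "rep (cls f) \<in> cls f"
    unfolding rep_def by (rule someI)
  then show ?thesis
    by (auto simp: coid_class_def coid_rel_iff)
qed

lemma e_natural: "f \<in> Arr D \<Longrightarrow> e (Cod D f) \<cdot> f = f \<cdot> e (Dom D f)"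
  using e.naturality_Arr[of f] by simp

text \<open>Naturality of \<open>e\<close> carries it past \<open>g'\<close> to the place where the
  hypothesis on \<open>f\<close> applies, and back again.\<close>

lemma coid_rel_Comp:
  assumes "(f, f') \<in> coid_rel D e" "(g, g') \<in> coid_rel D e" "Dom D g = Cod D f"
  shows "(g \<cdot> f, g' \<cdot> f') \<in> coid_rel D e"
proof -
  have arr: "f \<in> Arr D" "f' \<in> Arr D" "g \<in> Arr D" "g' \<in> Arr D" "Dom D f = Dom D f'" "Cod D f = Cod D f'"
    "Dom D g = Dom D g'" "Cod D g = Cod D g'" "Dom D g' = Cod D f'"
    and eq: "e (Cod D f') \<cdot> f = e (Cod D f') \<cdot> f'" "e (Cod D g') \<cdot> g = e (Cod D g') \<cdot> g'"
    using assms by (auto simp: coid_rel_iff)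
  have "e (Cod D g') \<cdot> (g \<cdot> f) = (e (Cod D g') \<cdot> g') \<cdot> f"
    using arr by (simp flip: Comp_assoc_Arr eq)
  also have "\<dots> = g' \<cdot> (e (Cod D f') \<cdot> f)"
    using arr e_natural[of g'] by (simp add: Comp_assoc_Arr)
  also have "\<dots> = (g' \<cdot> e (Cod D f')) \<cdot> f'"
    using arr by (simp add: eq Comp_assoc_Arr)
  also have "\<dots> = e (Cod D g') \<cdot> (g' \<cdot> f')"
    using arr e_natural[of g'] by (simp flip: Comp_assoc_Arr)
  finally show ?thesis
    using arr by (simp add: coid_rel_iff)
qed

lemma coid_rel_Add:
  assumes "(f, f') \<in> coid_rel D e" "(g, g') \<in> coid_rel D e" "Dom D f = Dom D g" "Cod D f = Cod D g"
  shows "(f \<boxplus> g, f' \<boxplus> g') \<in> coid_rel D e"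
  using assms by (auto simp: coid_rel_iff Comp_distrib_left)

text \<open>Kept general in \<open>S\<close> because it serves suspension as well as its
  inverse.\<close>

lemma coid_rel_far:
  assumes "additive_functor D D S" "(f, g) \<in> coid_rel D e" "\<And>X. X \<in> Ob D \<Longrightarrow> e (fob S X) = far S (e X)"
  shows "(far S f, far S g) \<in> coid_rel D e"
proof -
  interpret S: additive_functor D D S by fact
  have "far S (e (Cod D g) \<cdot> f) = far S (e (Cod D g) \<cdot> g)"
    using assms(2) by (auto simp: coid_rel_iff)
  then have "far S (e (Cod D g)) \<cdot> far S f = far S (e (Cod D g)) \<cdot> far S g"
    using assms(2) by (auto simp: coid_rel_iff simp flip: S.far_Comp_Arr)
  then show ?thesis
    using assms(2,3) by (auto simp: coid_rel_iff)
qed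

lemma Ob_De [simp]: "Ob De = Ob D"
  by (simp add: coidentifier_def)

lemma cls_Arr [simp]:
  assumes "f \<in> Arr D"
  shows "cls f \<in> Arr De" "Dom De (cls f) = Dom D f" "Cod De (cls f) = Cod D f"
  using assms coid_rel_rep[OF assms]
  by (auto simp: coidentifier_def coid_class_def coid_rel_iff intro: quotientI)

lemma Arr_DeE:
  assumes "c \<in> Arr De"
  obtains f where "f \<in> Arr D" "c = cls f"
  using assms by (auto simp: coidentifier_def coid_class_def elim: quotientE)

lemma Idt_De [simp]: "Idt De X = cls (Idt D X)"
  by (simp add: coidentifier_def)

lemma Zer_De [simp]: "Zer De X Y = cls (Zer D X Y)"
  by (simp add: coidentifier_def)

lemma Comp_De [simp]:
  "f \<in> Arr D \<Longrightarrow> g \<in> Arr D \<Longrightarrow> Dom D g = Cod D f \<Longrightarrow> cls g \<cdot>\<^bsub>De\<^esub> cls f = cls (g \<cdot> f)"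
  using coid_rel_Comp[OF coid_rel_rep coid_rel_rep, of f g] coid_rel_rep[of f] coid_rel_rep[of g]
  by (auto simp: coidentifier_def coid_rel_iff intro!: cls_eqI)

lemma Add_De [simp]:
  "f \<in> Arr D \<Longrightarrow> g \<in> Arr D \<Longrightarrow> Dom D f = Dom D g \<Longrightarrow> Cod D f = Cod D g
     \<Longrightarrow> cls f \<boxplus>\<^bsub>De\<^esub> cls g = cls (f \<boxplus> g)"
  using coid_rel_Add[OF coid_rel_rep coid_rel_rep, of f g] coid_rel_rep[of f] coid_rel_rep[of g]
  by (auto simp: coidentifier_def coid_rel_iff intro!: cls_eqI)

lemma Susp_De [simp]:
  "fob (Susp De) X = fob (Susp D) X"
  "f \<in> Arr D \<Longrightarrow> far (Susp De) (cls f) = cls (far (Susp D) f)"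
  using coid_rel_far[OF Susp.additive_functor_axioms coid_rel_rep] e_Susp
  by (auto simp: coidentifier_def nat_trans_commutes_Susp_def intro!: cls_eqI)

lemma category_De: "category De"
  by unfold_locales (auto elim!: Arr_DeE simp: Comp_assoc_Arr)

lemma additive_category_De: "additive_category De"
proof -
  interpret De: category De
    by (rule category_De)
  show ?thesis
  proof (intro additive_category.intro additive_category_axioms.intro De.category_axioms)
    fix X Y assume XY: "X \<in> Ob De" "Y \<in> Ob De"
    show "comm_group (hom_group De X Y)"
    proof (rule comm_groupI)
      fix c assume "c \<in> carrier (hom_group De X Y)"
      then obtain f where f: "f \<in> Arr D" "c = cls f" "Dom D f = X" "Cod D f = Y"
        by (auto simp: hom_group_def elim!: Arr_DeE)
      then show "\<exists>d\<in>carrier (hom_group De X Y).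
          d \<otimes>\<^bsub>hom_group De X Y\<^esub> c = \<one>\<^bsub>hom_group De X Y\<^esub>"
        by (intro bexI[of _ "cls (Neg D f)"]) (auto simp: hom_group_def)
    qed (use XY in \<open>auto simp: hom_group_def Add_assoc Add_commute Add_left_commute elim!: Arr_DeE\<close>)
  next
    fix f f' g X Y Z
    assume "f \<in> Hom De X Y" "f' \<in> Hom De X Y" "g \<in> Hom De Y Z"
    then show "g \<cdot>\<^bsub>De\<^esub> (f \<boxplus>\<^bsub>De\<^esub> f') = g \<cdot>\<^bsub>De\<^esub> f \<boxplus>\<^bsub>De\<^esub> g \<cdot>\<^bsub>De\<^esub> f'"
      by (auto elim!: Arr_DeE simp: Comp_distrib_left)
  next
    fix f g g' X Y Z
    assume "f \<in> Hom De X Y" "g \<in> Hom De Y Z" "g' \<in> Hom De Y Z"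
    then show "(g \<boxplus>\<^bsub>De\<^esub> g') \<cdot>\<^bsub>De\<^esub> f = g \<cdot>\<^bsub>De\<^esub> f \<boxplus>\<^bsub>De\<^esub> g' \<cdot>\<^bsub>De\<^esub> f"
      by (auto elim!: Arr_DeE simp: Comp_distrib_right)
  next
    obtain N where N: "zero_object D N"
      using ex_zero_object by blast
    \<comment> \<open>Each class between \<open>X\<close> and \<open>Y\<close> has a representative
      there, so a one-element Hom set stays one in the quotient.\<close>
    have "\<exists>!c. c \<in> Hom De X Y" if unique: "\<exists>!f. f \<in> Hom D X Y" for X Y
    proof -
      obtain f where f: "f \<in> Hom D X Y" "\<And>g. g \<in> Hom D X Y \<Longrightarrow> g = f"
        using unique by blast
      show ?thesis
      proof (rule ex1I[of _ "cls f"])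
        fix c assume c: "c \<in> Hom De X Y"
        then obtain g where g: "g \<in> Arr D" "c = cls g"
          by (auto elim: Arr_DeE)
        with c have "g \<in> Hom D X Y"
          by simp
        with g f(2) show "c = cls f"
          by blast
      qed (use f(1) in auto)
    qed
    note unique = this
    have N: "N \<in> Ob D" "\<And>X. X \<in> Ob D \<Longrightarrow> \<exists>!f. f \<in> Hom D X N"
      "\<And>X. X \<in> Ob D \<Longrightarrow> \<exists>!f. f \<in> Hom D N X"
      using N unfolding zero_object_def by blast+
    have "zero_object De N"
      unfolding zero_object_def Ob_De by (intro conjI ballI unique N)
    then show "\<exists>N. zero_object De N" ..
  next
    fix X Y assume "X \<in> Ob De" "Y \<in> Ob De"
    then obtain B i j p q where B: "B \<in> Ob D" "i \<in> Hom D X B" "j \<in> Hom D Y B" "p \<in> Hom D B X" "q \<in> Hom D B Y"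
      and eqs: "p \<cdot> i = Idt D X" "q \<cdot> j = Idt D Y" "p \<cdot> j = Zer D Y X" "q \<cdot> i = Zer D X Y"
        "(i \<cdot> p) \<boxplus> (j \<cdot> q) = Idt D B"
      using ex_biproduct[of X Y] by auto
    have arr: "i \<in> Arr D" "j \<in> Arr D" "p \<in> Arr D" "q \<in> Arr D" "Dom D i = X" "Cod D i = B"
      "Dom D j = Y" "Cod D j = B" "Dom D p = B" "Cod D p = X" "Dom D q = B" "Cod D q = Y"
      using B by auto
    show "\<exists>B \<in> Ob De. \<exists>i \<in> Hom De X B. \<exists>j \<in> Hom De Y B. \<exists>p \<in> Hom De B X. \<exists>q \<in> Hom De B Y.
        p \<cdot>\<^bsub>De\<^esub> i = Idt De X \<and> q \<cdot>\<^bsub>De\<^esub> j = Idt De Y \<and> p \<cdot>\<^bsub>De\<^esub> j = Zer De Y X \<and> q \<cdot>\<^bsub>De\<^esub> i = Zer De X Y \<and>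
        (i \<cdot>\<^bsub>De\<^esub> p) \<boxplus>\<^bsub>De\<^esub> (j \<cdot>\<^bsub>De\<^esub> q) = Idt De B"
      using arr B(1) eqs
      by (intro bexI[of _ B] bexI[of _ "cls i"] bexI[of _ "cls j"] bexI[of _ "cls p"] bexI[of _ "cls q"] conjI)
         simp_all
  qed
qed

text \<open>The inverse \<open>S\<close> of suspension must act on classes too. It is additive
  because suspension is faithful, and it commutes with \<open>e\<close> by cancelling suspension in
  the corresponding equation at \<open>S X\<close>.\<close>

lemma suspended_category_De: "suspended_category De"
proof -
  interpret De: additive_category De
    by (rule additive_category_De)
  interpret SDe: cat_functor De De "Susp De"
    by unfold_locales (auto elim!: Arr_DeE simp: Susp.far_Comp_Arr)
  obtain S where S: "cat_functor D D S"
    "\<And>X. X \<in> Ob D \<Longrightarrow> fob S (fob (Susp D) X) = X" "\<And>X. X \<in> Ob D \<Longrightarrow> fob (Susp D) (fob S X) = X"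
    "\<And>f. f \<in> Arr D \<Longrightarrow> far S (far (Susp D) f) = f" "\<And>f. f \<in> Arr D \<Longrightarrow> far (Susp D) (far S f) = f"
    using Susp_inverse by metis
  interpret S: cat_functor D D S by fact
  interpret S: additive_functor D D S
  proof
    fix f g X Y assume fg: "f \<in> Hom D X Y" "g \<in> Hom D X Y"
    then show "far S (f \<boxplus> g) = far S f \<boxplus> far S g"
      by - (rule Susp_inject, auto simp: Susp.far_Add_Arr S)
  qed
  have e_S: "e (fob S X) = far S (e X)" if "X \<in> Ob D" for X
  proof -
    have "e (fob (Susp D) (fob S X)) = far (Susp D) (e (fob S X))"
      using that e_Susp by (simp add: nat_trans_commutes_Susp_def)
    then have "e X = far (Susp D) (e (fob S X))"
      using that by (simp add: S(3))
    then show ?thesis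
      using that by (simp add: S(4))
  qed
  define S' where "S' = \<lparr>fob = fob S, far = (\<lambda>c. cls (far S (rep c)))\<rparr>"
  have fob_S' [simp]: "fob S' X = fob S X" for X
    by (simp add: S'_def)
  have far_S' [simp]: "far S' (cls f) = cls (far S f)" if "f \<in> Arr D" for f
    using coid_rel_far[OF S.additive_functor_axioms coid_rel_rep[OF that] e_S]
    by (auto simp: S'_def intro!: cls_eqI)
  have "cat_functor De De S'"
    by unfold_locales (auto elim!: Arr_DeE simp: S.far_Comp_Arr)
  moreover have "functor_eq De (S' \<circ>\<^sub>F Susp De) id_functor" "functor_eq De (Susp De \<circ>\<^sub>F S') id_functor"
    by (auto simp: functor_eq_def S elim!: Arr_DeE)
  ultimately show ?thesis
    by unfold_locales blast
qed

lemma quotient_functor_simps [simp]: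
  "fob (quotient_functor D e) X = X" "far (quotient_functor D e) f = cls f"
  by (auto simp: quotient_functor_def)

end

text \<open>Used twice: for \<open>G\<close>, where the factor functor is the given
  \<open>Ge\<close>, and for the comparison functor \<open>K\<close>, where it is the desired
  equivalence.\<close>

locale coidentified_functor = stable_endotransformation D e + cat_functor D C G
  for D :: "('od, 'md, 'zd) suspended_data_scheme" and e :: "'od \<Rightarrow> 'md"
    and C :: "('oc, 'mc, 'zc) category_data_scheme" and G :: "('od, 'md, 'oc, 'mc) functor_data" +
  assumes far_coid_rel: "(f, g) \<in> coid_rel D e \<Longrightarrow> far G f = far G g"
begin

lemma factor_functor_simps [simp]:
  "fob (factor_functor G) X = fob G X"
  "f \<in> Arr D \<Longrightarrow> far (factor_functor G) (cls f) = far G f"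
  using far_coid_rel[OF coid_rel_rep] by (auto simp: factor_functor_def)

lemma cat_functor_factor: "cat_functor De C (factor_functor G)"
proof -
  interpret De: category De
    by (rule category_De)
  show ?thesis
    by unfold_locales (auto elim!: Arr_DeE simp: far_Comp_Arr)
qed

end

section \<open>The Eilenberg-Moore category of a stable monad\<close>

locale stable_monad = suspended_category C + T: stable_additive_functor C C T +
    mult: nat_trans C C "T \<circ>\<^sub>F T" T \<mu> + unit: nat_trans C C id_functor T \<eta>
  for C :: "('o, 'm, 'z) suspended_data_scheme" (structure)
    and T :: "('o, 'm, 'o, 'm) functor_data" and \<mu> \<eta> :: "'o \<Rightarrow> 'm" +
  assumes mult_assoc: "X \<in> Ob C \<Longrightarrow> \<mu> X \<cdot> far T (\<mu> X) = \<mu> X \<cdot> \<mu> (fob T X)"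
    and mult_unit_left: "X \<in> Ob C \<Longrightarrow> \<mu> X \<cdot> \<eta> (fob T X) = Idt C (fob T X)"
    and mult_unit_right: "X \<in> Ob C \<Longrightarrow> \<mu> X \<cdot> far T (\<eta> X) = Idt C (fob T X)"
    and mult_Susp: "nat_trans_commutes_Susp C C \<mu>"
    and unit_Susp: "nat_trans_commutes_Susp C C \<eta>"
begin

abbreviation CT where "CT \<equiv> eilenberg_moore C T \<mu> \<eta>"

lemma nat_Susp [simp]:
  "X \<in> Ob C \<Longrightarrow> \<mu> (fob (Susp C) X) = far (Susp C) (\<mu> X)"
  "X \<in> Ob C \<Longrightarrow> \<eta> (fob (Susp C) X) = far (Susp C) (\<eta> X)"
  using mult_Susp unit_Susp by (auto simp: nat_trans_commutes_Susp_def)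

lemma mult_natural: "f \<in> Arr C \<Longrightarrow> \<mu> (Cod C f) \<cdot> far T (far T f) = far T f \<cdot> \<mu> (Dom C f)"
  using mult.naturality_Arr[of f] by simp

lemma unit_natural: "f \<in> Arr C \<Longrightarrow> \<eta> (Cod C f) \<cdot> f = far T f \<cdot> \<eta> (Dom C f)"
  using unit.naturality_Arr[of f] by simp

lemma Ob_CT_iff: "(X, h) \<in> Ob CT \<longleftrightarrow> X \<in> Ob C \<and> h \<in> Arr C \<and> Dom C h = fob T X \<and> Cod C h = X \<and>
    h \<cdot> far T h = h \<cdot> \<mu> X \<and> h \<cdot> \<eta> X = Idt C X"
  by (simp add: eilenberg_moore_def EM_modules_def Let_def)

lemma Ob_CT [simp]:
  assumes "M \<in> Ob CT"
  shows "fst M \<in> Ob C" "snd M \<in> Arr C" "Dom C (snd M) = fob T (fst M)" "Cod C (snd M) = fst M"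
  using assms Ob_CT_iff[of "fst M" "snd M"] by auto

lemma module_laws:
  assumes "M \<in> Ob CT"
  shows "snd M \<cdot> far T (snd M) = snd M \<cdot> \<mu> (fst M)" "snd M \<cdot> \<eta> (fst M) = Idt C (fst M)"
  using assms Ob_CT_iff[of "fst M" "snd M"] by auto

lemma Arr_CT [simp]: "(M, f, N) \<in> Arr CT \<longleftrightarrow> M \<in> Ob CT \<and> N \<in> Ob CT \<and>
    f \<in> Arr C \<and> Dom C f = fst M \<and> Cod C f = fst N \<and> f \<cdot> snd M = snd N \<cdot> far T f"
  by (cases M; cases N) (auto simp: eilenberg_moore_def EM_arrows_def Let_def)

lemma CT_simps [simp]:
  "Dom CT (M, f, N) = M" "Cod CT (M, f, N) = N" "Idt CT M = (M, Idt C (fst M), M)"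
  "(M', g, N') \<cdot>\<^bsub>CT\<^esub> (M, f, N) = (M, g \<cdot> f, N')"
  "Zer CT M N = (M, Zer C (fst M) (fst N), N)" "(M, f, N) \<boxplus>\<^bsub>CT\<^esub> (M', g, N') = (M, f \<boxplus> g, N)"
  "fob (Susp CT) M = (fob (Susp C) (fst M), far (Susp C) (snd M))"
  "far (Susp CT) (M, f, N) = (fob (Susp CT) M, far (Susp C) f, fob (Susp CT) N)"
  by (auto simp: eilenberg_moore_def Let_def case_prod_beta)

lemma Arr_CTE:
  assumes "c \<in> Arr CT"
  obtains M f N where "c = (M, f, N)" "M \<in> Ob CT" "N \<in> Ob CT" "f \<in> Arr C" "Dom C f = fst M"
    "Cod C f = fst N" "f \<cdot> snd M = snd N \<cdot> far T f"
proof -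
  obtain M f N where "c = (M, f, N)"
    using prod_cases3 by blast
  then show ?thesis
    using assms that by simp
qed

lemma linear_Comp:
  assumes "f \<in> Arr C" "Dom C f = fst L" "Cod C f = fst M" "f \<cdot> snd L = snd M \<cdot> far T f"
    "g \<in> Arr C" "Dom C g = fst M" "Cod C g = fst N" "g \<cdot> snd M = snd N \<cdot> far T g"
    "L \<in> Ob CT" "M \<in> Ob CT" "N \<in> Ob CT"
  shows "(g \<cdot> f) \<cdot> snd L = snd N \<cdot> far T (g \<cdot> f)"
  using assms by (simp add: Comp_assoc_Arr T.far_Comp_Arr Comp_reduce[OF assms(8)])

lemma Ob_CT_Susp:
  assumes "M \<in> Ob CT"
  shows "(fob (Susp C) (fst M), far (Susp C) (snd M)) \<in> Ob CT"
proof -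
  have "far (Susp C) (snd M) \<cdot> far (Susp C) (far T (snd M)) = far (Susp C) (snd M) \<cdot> far (Susp C) (\<mu> (fst M))"
    "far (Susp C) (snd M) \<cdot> far (Susp C) (\<eta> (fst M)) = Idt C (fob (Susp C) (fst M))"
    using assms module_laws[OF assms] by (simp_all flip: Susp.far_Comp_Arr)
  then show ?thesis
    using assms by (simp add: Ob_CT_iff)
qed

lemma category_CT: "category CT"
proof
  fix c d L M N assume "c \<in> Hom CT L M" "d \<in> Hom CT M N"
  then obtain f g where "c = (L, f, M)" "f \<in> Arr C" "Dom C f = fst L" "Cod C f = fst M"
    "f \<cdot> snd L = snd M \<cdot> far T f" "d = (M, g, N)" "g \<in> Arr C" "Dom C g = fst M" "Cod C g = fst N"
    "g \<cdot> snd M = snd N \<cdot> far T g" "L \<in> Ob CT" "M \<in> Ob CT" "N \<in> Ob CT"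
    by (auto elim!: Arr_CTE)
  then show "d \<cdot>\<^bsub>CT\<^esub> c \<in> Hom CT L N"
    using linear_Comp[of f L M g N] by simp
qed (auto elim!: Arr_CTE simp: Comp_assoc_Arr)

text \<open>Linear arrows form subgroups of the Hom groups of \<open>C\<close> because
  \<open>T\<close> is additive. Zero module and biproducts are put on the underlying objects in
  \<open>C\<close>.\<close>

lemma additive_category_CT: "additive_category CT"
proof -
  interpret CT: category CT
    by (rule category_CT)
  show ?thesis
  proof (intro additive_category.intro additive_category_axioms.intro CT.category_axioms)
    fix M N assume MN: "M \<in> Ob CT" "N \<in> Ob CT"
    show "comm_group (hom_group CT M N)"
    proof (rule comm_groupI)
      fix c assume "c \<in> carrier (hom_group CT M N)"
      then obtain f where f: "c = (M, f, N)" "f \<in> Arr C" "Dom C f = fst M" "Cod C f = fst N"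
        "f \<cdot> snd M = snd N \<cdot> far T f"
        by (auto simp: hom_group_def elim!: Arr_CTE)
      then show "\<exists>d\<in>carrier (hom_group CT M N).
          d \<otimes>\<^bsub>hom_group CT M N\<^esub> c = \<one>\<^bsub>hom_group CT M N\<^esub>"
        using MN by (intro bexI[of _ "(M, Neg C f, N)"]) (auto simp: hom_group_def T.far_Neg)
    qed (use MN in \<open>auto simp: hom_group_def Add_assoc Add_commute Add_left_commute Comp_distrib_left
        Comp_distrib_right T.far_Add_Arr Ob_CT_iff elim!: Arr_CTE\<close>)
  next
    fix f f' g L M N
    assume "f \<in> Hom CT L M" "f' \<in> Hom CT L M" "g \<in> Hom CT M N"
    then show "g \<cdot>\<^bsub>CT\<^esub> (f \<boxplus>\<^bsub>CT\<^esub> f') = g \<cdot>\<^bsub>CT\<^esub> f \<boxplus>\<^bsub>CT\<^esub> g \<cdot>\<^bsub>CT\<^esub> f'"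
      by (auto elim!: Arr_CTE simp: Comp_distrib_left)
  next
    fix f g g' L M N
    assume "f \<in> Hom CT L M" "g \<in> Hom CT M N" "g' \<in> Hom CT M N"
    then show "(g \<boxplus>\<^bsub>CT\<^esub> g') \<cdot>\<^bsub>CT\<^esub> f = g \<cdot>\<^bsub>CT\<^esub> f \<boxplus>\<^bsub>CT\<^esub> g' \<cdot>\<^bsub>CT\<^esub> f"
      by (auto elim!: Arr_CTE simp: Comp_distrib_right)
  next
    obtain N where N: "zero_object C N"
      using ex_zero_object by blast
    define Z where "Z = (N, Zer C (fob T N) N)"
    have Z: "Z \<in> Ob CT" "fst Z = N" "N \<in> Ob C" "Idt C N = Zer C N N"
      using N by (auto simp: Z_def Ob_CT_iff zero_object_iff)
    have to_Z: "f = Zer C (Dom C f) N" if "f \<in> Arr C" "Cod C f = N" for f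
      using that Z Comp_Idt(1)[of f N] by simp
    have from_Z: "f = Zer C N (Cod C f)" if "f \<in> Arr C" "Dom C f = N" for f
      using that Z Comp_Idt(2)[of f N] by simp
    have "zero_object CT Z"
      unfolding zero_object_def
    proof (intro conjI ballI)
      fix M assume M: "M \<in> Ob CT"
      show "\<exists>!f. f \<in> Hom CT M Z"
      proof (rule ex1I[of _ "(M, Zer C (fst M) N, Z)"])
        fix c assume "c \<in> Hom CT M Z"
        then show "c = (M, Zer C (fst M) N, Z)"
          using to_Z Z(2) by (auto elim!: Arr_CTE)
      qed (use M Z in simp)
      show "\<exists>!f. f \<in> Hom CT Z M"
      proof (rule ex1I[of _ "(Z, Zer C N (fst M), M)"])
        fix c assume "c \<in> Hom CT Z M"
        then show "c = (Z, Zer C N (fst M), M)"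
          using from_Z Z(2) by (auto elim!: Arr_CTE)
      qed (use M Z in simp)
    qed (fact Z(1))
    then show "\<exists>N. zero_object CT N" ..
  next
    fix M N assume MN: "M \<in> Ob CT" "N \<in> Ob CT"
    obtain B i j p q where B: "B \<in> Ob C" "i \<in> Hom C (fst M) B" "j \<in> Hom C (fst N) B"
        "p \<in> Hom C B (fst M)" "q \<in> Hom C B (fst N)"
      and eqs: "p \<cdot> i = Idt C (fst M)" "q \<cdot> j = Idt C (fst N)"
        "p \<cdot> j = Zer C (fst N) (fst M)" "q \<cdot> i = Zer C (fst M) (fst N)"
        "(i \<cdot> p) \<boxplus> (j \<cdot> q) = Idt C B"
      using ex_biproduct[of "fst M" "fst N"] MN by auto
    have arr: "i \<in> Arr C" "j \<in> Arr C" "p \<in> Arr C" "q \<in> Arr C" "Dom C i = fst M" "Cod C i = B"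
      "Dom C j = fst N" "Cod C j = B" "Dom C p = B" "Cod C p = fst M" "Dom C q = B" "Cod C q = fst N"
      using B by auto
    note red = Comp_reduce[OF eqs(1)] Comp_reduce[OF eqs(2)] Comp_reduce[OF eqs(3)] Comp_reduce[OF eqs(4)]
    have Teqs: "far T p \<cdot> far T i = Idt C (fob T (fst M))" "far T q \<cdot> far T j = Idt C (fob T (fst N))"
      "far T p \<cdot> far T j = Zer C (fob T (fst N)) (fob T (fst M))"
      "far T q \<cdot> far T i = Zer C (fob T (fst M)) (fob T (fst N))"
      using arr MN eqs by (simp_all flip: T.far_Comp_Arr)
    note Tred = Comp_reduce[OF Teqs(1)] Comp_reduce[OF Teqs(2)] Comp_reduce[OF Teqs(3)] Comp_reduce[OF Teqs(4)]
    \<comment> \<open>The componentwise action, through \<open>M\<close> on the first summand and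
      through \<open>N\<close> on the second; it makes all four structure arrows linear.\<close>
    define h where "h = i \<cdot> (snd M \<cdot> far T p) \<boxplus> j \<cdot> (snd N \<cdot> far T q)"
    have h: "h \<in> Arr C" "Dom C h = fob T B" "Cod C h = B"
      using arr MN by (auto simp: h_def)
    have ph: "p \<cdot> h = snd M \<cdot> far T p" and qh: "q \<cdot> h = snd N \<cdot> far T q"
      using arr MN by (simp_all add: h_def Comp_distrib_left red)
    have hi: "h \<cdot> far T i = i \<cdot> snd M" and hj: "h \<cdot> far T j = j \<cdot> snd N"
      using arr MN by (simp_all add: h_def Comp_distrib_right Comp_assoc_Arr Teqs)
    have "h \<cdot> far T h = i \<cdot> (snd M \<cdot> (far T (snd M) \<cdot> far T (far T p)))
        \<boxplus> j \<cdot> (snd N \<cdot> (far T (snd N) \<cdot> far T (far T q)))"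
    proof -
      have "far T h = far T i \<cdot> (far T (snd M) \<cdot> far T (far T p)) \<boxplus> far T j \<cdot> (far T (snd N) \<cdot> far T (far T q))"
        using arr MN by (simp add: h_def T.far_Add_Arr T.far_Comp_Arr)
      then show ?thesis
        using arr MN h by (simp add: Comp_distrib_left Comp_reduce[OF hi] Comp_reduce[OF hj] Comp_assoc_Arr)
    qed
    also have "\<dots> = i \<cdot> (snd M \<cdot> (far T p \<cdot> \<mu> B)) \<boxplus> j \<cdot> (snd N \<cdot> (far T q \<cdot> \<mu> B))"
      using arr MN B(1) mult_natural[of p] mult_natural[of q]
      by (simp add: Comp_reduce[OF module_laws(1)] Comp_assoc_Arr)
    also have "\<dots> = h \<cdot> \<mu> B"
      using arr MN B(1) by (simp add: h_def Comp_distrib_right Comp_assoc_Arr)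
    finally have h_assoc: "h \<cdot> far T h = h \<cdot> \<mu> B" .
    have "h \<cdot> \<eta> B = i \<cdot> (snd M \<cdot> (\<eta> (fst M) \<cdot> p)) \<boxplus> j \<cdot> (snd N \<cdot> (\<eta> (fst N) \<cdot> q))"
      using arr MN B(1) unit_natural[of p] unit_natural[of q]
      by (simp add: h_def Comp_distrib_right Comp_assoc_Arr)
    also have "\<dots> = Idt C B"
      using arr MN by (simp add: Comp_reduce[OF module_laws(2)] eqs)
    finally have h_unit: "h \<cdot> \<eta> B = Idt C B" .
    have Bh: "(B, h) \<in> Ob CT"
      using B(1) h h_assoc h_unit by (simp add: Ob_CT_iff)
    show "\<exists>B \<in> Ob CT. \<exists>i \<in> Hom CT M B. \<exists>j \<in> Hom CT N B. \<exists>p \<in> Hom CT B M. \<exists>q \<in> Hom CT B N.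
        p \<cdot>\<^bsub>CT\<^esub> i = Idt CT M \<and> q \<cdot>\<^bsub>CT\<^esub> j = Idt CT N \<and> p \<cdot>\<^bsub>CT\<^esub> j = Zer CT N M \<and> q \<cdot>\<^bsub>CT\<^esub> i = Zer CT M N \<and>
        (i \<cdot>\<^bsub>CT\<^esub> p) \<boxplus>\<^bsub>CT\<^esub> (j \<cdot>\<^bsub>CT\<^esub> q) = Idt CT B"
      using arr Bh MN eqs ph qh hi hj
      by (intro bexI[of _ "(B, h)"] bexI[of _ "(M, i, (B, h))"] bexI[of _ "(N, j, (B, h))"]
          bexI[of _ "((B, h), p, M)"] bexI[of _ "((B, h), q, N)"] conjI) simp_all
  qed
qed

text \<open>The inverse \<open>S\<close> of suspension lifts to modules once it is known to commute
  with \<open>T\<close>, \<open>\<mu>\<close> and \<open>\<eta>\<close>; each of these follows from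
  the same fact about suspension by cancelling it.\<close>

lemma suspended_category_CT: "suspended_category CT"
proof -
  interpret CT: additive_category CT
    by (rule additive_category_CT)
  interpret SCT: cat_functor CT CT "Susp CT"
  proof
    fix c M N assume "c \<in> Hom CT M N"
    then obtain f where f: "c = (M, f, N)" "M \<in> Ob CT" "N \<in> Ob CT" "f \<in> Arr C" "Dom C f = fst M"
      "Cod C f = fst N" "f \<cdot> snd M = snd N \<cdot> far T f"
      by (auto elim!: Arr_CTE)
    have "far (Susp C) f \<cdot> far (Susp C) (snd M) = far (Susp C) (snd N) \<cdot> far T (far (Susp C) f)"
      using f by (simp flip: Susp.far_Comp_Arr)
    then show "far (Susp CT) c \<in> Hom CT (fob (Susp CT) M) (fob (Susp CT) N)"
      using f by (simp add: Ob_CT_Susp)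
  qed (auto simp: Ob_CT_Susp Susp.far_Comp_Arr elim!: Arr_CTE)
  obtain S where S: "cat_functor C C S"
    "\<And>X. X \<in> Ob C \<Longrightarrow> fob S (fob (Susp C) X) = X" "\<And>X. X \<in> Ob C \<Longrightarrow> fob (Susp C) (fob S X) = X"
    "\<And>f. f \<in> Arr C \<Longrightarrow> far S (far (Susp C) f) = f" "\<And>f. f \<in> Arr C \<Longrightarrow> far (Susp C) (far S f) = f"
    using Susp_inverse by metis
  interpret S: cat_functor C C S by fact
  have TS_Ob: "fob T (fob S X) = fob S (fob T X)" if "X \<in> Ob C" for X
    using that T.Susp_commute(1)[of "fob S X"] by (metis S(2,3) S.fob_Ob T.fob_Ob)
  have TS_Arr: "far T (far S f) = far S (far T f)" if "f \<in> Arr C" for f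
    using that T.Susp_commute(2)[of "far S f"] by (metis S(4,5) S.far_Arr(1) T.far_Arr(1))
  have nat_S: "\<mu> (fob S X) = far S (\<mu> X)" "\<eta> (fob S X) = far S (\<eta> X)" if "X \<in> Ob C" for X
    using that nat_Susp[of "fob S X"] S(3)[of X] S(4)[of "\<mu> (fob S X)"] S(4)[of "\<eta> (fob S X)"] by simp_all
  define S' where "S' = \<lparr>fob = (\<lambda>M. (fob S (fst M), far S (snd M))),
    far = (\<lambda>(M, f, N). ((fob S (fst M), far S (snd M)), far S f, (fob S (fst N), far S (snd N))))\<rparr>"
  have S'_simps [simp]: "fob S' M = (fob S (fst M), far S (snd M))"
    "far S' (M, f, N) = ((fob S (fst M), far S (snd M)), far S f, (fob S (fst N), far S (snd N)))" for M f N
    by (simp_all add: S'_def)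
  have Ob_S': "(fob S (fst M), far S (snd M)) \<in> Ob CT" if "M \<in> Ob CT" for M
    using that module_laws[OF that]
    by (simp add: Ob_CT_iff TS_Ob TS_Arr nat_S flip: S.far_Comp_Arr)
  have "cat_functor CT CT S'"
  proof
    fix c M N assume "c \<in> Hom CT M N"
    then obtain f where f: "c = (M, f, N)" "M \<in> Ob CT" "N \<in> Ob CT" "f \<in> Arr C" "Dom C f = fst M"
      "Cod C f = fst N" "f \<cdot> snd M = snd N \<cdot> far T f"
      by (auto elim!: Arr_CTE)
    have "far S f \<cdot> far S (snd M) = far S (snd N) \<cdot> far T (far S f)"
      using f by (simp add: TS_Arr flip: S.far_Comp_Arr)
    then show "far S' c \<in> Hom CT (fob S' M) (fob S' N)"
      using f by (simp add: Ob_S')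
  qed (auto simp: Ob_S' S.far_Comp_Arr elim!: Arr_CTE)
  moreover have "functor_eq CT (S' \<circ>\<^sub>F Susp CT) id_functor" "functor_eq CT (Susp CT \<circ>\<^sub>F S') id_functor"
    by (auto simp: functor_eq_def S Ob_CT_iff elim!: Arr_CTE)
  ultimately show ?thesis
    by unfold_locales blast
qed

end

sublocale stable_monad \<subseteq> CT: suspended_category CT
  by (rule suspended_category_CT)

context stable_monad
begin

abbreviation U :: "('o \<times> 'm, ('o, 'm) module_arrow, 'o, 'm) functor_data" where "U \<equiv> EM_forgetful"

lemma U_simps [simp]: "fob U M = fst M" "far U (M, f, N) = f"
  by (auto simp: EM_forgetful_def case_prod_beta)

abbreviation V where "V \<equiv> EM_free C T \<mu>"

lemma V_simps [simp]:
  "fob V X = (fob T X, \<mu> X)"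
  "far V f = ((fob T (Dom C f), \<mu> (Dom C f)), far T f, (fob T (Cod C f), \<mu> (Cod C f)))"
  by (auto simp: EM_free_def Let_def)

lemma free_module [simp]: "X \<in> Ob C \<Longrightarrow> (fob T X, \<mu> X) \<in> Ob CT"
  by (simp add: Ob_CT_iff mult_assoc mult_unit_left)

end

sublocale stable_monad \<subseteq> U: stable_additive_functor CT C U
proof unfold_locales
  show "functor_commutes_Susp CT C U"
    by (auto simp: functor_commutes_Susp_def functor_eq_def elim!: Arr_CTE)
qed (auto elim!: Arr_CTE)

sublocale stable_monad \<subseteq> V: cat_functor C CT V
  by unfold_locales (auto simp: mult_natural T.far_Comp_Arr)

context stable_monad
begin

lemma U_faithful:
  "far U a = far U b \<Longrightarrow> a \<in> Arr CT \<Longrightarrow> b \<in> Arr CT \<Longrightarrow> Dom CT a = Dom CT b \<Longrightarrow> Cod CT a = Cod CT b \<Longrightarrow> a = b"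
  by (auto elim!: Arr_CTE)

lemma V_Susp: "functor_commutes_Susp C CT V"
  by (auto simp: functor_commutes_Susp_def functor_eq_def)

text \<open>Counit of the adjunction between free and forgetful functor: associativity of the action
  says that it is itself linear on the free module.\<close>

definition act :: "'o \<times> 'm \<Rightarrow> ('o, 'm) module_arrow" where
  "act M = (fob V (fst M), snd M, M)"

lemma act [simp]:
  assumes "M \<in> Ob CT"
  shows "act M \<in> Arr CT" "Dom CT (act M) = fob V (fst M)" "Cod CT (act M) = M"
  using assms module_laws(1)[OF assms] by (simp_all add: act_def)

lemma act_natural: "a \<in> Arr CT \<Longrightarrow> act (Cod CT a) \<cdot>\<^bsub>CT\<^esub> far V (far U a) = a \<cdot>\<^bsub>CT\<^esub> act (Dom CT a)"
  by (auto simp: act_def elim!: Arr_CTE)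

lemma adjunction_V_U: "adjunction C CT V U \<eta> act"
proof -
  interpret idC: cat_functor C C id_functor
    by (rule cat_functor_id) unfold_locales
  interpret idCT: cat_functor CT CT id_functor
    by (rule cat_functor_id) unfold_locales
  interpret UV: cat_functor C C "U \<circ>\<^sub>F V"
    by (rule cat_functor_comp) unfold_locales
  interpret VU: cat_functor CT CT "V \<circ>\<^sub>F U"
    by (rule cat_functor_comp) unfold_locales
  show ?thesis
  proof unfold_locales
    fix a M N assume "a \<in> Hom CT M N"
    then show "act N \<cdot>\<^bsub>CT\<^esub> far (V \<circ>\<^sub>F U) a = far id_functor a \<cdot>\<^bsub>CT\<^esub> act M"
      using act_natural[of a] by auto
  qed (auto simp: unit_natural act_def mult_unit_right module_laws)
qed

end

text \<open>The last two equations express that \<open>\<sigma>\<close> is a map of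
  \<open>T\<close>-bimodules. For the monad of a ring they are those of the section of its
  multiplication determined by a separability idempotent.\<close>

locale separable_stable_monad = stable_monad C T \<mu> \<eta> + splitting: nat_trans C C T "T \<circ>\<^sub>F T" \<sigma>
  for C :: "('o, 'm, 'z) suspended_data_scheme" (structure)
    and T :: "('o, 'm, 'o, 'm) functor_data" and \<mu> \<eta> \<sigma> :: "'o \<Rightarrow> 'm" +
  assumes mult_section: "X \<in> Ob C \<Longrightarrow> \<mu> X \<cdot> \<sigma> X = Idt C (fob T X)"
    and section_left: "X \<in> Ob C \<Longrightarrow> far T (\<mu> X) \<cdot> \<sigma> (fob T X) = \<sigma> X \<cdot> \<mu> X"
    and section_right: "X \<in> Ob C \<Longrightarrow> \<mu> (fob T X) \<cdot> far T (\<sigma> X) = \<sigma> X \<cdot> \<mu> X"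
begin

lemma section_natural: "f \<in> Arr C \<Longrightarrow> \<sigma> (Cod C f) \<cdot> far T f = far T (far T f) \<cdot> \<sigma> (Dom C f)"
  using splitting.naturality_Arr[of f] by simp

text \<open>For a ring with separability idempotent \<open>\<Sum> x \<otimes> y\<close> this is the
  arrow sending \<open>m\<close> to \<open>\<Sum> x \<otimes> y m\<close>:
  \<open>\<sigma> \<cdot> \<eta>\<close> inserts the idempotent, and \<open>far T (snd M)\<close>
  lets its second leg act.\<close>

definition sec :: "'o \<times> 'm \<Rightarrow> ('o, 'm) module_arrow" where
  "sec M = (M, far T (snd M) \<cdot> (\<sigma> (fst M) \<cdot> \<eta> (fst M)), fob V (fst M))"

text \<open>Both sides equal \<open>far T (snd M) \<cdot> \<sigma> (fst M)\<close>; one uses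
  \<open>section_left\<close>, the other \<open>section_right\<close>.\<close>

lemma sec_linear:
  assumes M: "M \<in> Ob CT"
  shows "(far T (snd M) \<cdot> (\<sigma> (fst M) \<cdot> \<eta> (fst M))) \<cdot> snd M
    = \<mu> (fst M) \<cdot> far T (far T (snd M) \<cdot> (\<sigma> (fst M) \<cdot> \<eta> (fst M)))"
proof -
  define X h where "X = fst M" and "h = snd M"
  have h: "X \<in> Ob C" "h \<in> Arr C" "Dom C h = fob T X" "Cod C h = X"
    and laws: "h \<cdot> far T h = h \<cdot> \<mu> X"
    using M module_laws[OF M] by (auto simp: X_def h_def)
  have Tlaws: "far T h \<cdot> far T (far T h) = far T h \<cdot> far T (\<mu> X)"
    using h laws by (simp flip: T.far_Comp_Arr)
  have unit_h: "\<eta> X \<cdot> h = far T h \<cdot> \<eta> (fob T X)"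
    and \<sigma>_h: "\<sigma> X \<cdot> far T h = far T (far T h) \<cdot> \<sigma> (fob T X)"
    and \<mu>_h: "\<mu> X \<cdot> far T (far T h) = far T h \<cdot> \<mu> (fob T X)"
    using h unit_natural[of h] section_natural[of h] mult_natural[of h] by auto
  have "(far T h \<cdot> (\<sigma> X \<cdot> \<eta> X)) \<cdot> h = far T h \<cdot> \<sigma> X"
    using h by (simp add: Comp_assoc_Arr unit_h Comp_reduce[OF \<sigma>_h] Comp_reduce[OF Tlaws]
        Comp_reduce[OF section_left] mult_unit_left)
  moreover have "\<mu> X \<cdot> far T (far T h \<cdot> (\<sigma> X \<cdot> \<eta> X)) = far T h \<cdot> \<sigma> X"
    using h by (simp add: Comp_assoc_Arr T.far_Comp_Arr Comp_reduce[OF \<mu>_h]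
        Comp_reduce[OF section_right] mult_unit_right)
  ultimately show ?thesis
    by (simp add: X_def h_def)
qed

lemma sec [simp]:
  assumes "M \<in> Ob CT"
  shows "sec M \<in> Arr CT" "Dom CT (sec M) = M" "Cod CT (sec M) = fob V (fst M)"
  using assms sec_linear[OF assms] by (simp_all add: sec_def)

text \<open>Associativity of the action produces \<open>\<mu> \<cdot> \<sigma>\<close>, which
  cancels; the unit law of the module does the rest.\<close>

lemma act_sec: "M \<in> Ob CT \<Longrightarrow> act M \<cdot>\<^bsub>CT\<^esub> sec M = Idt CT M"
  by (simp add: act_def sec_def Comp_reduce[OF module_laws(1)] Comp_reduce[OF mult_section]
      module_laws(2) Comp_assoc_Arr)

lemma sec_natural:
  assumes "a \<in> Arr CT"
  shows "far V (far U a) \<cdot>\<^bsub>CT\<^esub> sec (Dom CT a) = sec (Cod CT a) \<cdot>\<^bsub>CT\<^esub> a"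
proof -
  obtain M f N where a: "a = (M, f, N)" and MN: "M \<in> Ob CT" "N \<in> Ob CT" and f: "f \<in> Arr C" "Dom C f = fst M"
    "Cod C f = fst N" and linear: "f \<cdot> snd M = snd N \<cdot> far T f"
    using assms by (rule Arr_CTE)
  have T_linear: "far T f \<cdot> far T (snd M) = far T (snd N) \<cdot> far T (far T f)"
    using f MN linear by (simp flip: T.far_Comp_Arr)
  have "\<eta> (fst N) \<cdot> f = far T f \<cdot> \<eta> (fst M)"
    "\<sigma> (fst N) \<cdot> far T f = far T (far T f) \<cdot> \<sigma> (fst M)"
    using f unit_natural[of f] section_natural[of f] by auto
  then show ?thesis
    using f MN by (simp add: a sec_def Comp_assoc_Arr Comp_reduce[OF T_linear] Comp_reduce[of "\<sigma> (fst N)"])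
qed

text \<open>Maschke averaging: for a ring with separability idempotent
  \<open>\<Sum> x \<otimes> y\<close> it sends \<open>g\<close> to the map taking \<open>m\<close>
  to \<open>\<Sum> x g (y m)\<close>.\<close>

definition average :: "'o \<times> 'm \<Rightarrow> 'o \<times> 'm \<Rightarrow> 'm \<Rightarrow> ('o, 'm) module_arrow" where
  "average M N g = act N \<cdot>\<^bsub>CT\<^esub> (far V g \<cdot>\<^bsub>CT\<^esub> sec M)"

lemma average [simp]:
  assumes "M \<in> Ob CT" "N \<in> Ob CT" "g \<in> Arr C" "Dom C g = fst M" "Cod C g = fst N"
  shows "average M N g \<in> Arr CT" "Dom CT (average M N g) = M" "Cod CT (average M N g) = N"
proof -
  have "far V g \<in> Arr CT" "Dom CT (far V g) = fob V (fst M)" "Cod CT (far V g) = fob V (fst N)"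
    using assms V.far_Arr[of g] by auto
  then show "average M N g \<in> Arr CT" "Dom CT (average M N g) = M" "Cod CT (average M N g) = N"
    using assms unfolding average_def by (simp_all del: V_simps)
qed

end

section \<open>Exact separable monads\<close>

locale exact_separable_monad = separable_stable_monad C T \<mu> \<eta> \<sigma> + pretriangulated C \<Delta>
  for C :: "('o, 'm, 'z) suspended_data_scheme" (structure)
    and T :: "('o, 'm, 'o, 'm) functor_data" and \<mu> \<eta> \<sigma> :: "'o \<Rightarrow> 'm" and \<Delta> +
  assumes T_dist: "(u, v, w) \<in> \<Delta> \<Longrightarrow> (far T u, far T v, far T w) \<in> \<Delta>"

sublocale exact_separable_monad \<subseteq> U: reflected_pretriangulation CT C U \<Delta>
  by unfold_locales

context exact_separable_monad
begin

abbreviation \<Delta>T where "\<Delta>T \<equiv> reflected_triangles CT U \<Delta>"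

lemma fst_V: "fst (fob V X) = fob T X"
  by simp

lemma U_V: "far U (far V f) = far T f"
  by simp

lemma V_Susp_Ob: "X \<in> Ob C \<Longrightarrow> fob V (fob (Susp C) X) = fob (Susp CT) (fob V X)"
  using V_Susp by (simp add: functor_commutes_Susp_def functor_eq_def)

text \<open>Keeps the triples encoding the arrows of \<open>CT\<close> folded, so that the simplifier works in
  the category \<open>CT\<close> itself.\<close>

declare V_simps [simp del] CT_simps(3-8) [simp del] free_module [simp del]

lemma fst_Susp: "fst (fob (Susp CT) M) = fob (Susp C) (fst M)"
  by (simp add: CT_simps)

lemmas CT_level [simp] = fst_V U_V V_Susp_Ob fst_Susp

lemma U_Arr [simp]:
  "a \<in> Arr CT \<Longrightarrow> far U a \<in> Arr C" "a \<in> Arr CT \<Longrightarrow> Dom C (far U a) = fst (Dom CT a)"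
  "a \<in> Arr CT \<Longrightarrow> Cod C (far U a) = fst (Cod CT a)"
  using U.far_Arr[of a] by auto

text \<open>Naturality of \<open>sec\<close> for the linear \<open>a\<close> leaves
  \<open>act \<cdot> sec\<close>, an identity, in front of \<open>a\<close>.\<close>

lemma average_linear:
  assumes "a \<in> Arr CT"
  shows "average (Dom CT a) (Cod CT a) (far U a) = a"
  using assms sec_natural[OF assms] CT.Comp_reduce[OF act_sec, of "Cod CT a" a]
  by (simp add: average_def)

text \<open>Naturality of \<open>act\<close>; the companion for precomposition is naturality of
  \<open>sec\<close>.\<close>

lemma average_post:
  assumes "b \<in> Arr CT" "M \<in> Ob CT" "g \<in> Arr C" "Dom C g = fst M" "Cod C g = fst (Dom CT b)"
  shows "average M (Cod CT b) (far U b \<cdot> g) = b \<cdot>\<^bsub>CT\<^esub> average M (Dom CT b) g"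
  using assms CT.Comp_reduce[OF act_natural, of b "far V g \<cdot>\<^bsub>CT\<^esub> sec M"]
  by (simp add: average_def V.far_Comp_Arr CT.Comp_assoc_Arr)

lemma average_pre:
  assumes "a \<in> Arr CT" "N \<in> Ob CT" "g \<in> Arr C" "Dom C g = fst (Cod CT a)" "Cod C g = fst N"
  shows "average (Dom CT a) N (g \<cdot> far U a) = average (Cod CT a) N g \<cdot>\<^bsub>CT\<^esub> a"
  using assms sec_natural[of a]
  by (simp add: average_def V.far_Comp_Arr CT.Comp_assoc_Arr)

text \<open>If \<open>k\<close> is a filler in \<open>C\<close>, its average \<open>h\<close> is one
  in \<open>CT\<close>: \<open>h\<close> after \<open>v\<close> is the average of
  \<open>k \<cdot> far U v\<close>, which underlies the linear arrow \<open>v'\<close> after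
  \<open>g\<close> and so averages to it. The other square is dual.\<close>

lemma fill_reflected:
  assumes dist: "(u, v, w) \<in> \<Delta>T" "(u', v', w') \<in> \<Delta>T"
    and fg: "f \<in> Arr CT" "g \<in> Arr CT"
      "Dom CT f = Dom CT u" "Cod CT f = Dom CT u'" "Dom CT g = Cod CT u" "Cod CT g = Cod CT u'"
      "g \<cdot>\<^bsub>CT\<^esub> u = u' \<cdot>\<^bsub>CT\<^esub> f"
  shows "\<exists>h. triangle_map CT (u, v, w) (u', v', w') f g h"
proof -
  have t: "is_triangle CT u v w" "is_triangle CT u' v' w'"
    and distC: "(far U u, far U v, far U w) \<in> \<Delta>" "(far U u', far U v', far U w') \<in> \<Delta>"
    using dist by (auto simp: U.reflected_iff)
  have arr: "u \<in> Arr CT" "v \<in> Arr CT" "w \<in> Arr CT" "Dom CT v = Cod CT u" "Dom CT w = Cod CT v"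
    "Cod CT w = fob (Susp CT) (Dom CT u)"
    "u' \<in> Arr CT" "v' \<in> Arr CT" "w' \<in> Arr CT" "Dom CT v' = Cod CT u'" "Dom CT w' = Cod CT v'"
    "Cod CT w' = fob (Susp CT) (Dom CT u')"
    using t by (auto simp: is_triangle_def)
  have "far U g \<cdot> far U u = far U u' \<cdot> far U f"
    using fg arr by (simp flip: U.far_Comp_Arr)
  then obtain k where "triangle_map C (far U u, far U v, far U w) (far U u', far U v', far U w') (far U f) (far U g) k"
    using dist_map[OF distC, of "far U f" "far U g"] fg arr by auto
  then have k: "k \<in> Arr C" "Dom C k = fst (Cod CT v)" "Cod C k = fst (Cod CT v')"
    and kv: "k \<cdot> far U v = far U v' \<cdot> far U g"
    and kw: "far (Susp C) (far U f) \<cdot> far U w = far U w' \<cdot> k"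
    unfolding triangle_map_iff[OF t[THEN U.is_triangle_far]] using arr by auto
  define h where "h = average (Cod CT v) (Cod CT v') k"
  have h: "h \<in> Arr CT" "Dom CT h = Cod CT v" "Cod CT h = Cod CT v'"
    using k arr by (auto simp: h_def)
  have "h \<cdot>\<^bsub>CT\<^esub> v = v' \<cdot>\<^bsub>CT\<^esub> g"
  proof -
    have "h \<cdot>\<^bsub>CT\<^esub> v = average (Dom CT v) (Cod CT v') (k \<cdot> far U v)"
      using average_pre[of v "Cod CT v'" k] k arr by (simp add: h_def)
    also have "k \<cdot> far U v = far U (v' \<cdot>\<^bsub>CT\<^esub> g)"
      using kv fg arr by (simp add: U.far_Comp_Arr)
    finally show ?thesis
      using average_linear[of "v' \<cdot>\<^bsub>CT\<^esub> g"] fg arr by simp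
  qed
  moreover have "far (Susp CT) f \<cdot>\<^bsub>CT\<^esub> w = w' \<cdot>\<^bsub>CT\<^esub> h"
  proof -
    have "w' \<cdot>\<^bsub>CT\<^esub> h = average (Cod CT v) (Cod CT w') (far U w' \<cdot> k)"
      using average_post[of w' "Cod CT v" k] k arr by (simp add: h_def)
    also have "far U w' \<cdot> k = far U (far (Susp CT) f \<cdot>\<^bsub>CT\<^esub> w)"
      using kw fg arr by (simp add: U.far_Comp_Arr)
    finally show ?thesis
      using average_linear[of "far (Susp CT) f \<cdot>\<^bsub>CT\<^esub> w"] fg arr by simp
  qed
  ultimately show ?thesis
    using fg h by (intro exI[of _ h]) (simp add: CT.triangle_map_iff[OF t])
qed

lemma dist_free:
  assumes "(u, v, w) \<in> \<Delta>"
  shows "(far V u, far V v, far V w) \<in> \<Delta>T"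
  using dist_Arr[OF assms] T_dist[OF assms]
  by (simp add: U.reflected_iff is_triangle_def)

text \<open>The cone of \<open>u\<close> is the image of an idempotent on the free module on a cone of \<open>U u\<close>, since
  \<open>u\<close> is a retract of \<open>V (U u)\<close>.\<close>

lemma complete_reflected:
  assumes ic: "idempotent_complete CT" and u: "u \<in> Arr CT"
  shows "\<exists>v w. (u, v, w) \<in> \<Delta>T"
proof -
  define M N where "M = Dom CT u" and "N = Cod CT u"
  have MN: "M \<in> Ob CT" "N \<in> Ob CT" and uMN: "Dom CT u = M" "Cod CT u = N"
    using u by (auto simp: M_def N_def)
  obtain v0 w0 where dist0: "(far U u, v0, w0) \<in> \<Delta>"
    using dist_complete[of "far U u"] u by auto
  note arr0 = dist_Arr[OF dist0]
  define u1 v1 w1 where "u1 = far V (far U u)" and "v1 = far V v0" and "w1 = far V w0"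
  define Z where "Z = fob V (Cod C v0)"
  have dist1: "(u1, v1, w1) \<in> \<Delta>T"
    using dist_free[OF dist0] by (simp add: u1_def v1_def w1_def)
  then have t1: "is_triangle CT u1 v1 w1" and distU: "(far U u1, far U v1, far U w1) \<in> \<Delta>"
    by (auto simp: U.reflected_iff)
  have arr1: "u1 \<in> Arr CT" "Dom CT u1 = fob V (fst M)" "Cod CT u1 = fob V (fst N)"
    "v1 \<in> Arr CT" "Dom CT v1 = fob V (fst N)" "Cod CT v1 = Z"
    "w1 \<in> Arr CT" "Dom CT w1 = Z" "Cod CT w1 = fob (Susp CT) (fob V (fst M))" "Z \<in> Ob CT"
    using u arr0 by (auto simp: u1_def v1_def w1_def Z_def M_def N_def)
  have u_sec: "u1 \<cdot>\<^bsub>CT\<^esub> sec M = sec N \<cdot>\<^bsub>CT\<^esub> u" and u_act: "act N \<cdot>\<^bsub>CT\<^esub> u1 = u \<cdot>\<^bsub>CT\<^esub> act M"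
    using u sec_natural[of u] act_natural[of u] by (auto simp: u1_def M_def N_def)
  \<comment> \<open>Idempotents on the free modules that cut out \<open>M\<close> and
    \<open>N\<close>; naturality of \<open>sec\<close> and \<open>act\<close> makes them commute
    with \<open>u1\<close>.\<close>
  define p1 p2 where "p1 = sec M \<cdot>\<^bsub>CT\<^esub> act M" and "p2 = sec N \<cdot>\<^bsub>CT\<^esub> act N"
  have p_arr: "p1 \<in> Arr CT" "Dom CT p1 = fob V (fst M)" "Cod CT p1 = fob V (fst M)"
    "p2 \<in> Arr CT" "Dom CT p2 = fob V (fst N)" "Cod CT p2 = fob V (fst N)"
    using MN by (auto simp: p1_def p2_def)
  have p_sec: "p1 \<cdot>\<^bsub>CT\<^esub> sec M = sec M" "p2 \<cdot>\<^bsub>CT\<^esub> sec N = sec N"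
    and act_p: "act M \<cdot>\<^bsub>CT\<^esub> p1 = act M" "act N \<cdot>\<^bsub>CT\<^esub> p2 = act N"
    using MN CT.Comp_reduce[OF act_sec, of M "act M"] CT.Comp_reduce[OF act_sec, of N "act N"]
    by (simp_all add: p1_def p2_def CT.Comp_assoc_Arr act_sec)
  have pp: "p1 \<cdot>\<^bsub>CT\<^esub> p1 = p1" "p2 \<cdot>\<^bsub>CT\<^esub> p2 = p2"
    using MN p_arr by (simp_all add: p1_def p2_def CT.Comp_reduce[OF p_sec(1)[unfolded p1_def]]
      CT.Comp_reduce[OF p_sec(2)[unfolded p2_def]] flip: CT.Comp_assoc_Arr)
       (simp_all add: p_sec flip: p1_def p2_def)
  have "p2 \<cdot>\<^bsub>CT\<^esub> u1 = u1 \<cdot>\<^bsub>CT\<^esub> p1"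
    using MN arr1 u uMN CT.Comp_reduce[OF u_sec, of "act M"]
    by (simp add: p1_def p2_def CT.Comp_assoc_Arr u_act)
  then obtain q where "triangle_map CT (u1, v1, w1) (u1, v1, w1) p1 p2 q"
    using fill_reflected[OF dist1 dist1, of p1 p2] p_arr arr1 by auto
  then have q: "q \<in> Arr CT" "Dom CT q = Z" "Cod CT q = Z"
    and qv: "q \<cdot>\<^bsub>CT\<^esub> v1 = v1 \<cdot>\<^bsub>CT\<^esub> p2" and qw: "far (Susp CT) p1 \<cdot>\<^bsub>CT\<^esub> w1 = w1 \<cdot>\<^bsub>CT\<^esub> q"
    unfolding CT.triangle_map_iff[OF t1 t1] using arr1 by auto
  have qqv: "q \<cdot>\<^bsub>CT\<^esub> (q \<cdot>\<^bsub>CT\<^esub> v1) = q \<cdot>\<^bsub>CT\<^esub> v1"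
    using q arr1 p_arr by (simp add: qv CT.Comp_reduce[OF qv] CT.Comp_assoc_Arr pp)
  have wqq: "(w1 \<cdot>\<^bsub>CT\<^esub> q) \<cdot>\<^bsub>CT\<^esub> q = w1 \<cdot>\<^bsub>CT\<^esub> q"
  proof -
    have Spp: "far (Susp CT) p1 \<cdot>\<^bsub>CT\<^esub> far (Susp CT) p1 = far (Susp CT) p1"
      using p_arr pp by (simp flip: CT.Susp.far_Comp_Arr)
    have "(w1 \<cdot>\<^bsub>CT\<^esub> q) \<cdot>\<^bsub>CT\<^esub> q = far (Susp CT) p1 \<cdot>\<^bsub>CT\<^esub> (w1 \<cdot>\<^bsub>CT\<^esub> q)"
      using q arr1 p_arr by (simp add: CT.Comp_assoc_Arr flip: qw)
    also have "\<dots> = w1 \<cdot>\<^bsub>CT\<^esub> q"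
      using q arr1 p_arr by (simp add: CT.Comp_reduce[OF Spp] flip: qw)
    finally show ?thesis .
  qed
  define n where "n = q \<cdot>\<^bsub>CT\<^esub> q \<boxplus>\<^bsub>CT\<^esub> Neg CT q"
  have n: "n \<in> Arr CT" "Dom CT n = Z" "Cod CT n = Z"
    using q by (auto simp: n_def)
  have nv: "n \<cdot>\<^bsub>CT\<^esub> v1 = Zer CT (fob V (fst N)) Z"
    using q arr1 qqv by (simp add: n_def CT.Comp_distrib_right CT.Comp_assoc_Arr)
  have wn: "w1 \<cdot>\<^bsub>CT\<^esub> n = Zer CT Z (fob (Susp CT) (fob V (fst M)))"
    using q arr1 wqq by (simp add: n_def CT.Comp_distrib_left flip: CT.Comp_assoc_Arr)
  \<comment> \<open>As \<open>w1\<close> annihilates \<open>n\<close>, \<open>far U n\<close>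
    factors as \<open>far U v1 \<cdot> b\<close>, and \<open>n\<close> annihilates
    \<open>v1\<close>. The factor \<open>b\<close> is obtained from exactness in \<open>C\<close>
    and need not be linear, so the product is computed after the faithful \<open>U\<close>.\<close>
  have "n \<cdot>\<^bsub>CT\<^esub> n = Zer CT Z Z"
  proof (rule U_faithful)
    have "far U w1 \<cdot> far U n = Zer C (fst Z) (fob (Susp C) (fob T (fst M)))"
      using n arr1 MN by (simp add: wn flip: U.far_Comp_Arr)
    then obtain b where b: "b \<in> Arr C" "Dom C b = fst Z" "Cod C b = fob T (fst N)" "far U v1 \<cdot> b = far U n"
      using dist_exact_3[OF distU, of "far U n"] n arr1 MN by auto
    have "far U n \<cdot> far U v1 = Zer C (fob T (fst N)) (fst Z)"
      using n arr1 MN by (simp add: nv flip: U.far_Comp_Arr)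
    from Comp_reduce[OF this, of b] have "far U n \<cdot> far U n = Zer C (fst Z) (fst Z)"
      using n b arr1 MN by simp
    then show "far U (n \<cdot>\<^bsub>CT\<^esub> n) = far U (Zer CT Z Z)"
      using n arr1 by (simp add: U.far_Comp_Arr)
  qed (use n arr1 in auto)
  \<comment> \<open>The corrected idempotent still completes \<open>p1\<close> and \<open>p2\<close>
    to an endomorphism of the free triangle, since it agrees with \<open>q\<close> after
    \<open>v1\<close> and before \<open>w1\<close>.\<close>
  then obtain p where p: "p \<in> Arr CT" "Dom CT p = Z" "Cod CT p = Z" "p \<cdot>\<^bsub>CT\<^esub> p = p"
    and "p \<cdot>\<^bsub>CT\<^esub> v1 = q \<cdot>\<^bsub>CT\<^esub> v1" "w1 \<cdot>\<^bsub>CT\<^esub> p = w1 \<cdot>\<^bsub>CT\<^esub> q"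
    using CT.idempotent_lift[OF q] arr1 qqv wqq unfolding n_def by metis
  then have pv: "p \<cdot>\<^bsub>CT\<^esub> v1 = v1 \<cdot>\<^bsub>CT\<^esub> p2" and pw: "w1 \<cdot>\<^bsub>CT\<^esub> p = far (Susp CT) p1 \<cdot>\<^bsub>CT\<^esub> w1"
    using qv qw by simp_all
  obtain Z' r s where rs: "Z' \<in> Ob CT" "r \<in> Hom CT Z Z'" "s \<in> Hom CT Z' Z" "s \<cdot>\<^bsub>CT\<^esub> r = p" "r \<cdot>\<^bsub>CT\<^esub> s = Idt CT Z'"
    using ic p arr1 unfolding idempotent_complete_def by (metis in_Hom)
  then have rs_arr: "r \<in> Arr CT" "Dom CT r = Z" "Cod CT r = Z'" "s \<in> Arr CT" "Dom CT s = Z'" "Cod CT s = Z"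
    by auto
  \<comment> \<open>The arrows of the free triangle, restricted by the sections and the inclusion
    \<open>s\<close> and projected by the actions and \<open>r\<close>; this makes
    \<open>(u, v, w)\<close> the summand of the free triangle cut out by \<open>p1\<close>,
    \<open>p2\<close>, \<open>p\<close>.\<close>
  define v w where "v = r \<cdot>\<^bsub>CT\<^esub> (v1 \<cdot>\<^bsub>CT\<^esub> sec N)" and "w = far (Susp CT) (act M) \<cdot>\<^bsub>CT\<^esub> (w1 \<cdot>\<^bsub>CT\<^esub> s)"
  have vw: "v \<in> Arr CT" "Dom CT v = N" "Cod CT v = Z'" "w \<in> Arr CT" "Dom CT w = Z'" "Cod CT w = fob (Susp CT) M"
    using rs_arr arr1 MN by (auto simp: v_def w_def)
  have t: "is_triangle CT u v w"
    using u vw uMN by (auto simp: is_triangle_def)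
  have ps: "p \<cdot>\<^bsub>CT\<^esub> s = s" and rp: "r \<cdot>\<^bsub>CT\<^esub> p = r"
    using rs rs_arr CT.Comp_reduce[OF rs(5), of r] by (auto simp: CT.Comp_assoc_Arr simp flip: rs(4))
  have sv: "s \<cdot>\<^bsub>CT\<^esub> v = v1 \<cdot>\<^bsub>CT\<^esub> sec N"
    using rs_arr arr1 MN p p_arr
    by (simp add: v_def CT.Comp_reduce[OF rs(4)] CT.Comp_reduce[OF pv] CT.Comp_assoc_Arr p_sec)
  have Sw: "far (Susp CT) (sec M) \<cdot>\<^bsub>CT\<^esub> w = w1 \<cdot>\<^bsub>CT\<^esub> s"
  proof -
    have "far (Susp CT) (sec M) \<cdot>\<^bsub>CT\<^esub> far (Susp CT) (act M) = far (Susp CT) p1"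
      using MN by (simp add: p1_def CT.Susp.far_Comp_Arr)
    then show ?thesis
      using rs_arr arr1 MN p p_arr
      by (simp add: w_def CT.Comp_reduce[of "far (Susp CT) (sec M)"] CT.Comp_reduce[OF pw[symmetric]]
          CT.Comp_assoc_Arr ps)
  qed
  have rv: "r \<cdot>\<^bsub>CT\<^esub> v1 = v \<cdot>\<^bsub>CT\<^esub> act N"
  proof -
    have "v \<cdot>\<^bsub>CT\<^esub> act N = r \<cdot>\<^bsub>CT\<^esub> (p \<cdot>\<^bsub>CT\<^esub> v1)"
      using rs_arr arr1 MN by (simp add: v_def p2_def pv CT.Comp_assoc_Arr)
    then show ?thesis
      using rs_arr arr1 p by (simp add: CT.Comp_reduce[OF rp])
  qed
  have Saw: "far (Susp CT) (act M) \<cdot>\<^bsub>CT\<^esub> w1 = w \<cdot>\<^bsub>CT\<^esub> r"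
  proof -
    have Sap: "far (Susp CT) (act M) \<cdot>\<^bsub>CT\<^esub> far (Susp CT) p1 = far (Susp CT) (act M)"
      using MN p_arr act_p by (simp flip: CT.Susp.far_Comp_Arr)
    have "w \<cdot>\<^bsub>CT\<^esub> r = far (Susp CT) (act M) \<cdot>\<^bsub>CT\<^esub> (w1 \<cdot>\<^bsub>CT\<^esub> p)"
      using rs_arr arr1 MN by (simp add: w_def CT.Comp_assoc_Arr rs(4))
    then show ?thesis
      using arr1 MN p_arr by (simp add: pw CT.Comp_reduce[OF Sap])
  qed
  have "triangle_map CT (u, v, w) (u1, v1, w1) (sec M) (sec N) s"
    unfolding CT.triangle_map_iff[OF t t1]
    using u MN vw rs_arr arr1 sv Sw u_sec by (simp add: uMN)
  moreover have "triangle_map CT (u1, v1, w1) (u, v, w) (act M) (act N) r"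
    unfolding CT.triangle_map_iff[OF t1 t]
    using u MN vw rs_arr arr1 rv Saw u_act by (simp add: uMN)
  moreover have "far U (act M) \<cdot> far U (sec M) = Idt C (fst M)" "far U (act N) \<cdot> far U (sec N) = Idt C (fst N)"
    "far U r \<cdot> far U s = Idt C (fst Z')"
    using MN rs_arr rs by (simp_all add: act_sec flip: U.far_Comp_Arr)
  ultimately have "(far U u, far U v, far U w) \<in> \<Delta>"
    using dist_retract[OF distU U.is_triangle_far[OF t] U.triangle_map_far[OF t t1] U.triangle_map_far[OF t1 t]]
      u vw uMN by simp
  then show ?thesis
    using t U.reflected_iff by blast
qed

theorem pretriangulated_CT: "idempotent_complete CT \<Longrightarrow> pretriangulated CT \<Delta>T"
  by (rule U.pretriangulatedI) (use complete_reflected fill_reflected in blast)+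

lemma exact_functor_V:
  assumes "pretriangulated CT \<Delta>T"
  shows "exact_functor C \<Delta> CT \<Delta>T V"
proof -
  interpret CT: pretriangulated CT \<Delta>T by fact
  show ?thesis
    by unfold_locales (use V_Susp dist_free in auto)
qed

end

section \<open>Semiseparable adjunctions\<close>

context semiseparable_via
begin

lemma P_Arr [simp]:
  assumes "X \<in> Ob D" "Y \<in> Ob D" "g \<in> Arr C" "Dom C g = fob G X" "Cod C g = fob G Y"
  shows "P X Y g \<in> Arr D" "Dom D (P X Y g) = X" "Cod D (P X Y g) = Y"
  using P_Hom[of X Y g] assms by auto

lemma P_pre:
  assumes "a \<in> Arr D" "Y \<in> Ob D" "g \<in> Arr C" "Dom C g = fob G (Cod D a)" "Cod C g = fob G Y"
  shows "P (Dom D a) Y (g \<cdot>\<^bsub>C\<^esub> far G a) = P (Cod D a) Y g \<cdot>\<^bsub>D\<^esub> a"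
  using P_natural[of a "Dom D a" "Cod D a" "Idt D Y" Y Y g] assms by simp

lemma P_post:
  assumes "b \<in> Arr D" "X \<in> Ob D" "g \<in> Arr C" "Dom C g = fob G X" "Cod C g = fob G (Dom D b)"
  shows "P X (Cod D b) (far G b \<cdot>\<^bsub>C\<^esub> g) = b \<cdot>\<^bsub>D\<^esub> P X (Dom D b) g"
  using P_natural[of "Idt D X" X X b "Dom D b" "Cod D b" g] assms by simp

definition idem :: "'od \<Rightarrow> 'md" where
  "idem X = P X X (Idt C (fob G X))"

lemma idem [simp]:
  "X \<in> Ob D \<Longrightarrow> idem X \<in> Arr D" "X \<in> Ob D \<Longrightarrow> Dom D (idem X) = X" "X \<in> Ob D \<Longrightarrow> Cod D (idem X) = X"
  by (simp_all add: idem_def)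

lemma P_far: "f \<in> Arr D \<Longrightarrow> P (Dom D f) (Cod D f) (far G f) = idem (Cod D f) \<cdot>\<^bsub>D\<^esub> f"
  using P_pre[of f "Cod D f" "Idt C (fob G (Cod D f))"] by (simp add: idem_def)

lemma far_idem: "X \<in> Ob D \<Longrightarrow> far G (idem X) = Idt C (fob G X)"
  using GPG[of "Idt D X" X X] by (simp add: idem_def)

lemma idem_natural: "f \<in> Arr D \<Longrightarrow> idem (Cod D f) \<cdot>\<^bsub>D\<^esub> f = f \<cdot>\<^bsub>D\<^esub> idem (Dom D f)"
  using P_post[of f "Dom D f" "Idt C (fob G (Dom D f))"] P_far[of f] by (simp add: idem_def)

text \<open>One direction applies \<open>G\<close>, which sends \<open>idem\<close> to an identity;
  the other applies \<open>P\<close>, since \<open>P (G f)\<close> is \<open>idem\<close> after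
  \<open>f\<close>.\<close>

lemma idem_Comp_eq_iff:
  assumes "f \<in> Arr D" "g \<in> Arr D" "Dom D f = Dom D g" "Cod D f = Cod D g"
  shows "idem (Cod D g) \<cdot>\<^bsub>D\<^esub> f = idem (Cod D g) \<cdot>\<^bsub>D\<^esub> g \<longleftrightarrow> far G f = far G g"
proof
  assume "idem (Cod D g) \<cdot>\<^bsub>D\<^esub> f = idem (Cod D g) \<cdot>\<^bsub>D\<^esub> g"
  then have "far G (idem (Cod D g) \<cdot>\<^bsub>D\<^esub> f) = far G (idem (Cod D g) \<cdot>\<^bsub>D\<^esub> g)"
    by simp
  then show "far G f = far G g"
    using assms by (simp add: far_Comp_Arr far_idem)
next
  assume "far G f = far G g"
  then show "idem (Cod D g) \<cdot>\<^bsub>D\<^esub> f = idem (Cod D g) \<cdot>\<^bsub>D\<^esub> g"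
    using assms P_far[of f] P_far[of g] by simp
qed

end

text \<open>\<open>G\<close> sends both idempotents to identities, so each absorbs the other;
  naturality makes them commute. This reconciles the \<open>P\<close> that defines \<open>e\<close>
  with a possibly different one that commutes with suspension.\<close>

lemma associated_idempotent_unique:
  assumes "semiseparable_via D C G P" "semiseparable_via D C G P'" "X \<in> Ob D"
  shows "P X X (Idt C (fob G X)) = P' X X (Idt C (fob G X))"
proof -
  interpret P: semiseparable_via D C G P by fact
  interpret P': semiseparable_via D C G P' by fact
  have "P.idem X \<cdot>\<^bsub>D\<^esub> P'.idem X = P.idem X" "P'.idem X \<cdot>\<^bsub>D\<^esub> P.idem X = P'.idem X"
    using P.idem_Comp_eq_iff[of "P'.idem X" "Idt D X"] P'.idem_Comp_eq_iff[of "P.idem X" "Idt D X"] assms(3)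
    by (simp_all add: P.far_idem P'.far_idem)
  then show ?thesis
    using P.idem_natural[of "P'.idem X"] assms(3) by (simp flip: P.idem_def P'.idem_def)
qed

locale semiseparable_adjunction = suspended_adjunction C D F G \<eta> \<epsilon> + G: semiseparable_via D C G P
  for C :: "('oc, 'mc, 'zc) suspended_data_scheme" and D :: "('od, 'md, 'zd) suspended_data_scheme"
    and F :: "('oc, 'mc, 'od, 'md) functor_data" and G :: "('od, 'md, 'oc, 'mc) functor_data"
    and \<eta> :: "'oc \<Rightarrow> 'mc" and \<epsilon> :: "'od \<Rightarrow> 'md" and P :: "'od \<Rightarrow> 'od \<Rightarrow> 'mc \<Rightarrow> 'md"

sublocale suspended_adjunction \<subseteq> additive_adjunction C D F G \<eta> \<epsilon>
  by unfold_locales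

sublocale suspended_adjunction \<subseteq> F: stable_additive_functor C D F
proof -
  interpret F: additive_functor C D F
    by (rule additive_functor_F)
  show "stable_additive_functor C D F"
    by unfold_locales (rule F_Susp)
qed

sublocale suspended_adjunction \<subseteq> G: stable_additive_functor D C G
proof -
  interpret G: additive_functor D C G
    by (rule additive_functor_G)
  show "stable_additive_functor D C G"
    by unfold_locales (rule G_Susp)
qed

context suspended_adjunction
begin

abbreviation T where "T \<equiv> G \<circ>\<^sub>F F"
abbreviation \<mu> where "\<mu> \<equiv> \<lambda>X. far G (\<epsilon> (fob F X))"

lemma counit_natural: "b \<in> Arr D \<Longrightarrow> \<epsilon> (Cod D b) \<cdot>\<^bsub>D\<^esub> far F (far G b) = b \<cdot>\<^bsub>D\<^esub> \<epsilon> (Dom D b)"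
  using counit.naturality_Arr[of b] by simp

lemma G_counit_natural:
  assumes "b \<in> Arr D"
  shows "far G (\<epsilon> (Cod D b)) \<cdot>\<^bsub>C\<^esub> far G (far F (far G b)) = far G b \<cdot>\<^bsub>C\<^esub> far G (\<epsilon> (Dom D b))"
  using assms counit_natural[OF assms] by (simp flip: G.far_Comp_Arr)

lemma counit_Susp_eq: "Y \<in> Ob D \<Longrightarrow> \<epsilon> (fob (Susp D) Y) = far (Susp D) (\<epsilon> Y)"
  using counit_Susp by (simp add: nat_trans_commutes_Susp_def)

lemma stable_monad_GF: "stable_monad C T \<mu> \<eta>"
proof -
  interpret T: cat_functor C C T
    by (rule cat_functor_comp) unfold_locales
  interpret TT: cat_functor C C "T \<circ>\<^sub>F T"
    by (rule cat_functor_comp) unfold_locales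
  show ?thesis
  proof unfold_locales
    fix X assume X: "X \<in> Ob C"
    then show "far G (\<epsilon> (fob F X)) \<cdot>\<^bsub>C\<^esub> far T (far G (\<epsilon> (fob F X)))
        = far G (\<epsilon> (fob F X)) \<cdot>\<^bsub>C\<^esub> far G (\<epsilon> (fob F (fob T X)))"
      using G_counit_natural[of "\<epsilon> (fob F X)"] by simp
    show "far G (\<epsilon> (fob F X)) \<cdot>\<^bsub>C\<^esub> \<eta> (fob T X) = Idt C (fob T X)"
      using X triangle_G[of "fob F X"] by simp
    show "far G (\<epsilon> (fob F X)) \<cdot>\<^bsub>C\<^esub> far T (\<eta> X) = Idt C (fob T X)"
      using X triangle_F[of X] by (simp flip: G.far_Comp_Arr)
  next
    fix f X Y assume "f \<in> Hom C X Y"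
    then show "far G (\<epsilon> (fob F Y)) \<cdot>\<^bsub>C\<^esub> far (T \<circ>\<^sub>F T) f = far T f \<cdot>\<^bsub>C\<^esub> far G (\<epsilon> (fob F X))"
      using G_counit_natural[of "far F f"] by auto
  next
    show "functor_commutes_Susp C C T"
      by (auto simp: functor_commutes_Susp_def functor_eq_def)
    show "nat_trans_commutes_Susp C C \<mu>"
      by (auto simp: nat_trans_commutes_Susp_def counit_Susp_eq)
  qed (auto simp: G.far_Add_Arr F.far_Add_Arr unit_Susp)
qed

end

sublocale suspended_adjunction \<subseteq> monad: stable_monad C T \<mu> \<eta>
  by (rule stable_monad_GF)

context suspended_adjunction
begin

abbreviation CT where "CT \<equiv> monad.CT"
abbreviation K where "K \<equiv> EM_comparison D G \<epsilon>"

lemma K_simps [simp]: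
  "fob K Y = (fob G Y, far G (\<epsilon> Y))"
  "far K f = (fob K (Dom D f), far G f, fob K (Cod D f))"
  by (auto simp: EM_comparison_def Let_def)

lemma K_Ob: "Y \<in> Ob D \<Longrightarrow> (fob G Y, far G (\<epsilon> Y)) \<in> Ob CT"
  using G_counit_natural[of "\<epsilon> Y"] by (simp add: monad.Ob_CT_iff triangle_G)

lemma functor_K: "cat_functor D CT K"
  by unfold_locales (auto simp: K_Ob G_counit_natural G.far_Comp_Arr)

lemma K_Susp: "functor_commutes_Susp D CT K"
  by (auto simp: functor_commutes_Susp_def functor_eq_def counit_Susp_eq)

end

sublocale suspended_adjunction \<subseteq> K: cat_functor D CT K
  by (rule functor_K)

context semiseparable_adjunction
begin

text \<open>\<open>P\<close> applies to \<open>\<eta> (fob G Y)\<close> because its target is again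
  of the form \<open>G\<close> of an object of \<open>D\<close>.\<close>

definition cosection :: "'od \<Rightarrow> 'md" where
  "cosection Y = P Y (fob F (fob G Y)) (\<eta> (fob G Y))"

lemma cosection [simp]:
  assumes "Y \<in> Ob D"
  shows "cosection Y \<in> Arr D" "Dom D (cosection Y) = Y" "Cod D (cosection Y) = fob F (fob G Y)"
  using assms by (simp_all add: cosection_def)

text \<open>Both sides are \<open>P\<close> of the two sides of the naturality square of
  \<open>\<eta>\<close> at \<open>far G b\<close>.\<close>

lemma cosection_natural:
  assumes "b \<in> Arr D"
  shows "far F (far G b) \<cdot>\<^bsub>D\<^esub> cosection (Dom D b) = cosection (Cod D b) \<cdot>\<^bsub>D\<^esub> b"
  using assms G.P_post[of "far F (far G b)" "Dom D b" "\<eta> (fob G (Dom D b))"]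
    G.P_pre[of b "fob F (fob G (Cod D b))" "\<eta> (fob G (Cod D b))"] unit.naturality_Arr[of "far G b"]
  by (simp add: cosection_def)

text \<open>Naturality of \<open>P\<close> moves \<open>\<epsilon> Y\<close> inside, where the
  triangle identity turns \<open>\<eta>\<close> into the identity.\<close>

lemma counit_cosection: "Y \<in> Ob D \<Longrightarrow> \<epsilon> Y \<cdot>\<^bsub>D\<^esub> cosection Y = G.idem Y"
  using G.P_post[of "\<epsilon> Y" Y "\<eta> (fob G Y)"] by (simp add: cosection_def triangle_G G.idem_def)

text \<open>The section property is \<open>G\<close> applied to
  \<open>\<epsilon> \<cdot> cosection = idem\<close>. The two bimodule laws are images under
  \<open>G\<close> of naturality squares: of \<open>cosection\<close> at
  \<open>\<epsilon> (fob F X)\<close>, and of \<open>\<epsilon>\<close> at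
  \<open>cosection (fob F X)\<close>.\<close>

lemma separable_stable_monad_GF:
  "separable_stable_monad C T \<mu> \<eta> (\<lambda>X. far G (cosection (fob F X)))"
proof unfold_locales
  fix X assume X: "X \<in> Ob C"
  then show "far G (\<epsilon> (fob F X)) \<cdot>\<^bsub>C\<^esub> far G (cosection (fob F X)) = Idt C (fob T X)"
    by (simp add: counit_cosection G.far_idem flip: G.far_Comp_Arr)
  show "far T (far G (\<epsilon> (fob F X))) \<cdot>\<^bsub>C\<^esub> far G (cosection (fob F (fob T X)))
      = far G (cosection (fob F X)) \<cdot>\<^bsub>C\<^esub> far G (\<epsilon> (fob F X))"
    using X cosection_natural[of "\<epsilon> (fob F X)"] by (simp flip: G.far_Comp_Arr)
  show "far G (\<epsilon> (fob F (fob T X))) \<cdot>\<^bsub>C\<^esub> far T (far G (cosection (fob F X)))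
      = far G (cosection (fob F X)) \<cdot>\<^bsub>C\<^esub> far G (\<epsilon> (fob F X))"
    using X G_counit_natural[of "cosection (fob F X)"] by simp
next
  fix f X Y assume "f \<in> Hom C X Y"
  then show "far G (cosection (fob F Y)) \<cdot>\<^bsub>C\<^esub> far T f = far (T \<circ>\<^sub>F T) f \<cdot>\<^bsub>C\<^esub> far G (cosection (fob F X))"
    using cosection_natural[of "far F f"] by (auto simp flip: G.far_Comp_Arr)
qed auto

end

sublocale semiseparable_adjunction \<subseteq>
  monad: separable_stable_monad C T \<mu> \<eta> "\<lambda>X. far G (cosection (fob F X))"
  by (rule separable_stable_monad_GF)

section \<open>Lifting linear arrows and idempotents from modules to \<open>D\<close>\<close>

context semiseparable_adjunction
begin

text \<open>Axiom \<open>GPG\<close> says that \<open>G\<close> after \<open>P\<close> fixes arrows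
  in the image of \<open>G\<close>. Linearity puts \<open>g \<cdot> far G (\<epsilon> Y)\<close>
  into that image, as \<open>G\<close> of the transpose of \<open>g\<close>; the factor
  \<open>far G (\<epsilon> Y)\<close> cancels because \<open>\<eta> (fob G Y)\<close> splits
  it.\<close>

lemma far_P_linear:
  assumes Y: "Y \<in> Ob D" "Y' \<in> Ob D" and g: "g \<in> Arr C" "Dom C g = fob G Y" "Cod C g = fob G Y'"
    and linear: "g \<cdot>\<^bsub>C\<^esub> far G (\<epsilon> Y) = far G (\<epsilon> Y') \<cdot>\<^bsub>C\<^esub> far T g"
  shows "far G (P Y Y' g) = g"
proof -
  define a where "a = \<epsilon> Y' \<cdot>\<^bsub>D\<^esub> far F g"
  have a: "a \<in> Arr D" "Dom D a = fob F (fob G Y)" "Cod D a = Y'" "far G a = g \<cdot>\<^bsub>C\<^esub> far G (\<epsilon> Y)"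
    using Y g linear by (auto simp: a_def G.far_Comp_Arr)
  have "far G (P Y Y' g) \<cdot>\<^bsub>C\<^esub> far G (\<epsilon> Y) = far G (P Y Y' g \<cdot>\<^bsub>D\<^esub> \<epsilon> Y)"
    using Y g by (simp add: G.far_Comp_Arr)
  also have "\<dots> = far G (P (fob F (fob G Y)) Y' (far G a))"
    using Y g a G.P_pre[of "\<epsilon> Y" Y' g] by simp
  also have "\<dots> = g \<cdot>\<^bsub>C\<^esub> far G (\<epsilon> Y)"
    using a G.GPG[of a] by simp
  finally have "far G (P Y Y' g) \<cdot>\<^bsub>C\<^esub> far G (\<epsilon> Y) = g \<cdot>\<^bsub>C\<^esub> far G (\<epsilon> Y)" .
  from C.Comp_reduce[OF this, of "\<eta> (fob G Y)"] show ?thesis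
    using Y g by (simp add: triangle_G C.Comp_assoc_Arr)
qed

lemma K_full:
  assumes "Y \<in> Ob D" "Y' \<in> Ob D" "c \<in> Arr CT" "Dom CT c = fob K Y" "Cod CT c = fob K Y'"
  shows "far K (P Y Y' (far monad.U c)) = c"
  using assms(3)
proof (rule monad.Arr_CTE)
  fix M g N
  assume c: "c = (M, g, N)" and g: "g \<in> Arr C" "Dom C g = fst M" "Cod C g = fst N" "g \<cdot>\<^bsub>C\<^esub> snd M = snd N \<cdot>\<^bsub>C\<^esub> far T g"
  have MN: "M = fob K Y" "N = fob K Y'"
    using assms c by auto
  then show "far K (P Y Y' (far monad.U c)) = c"
    using assms(1,2) c g far_P_linear[of Y Y' g] by simp
qed

text \<open>By naturality \<open>P g \<cdot> P g\<close> is \<open>P (g \<cdot> G (P g))\<close>,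
  and \<open>G (P g) = g\<close> for linear \<open>g\<close>.\<close>

lemma P_multiplicative:
  assumes "Y \<in> Ob D" "p \<in> Arr CT" "Dom CT p = fob K Y" "Cod CT p = fob K Y" "p \<cdot>\<^bsub>CT\<^esub> p = p"
  shows "P Y Y (far monad.U p) \<cdot>\<^bsub>D\<^esub> P Y Y (far monad.U p) = P Y Y (far monad.U p)"
proof -
  define g where "g = far monad.U p"
  have g: "g \<in> Arr C" "Dom C g = fob G Y" "Cod C g = fob G Y" "g \<cdot>\<^bsub>C\<^esub> g = g"
    using assms monad.U.far_Arr[of p] monad.U.far_Comp_Arr[of p p] by (auto simp: g_def)
  have "far G (P Y Y g) = g"
    using arg_cong[OF K_full[OF assms(1,1-4)], of "far monad.U"] by (simp add: g_def)
  then show ?thesis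
    using assms(1) g G.P_pre[of "P Y Y g" Y g] by (simp flip: g_def)
qed

lemma split_idempotent_K:
  assumes ic: "idempotent_complete D" and Y: "Y \<in> Ob D"
    and p: "p \<in> Arr CT" "Dom CT p = fob K Y" "Cod CT p = fob K Y" "p \<cdot>\<^bsub>CT\<^esub> p = p"
  obtains Z r s where "Z \<in> Ob D" "r \<in> Hom CT (fob K Y) (fob K Z)" "s \<in> Hom CT (fob K Z) (fob K Y)"
    "s \<cdot>\<^bsub>CT\<^esub> r = p" "r \<cdot>\<^bsub>CT\<^esub> s = Idt CT (fob K Z)"
proof -
  define f where "f = P Y Y (far monad.U p)"
  have f: "f \<in> Hom D Y Y" "f \<cdot>\<^bsub>D\<^esub> f = f"
    using Y p monad.U.far_Arr[of p] P_multiplicative[OF Y p] by (auto simp: f_def)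
  then obtain Z r s where Z: "Z \<in> Ob D" "r \<in> Hom D Y Z" "s \<in> Hom D Z Y" "s \<cdot>\<^bsub>D\<^esub> r = f" "r \<cdot>\<^bsub>D\<^esub> s = Idt D Z"
    using ic Y unfolding idempotent_complete_def by metis
  show ?thesis
  proof (rule that[of Z "far K r" "far K s"])
    show "far K s \<cdot>\<^bsub>CT\<^esub> far K r = p"
      using Z K_full[OF Y Y p(1-3)] K.far_Comp_Arr[of r s] by (simp add: f_def)
    show "far K r \<cdot>\<^bsub>CT\<^esub> far K s = Idt CT (fob K Z)"
      using Z K.far_Comp_Arr[of s r] by simp
  qed (use Z K.far_Arr[of r] K.far_Arr[of s] in auto)
qed

text \<open>Every module is a retract of a free module, which lies in the image of \<open>K\<close>.\<close>

lemma split_idempotent_CT: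
  assumes ic: "idempotent_complete D" and M: "M \<in> Ob CT"
    and p: "p \<in> Hom CT M M" "p \<cdot>\<^bsub>CT\<^esub> p = p"
  obtains Z r s where "Z \<in> Ob D" "r \<in> Hom CT M (fob K Z)" "s \<in> Hom CT (fob K Z) M"
    "s \<cdot>\<^bsub>CT\<^esub> r = p" "r \<cdot>\<^bsub>CT\<^esub> s = Idt CT (fob K Z)"
proof -
  let ?i = "monad.sec M" and ?a = "monad.act M"
  define Y where "Y = fob F (fst M)"
  have Y: "Y \<in> Ob D" "fob monad.V (fst M) = fob K Y"
    using M by (auto simp: Y_def)
  have ia: "?i \<in> Arr CT" "Dom CT ?i = M" "Cod CT ?i = fob K Y"
    "?a \<in> Arr CT" "Dom CT ?a = fob K Y" "Cod CT ?a = M"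
    using M Y(2) monad.sec[OF M] monad.act[OF M] by (simp_all only:)
  have ai: "?a \<cdot>\<^bsub>CT\<^esub> ?i = Idt CT M"
    by (rule monad.act_sec[OF M])
  have p': "p \<in> Arr CT" "Dom CT p = M" "Cod CT p = M"
    using p by auto
  note simps = monad.CT.Comp_assoc_Arr monad.CT.Comp_reduce[OF ai] monad.CT.Comp_reduce[OF p(2)] ai p(2)
  note [simp del] = monad.CT_simps K_simps
  \<comment> \<open>\<open>p\<close> transported to the free module that contains \<open>M\<close>
    as a retract; \<open>p1\<close> and \<open>p\<close> have the same image up to
    isomorphism.\<close>
  define p1 where "p1 = ?i \<cdot>\<^bsub>CT\<^esub> (p \<cdot>\<^bsub>CT\<^esub> ?a)"
  have p1: "p1 \<in> Arr CT" "Dom CT p1 = fob K Y" "Cod CT p1 = fob K Y"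
    using p' ia by (auto simp: p1_def)
  have p1p1: "p1 \<cdot>\<^bsub>CT\<^esub> p1 = p1" and p1ia: "p1 \<cdot>\<^bsub>CT\<^esub> (?i \<cdot>\<^bsub>CT\<^esub> ?a) = p1"
    and ap1i: "?a \<cdot>\<^bsub>CT\<^esub> (p1 \<cdot>\<^bsub>CT\<^esub> ?i) = p"
    using M p' ia by (simp_all add: p1_def simps)
  obtain Z r s where Z: "Z \<in> Ob D" "r \<in> Hom CT (fob K Y) (fob K Z)" "s \<in> Hom CT (fob K Z) (fob K Y)"
    and sr: "s \<cdot>\<^bsub>CT\<^esub> r = p1" and rs: "r \<cdot>\<^bsub>CT\<^esub> s = Idt CT (fob K Z)"
    by (rule split_idempotent_K[OF ic Y(1) p1 p1p1])
  have rs': "r \<in> Arr CT" "Dom CT r = fob K Y" "Cod CT r = fob K Z" "s \<in> Arr CT" "Dom CT s = fob K Z" "Cod CT s = fob K Y"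
    using Z by auto
  have rp1: "r \<cdot>\<^bsub>CT\<^esub> p1 = r"
    using rs' monad.CT.Comp_reduce[OF rs, of r] by (simp flip: sr)
  have ria: "r \<cdot>\<^bsub>CT\<^esub> (?i \<cdot>\<^bsub>CT\<^esub> ?a) = r"
    using rs' p1 ia monad.CT.Comp_reduce[OF rp1, of "?i \<cdot>\<^bsub>CT\<^esub> ?a"] by (simp add: p1ia rp1)
  show ?thesis
  proof (rule that[OF Z(1), of "r \<cdot>\<^bsub>CT\<^esub> ?i" "?a \<cdot>\<^bsub>CT\<^esub> s"])
    show "(?a \<cdot>\<^bsub>CT\<^esub> s) \<cdot>\<^bsub>CT\<^esub> (r \<cdot>\<^bsub>CT\<^esub> ?i) = p"
      using rs' ia ap1i by (simp add: monad.CT.Comp_assoc_Arr monad.CT.Comp_reduce[OF sr])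
    \<comment> \<open>The projection \<open>?i\<close> after \<open>?a\<close> may be dropped after
      \<open>r\<close>, because \<open>r\<close> absorbs \<open>p1\<close> and \<open>p1\<close>
      absorbs that projection.\<close>
    have "(r \<cdot>\<^bsub>CT\<^esub> ?i) \<cdot>\<^bsub>CT\<^esub> (?a \<cdot>\<^bsub>CT\<^esub> s) = (r \<cdot>\<^bsub>CT\<^esub> (?i \<cdot>\<^bsub>CT\<^esub> ?a)) \<cdot>\<^bsub>CT\<^esub> s"
      using rs' ia by (simp add: monad.CT.Comp_assoc_Arr)
    then show "(r \<cdot>\<^bsub>CT\<^esub> ?i) \<cdot>\<^bsub>CT\<^esub> (?a \<cdot>\<^bsub>CT\<^esub> s) = Idt CT (fob K Z)"
      by (simp add: ria rs)
  qed (use rs' ia in auto)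
qed

lemma idempotent_complete_CT:
  assumes "idempotent_complete D"
  shows "idempotent_complete CT"
  unfolding idempotent_complete_def
proof (intro ballI impI)
  fix M p assume "M \<in> Ob CT" "p \<in> Hom CT M M" "p \<cdot>\<^bsub>CT\<^esub> p = p"
  then obtain Z r s where "Z \<in> Ob D" "r \<in> Hom CT M (fob K Z)" "s \<in> Hom CT (fob K Z) M"
    "s \<cdot>\<^bsub>CT\<^esub> r = p" "r \<cdot>\<^bsub>CT\<^esub> s = Idt CT (fob K Z)"
    by (rule split_idempotent_CT[OF assms])
  then show "\<exists>Y\<in>Ob CT. \<exists>r\<in>Hom CT M Y. \<exists>s\<in>Hom CT Y M. s \<cdot>\<^bsub>CT\<^esub> r = p \<and> r \<cdot>\<^bsub>CT\<^esub> s = Idt CT Y"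
    using K.fob_Ob by blast
qed

text \<open>Splitting the identity of \<open>M\<close> through some \<open>fob K Z\<close> is an
  isomorphism.\<close>

lemma K_ess_surj:
  assumes "idempotent_complete D" "M \<in> Ob CT"
  obtains Z s where "Z \<in> Ob D" "s \<in> Hom CT (fob K Z) M" "iso_arr CT s"
proof -
  have "Idt CT M \<in> Hom CT M M" "Idt CT M \<cdot>\<^bsub>CT\<^esub> Idt CT M = Idt CT M"
    using monad.CT.Idt_Hom[OF assms(2)] monad.CT.Idt_left[of "Idt CT M"] by auto
  then obtain Z r s where Z: "Z \<in> Ob D" "r \<in> Hom CT M (fob K Z)" "s \<in> Hom CT (fob K Z) M"
    "s \<cdot>\<^bsub>CT\<^esub> r = Idt CT M" "r \<cdot>\<^bsub>CT\<^esub> s = Idt CT (fob K Z)"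
    by (rule split_idempotent_CT[OF assms])
  then have "iso_arr CT s"
    by (auto intro!: monad.CT.iso_arrI[of s r] simp del: monad.CT_simps)
  with Z that show ?thesis
    by blast
qed

end

locale stably_semiseparable_adjunction = semiseparable_adjunction C D F G \<eta> \<epsilon> P +
    e: stable_endotransformation D e
  for C :: "('oc, 'mc, 'zc) suspended_data_scheme" and D :: "('od, 'md, 'zd) suspended_data_scheme"
    and F :: "('oc, 'mc, 'od, 'md) functor_data" and G :: "('od, 'md, 'oc, 'mc) functor_data"
    and \<eta> :: "'oc \<Rightarrow> 'mc" and \<epsilon> :: "'od \<Rightarrow> 'md" and P :: "'od \<Rightarrow> 'od \<Rightarrow> 'mc \<Rightarrow> 'md"
    and e :: "'od \<Rightarrow> 'md" +
  assumes e_eq_idem: "X \<in> Ob D \<Longrightarrow> e X = G.idem X"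
begin

text \<open>The congruence is the kernel of \<open>G\<close>, hence also that of \<open>K\<close>,
  whose underlying arrows are those of \<open>G\<close>.\<close>

lemma coid_rel_iff_far:
  "(f, g) \<in> coid_rel D e \<longleftrightarrow>
    f \<in> Arr D \<and> g \<in> Arr D \<and> Dom D f = Dom D g \<and> Cod D f = Cod D g \<and> far G f = far G g"
  using G.idem_Comp_eq_iff[of f g] by (auto simp: e.coid_rel_iff e_eq_idem)

end

sublocale stably_semiseparable_adjunction \<subseteq> G: coidentified_functor D e C G
  by unfold_locales (simp add: coid_rel_iff_far)

sublocale stably_semiseparable_adjunction \<subseteq> K: coidentified_functor D e CT K
  by unfold_locales (simp add: coid_rel_iff_far)

context stably_semiseparable_adjunction
begin

abbreviation De where "De \<equiv> coidentifier D e"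
abbreviation L where "L \<equiv> factor_functor K"

lemma L_full_faithful: "fully_faithful De CT L"
proof -
  interpret De: suspended_category De
    by (rule e.suspended_category_De)
  interpret L: cat_functor De CT L
    by (rule K.cat_functor_factor)
  show ?thesis
  proof
    fix c d X Y assume cd: "c \<in> Hom De X Y" "d \<in> Hom De X Y" "far L c = far L d"
    then obtain f g where "f \<in> Arr D" "c = e.cls f" "g \<in> Arr D" "d = e.cls g"
      by (metis e.Arr_DeE in_Hom)
    with cd show "c = d"
      by (simp add: e.cls_eq_iff coid_rel_iff_far)
  next
    fix X Y h assume XY: "X \<in> Ob De" "Y \<in> Ob De" and h: "h \<in> Hom CT (fob L X) (fob L Y)"
    define f where "f = P X Y (far monad.U h)"
    have f: "f \<in> Arr D" "Dom D f = X" "Cod D f = Y"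
      using XY h monad.U.far_Arr[of h] by (auto simp: f_def)
    have "far K f = h"
      using K_full[of X Y h] XY h by (auto simp: f_def)
    then show "\<exists>c\<in>Hom De X Y. far L c = h"
      using f by (intro bexI[of _ "e.cls f"]) (auto simp del: K_simps)
  qed
qed

lemma L_additive: "stable_additive_functor De CT L"
proof -
  interpret De: suspended_category De
    by (rule e.suspended_category_De)
  interpret L: cat_functor De CT L
    by (rule K.cat_functor_factor)
  show ?thesis
  proof
    fix c d X Y assume "c \<in> Hom De X Y" "d \<in> Hom De X Y"
    then show "far L (c \<boxplus>\<^bsub>De\<^esub> d) = far L c \<boxplus>\<^bsub>CT\<^esub> far L d"
      by (auto elim!: e.Arr_DeE simp: G.far_Add_Arr)
  next
    show "functor_commutes_Susp De CT L"
      using K_Susp by (auto elim!: e.Arr_DeE simp: functor_commutes_Susp_def functor_eq_def)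
  qed
qed

lemma weak_equivalence_L:
  assumes "idempotent_complete D"
  shows "weak_equivalence De CT L"
proof -
  interpret L: fully_faithful De CT L
    by (rule L_full_faithful)
  show ?thesis
  proof
    fix M assume "M \<in> Ob CT"
    then obtain Z s where "Z \<in> Ob D" "s \<in> Hom CT (fob K Z) M" "iso_arr CT s"
      by (rule K_ess_surj[OF assms])
    then show "\<exists>X\<in>Ob De. \<exists>\<phi>\<in>Hom CT (fob L X) M. iso_arr CT \<phi>"
      by (intro bexI[of _ Z] bexI[of _ s]) auto
  qed
qed

lemma U_L: "functor_eq De (monad.U \<circ>\<^sub>F L) (factor_functor G)"
  by (auto simp: functor_eq_def elim!: e.Arr_DeE)

lemma L_H: "functor_eq D (L \<circ>\<^sub>F quotient_functor D e) K"
  by (auto simp: functor_eq_def)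

text \<open>The quotient functor is the identity on objects and surjective on arrows, so the
  triangle with \<open>K\<close> determines the functor.\<close>

lemma L_unique:
  assumes "functor_eq D (L' \<circ>\<^sub>F quotient_functor D e) K"
  shows "functor_eq De L' L"
  using assms by (auto simp: functor_eq_def elim!: e.Arr_DeE)

text \<open>Exactness of \<open>L\<close> is obtained for triangles reflected from
  \<open>CT\<close>, whereas those of \<open>De\<close> are prescribed through \<open>Ge\<close>;
  they agree because \<open>U\<close> after \<open>L\<close> is \<open>Ge\<close>.\<close>

lemma reflected_triangles_L:
  "reflected_triangles De L (reflected_triangles CT monad.U \<Delta>) = reflected_triangles De (factor_functor G) \<Delta>"
proof -
  interpret L: stable_additive_functor De CT L
    by (rule L_additive)
  have "far monad.U (far L c) = far (factor_functor G) c" if "c \<in> Arr De" for c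
    using U_L that by (auto simp: functor_eq_def)
  then show ?thesis
    using L.is_triangle_far by (auto simp: reflected_triangles_def is_triangle_def[of De])
qed

end

theorem corollary3p29:
  fixes C :: "('oc, 'mc) suspended_data" and \<Delta> :: "('mc \<times> 'mc \<times> 'mc) set"
    and D :: "('od, 'md) suspended_data"
    and F :: "('oc, 'mc, 'od, 'md) functor_data" and G :: "('od, 'md, 'oc, 'mc) functor_data"
    and \<eta> :: "'oc \<Rightarrow> 'mc" and \<epsilon> e :: "'od \<Rightarrow> 'md"
  assumes "pretriangulated C \<Delta>"
    and "suspended_category D" and "idempotent_complete D"
    and "suspended_adjunction C D F G \<eta> \<epsilon>"
    and "exact_functor C \<Delta> C \<Delta> (G \<circ>\<^sub>F F)"
    and "stably_semiseparable D C G"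
    and "associated_idempotent D C G e"
  shows "let T = G \<circ>\<^sub>F F; \<mu> = (\<lambda>X. far G (\<epsilon> (fob F X)));
             CT = eilenberg_moore C T \<mu> \<eta>;
             U = EM_forgetful; V = EM_free C T \<mu>; K = EM_comparison D G \<epsilon>;
             De = coidentifier D e; H = quotient_functor D e; Ge = factor_functor G;
             \<Delta>T = reflected_triangles CT U \<Delta>;
             \<Delta>e = reflected_triangles De Ge \<Delta>;
             is_Ke = (\<lambda>L. exact_functor De \<Delta>e CT \<Delta>T L \<and> cat_equivalence De CT L \<and>
                          functor_eq D (L \<circ>\<^sub>F H) K \<and> functor_eq De (U \<circ>\<^sub>F L) Ge)
         in idempotent_complete CT \<and> pretriangulated CT \<Delta>T \<and>
            left_adjoint C CT V U \<and> exact_functor CT \<Delta>T C \<Delta> U \<and> exact_functor C \<Delta> CT \<Delta>T V \<and>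
            (\<exists>L. is_Ke L \<and> (\<forall>L'. is_Ke L' \<longrightarrow> functor_eq De L' L))"
proof -
  interpret C: pretriangulated C \<Delta> by fact
  interpret suspended_adjunction C D F G \<eta> \<epsilon> by fact
  interpret GF: exact_functor C \<Delta> C \<Delta> "G \<circ>\<^sub>F F" by fact
  obtain P where P: "semiseparable_via D C G P"
    and P_Susp: "\<And>X Y g. X \<in> Ob D \<Longrightarrow> Y \<in> Ob D \<Longrightarrow> g \<in> Hom C (fob G X) (fob G Y) \<Longrightarrow>
      far (Susp D) (P X Y g) = P (fob (Susp D) X) (fob (Susp D) Y) (far (Susp C) g)"
    using assms(6) unfolding stably_semiseparable_def by blast
  obtain P' where P': "semiseparable_via D C G P'" "\<And>X. X \<in> Ob D \<Longrightarrow> e X = P' X X (Idt C (fob G X))"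
    using assms(7) unfolding associated_idempotent_def by blast
  interpret G: semiseparable_via D C G P by fact
  have e: "e X = G.idem X" if "X \<in> Ob D" for X
    using associated_idempotent_unique[OF P P'(1) that] P'(2)[OF that] by (simp add: G.idem_def)
  interpret idD: cat_functor D D id_functor
    by (rule cat_functor_id) unfold_locales
  interpret e: nat_trans D D id_functor id_functor e
    by unfold_locales (auto simp: e G.idem_natural)
  \<comment> \<open>Suspending \<open>P X X (Idt)\<close> gives \<open>P\<close> of the suspended
    identity, which is the component of \<open>e\<close> at the suspension of
    \<open>X\<close>.\<close>
  have "nat_trans_commutes_Susp D D e"
    unfolding nat_trans_commutes_Susp_def
    by (auto simp: e G.idem_def P_Susp)
  then interpret stably_semiseparable_adjunction C D F G \<eta> \<epsilon> P e
    by unfold_locales (auto simp: e)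
  interpret monad: exact_separable_monad C "G \<circ>\<^sub>F F" "\<lambda>X. far G (\<epsilon> (fob F X))" \<eta>
    "\<lambda>X. far G (cosection (fob F X))" \<Delta>
    by unfold_locales (rule GF.preserves_dist)
  have ic: "idempotent_complete CT"
    by (rule idempotent_complete_CT[OF assms(3)])
  then have pre: "pretriangulated CT monad.\<Delta>T"
    by (rule monad.pretriangulated_CT)
  interpret CT: pretriangulated CT monad.\<Delta>T
    by (rule pre)
  interpret L: stable_additive_functor De CT L
    by (rule L_additive)
  interpret L: weak_equivalence De CT L
    by (rule weak_equivalence_L[OF assms(3)])
  interpret L: reflected_along_equivalence De CT L monad.\<Delta>T
    by unfold_locales
  have "exact_functor De (reflected_triangles De (factor_functor G) \<Delta>) CT monad.\<Delta>T L"
    using L.exact_functor_reflected[OF L.pretriangulated_reflected] by (simp add: reflected_triangles_L)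
  then have "\<exists>L. (exact_functor De (reflected_triangles De (factor_functor G) \<Delta>) CT monad.\<Delta>T L \<and>
      cat_equivalence De CT L \<and> functor_eq D (L \<circ>\<^sub>F quotient_functor D e) K \<and>
      functor_eq De (monad.U \<circ>\<^sub>F L) (factor_functor G)) \<and>
    (\<forall>L'. exact_functor De (reflected_triangles De (factor_functor G) \<Delta>) CT monad.\<Delta>T L' \<and>
      cat_equivalence De CT L' \<and> functor_eq D (L' \<circ>\<^sub>F quotient_functor D e) K \<and>
      functor_eq De (monad.U \<circ>\<^sub>F L') (factor_functor G) \<longrightarrow> functor_eq De L' L)"
    using L.cat_equivalence L_H U_L L_unique by blast
  moreover have "left_adjoint C CT monad.V monad.U"
    unfolding left_adjoint_def using monad.adjunction_V_U by blast
  ultimately show ?thesis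
    unfolding Let_def
    using ic pre monad.U.exact_functor_reflected[OF pre] monad.exact_functor_V[OF pre] by blast
qed

end
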